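(* There exists a Jordan curve $\Gamma \subset \mathbb{C}$ such that for every rectifiable arc $\sigma:[0,1]\to\mathbb{C}$ whose endpoints $\sigma(0)$ and $\sigma(1)$ lie in distinct connected components of $\mathbb{C}\setminus\Gamma$, one has $$H^1\big(\sigma([0,1]) \cap \Gamma\big) > 0.$$
   Context: A curve is a continuous function $\sigma:[0,1]\to\mathbb{C}$; its trace is the image $\sigma([0,1])$. A curve is closed if $\sigma(0)=\sigma(1)$; curves that are not closed are called arcs (an arc is not required to be injective). A Jordan curve is a simple closed curve, i.e. an injective continuous image of the unit circle in the plane; $\Gamma$ is identified with its trace, and $\mathbb{C}\setminus\Gamma$ has exactly two connected components, one bounded and one unbounded. The length of a curve is $$l(\sigma)=\sup_{0=t_0\le t_1\le\dots\le t_n=1}\sum_{k=1}^n|\sigma(t_k)-\sigma(t_{k-1})|,$$ and $\sigma$ is rectifiable if $l(\sigma)<\infty$. $H^1$ denotes the one-dimensional Hausdorff measure on $\mathbb{C}$. *)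

theory Defs
  imports "HOL-Analysis.Analysis"
begin

definition jordan_curve :: "complex set \<Rightarrow> bool" where
  "jordan_curve \<Gamma> \<longleftrightarrow>
     (\<exists>\<gamma>. simple_path \<gamma> \<and> pathfinish \<gamma> = pathstart \<gamma> \<and> \<Gamma> = path_image \<gamma>)"

lemma jordan_curve_iff_circle:
  "jordan_curve \<Gamma> \<longleftrightarrow>
     (\<exists>f. continuous_on (sphere (0::complex) 1) f \<and> inj_on f (sphere 0 1) \<and> \<Gamma> = f ` sphere 0 1)"
proof
  assume "jordan_curve \<Gamma>"
  then obtain \<gamma> where "simple_path \<gamma>" "pathfinish \<gamma> = pathstart \<gamma>" "\<Gamma> = path_image \<gamma>"
    unfolding jordan_curve_def by blast
  then have "sphere (0::complex) 1 homeomorphic \<Gamma>"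
    using homeomorphic_simple_path_image_circle[of \<gamma> 1 0] homeomorphic_sym by auto
  then show "\<exists>f. continuous_on (sphere (0::complex) 1) f \<and> inj_on f (sphere 0 1) \<and> \<Gamma> = f ` sphere 0 1"
    unfolding homeomorphic_def homeomorphism_def by (metis inj_on_inverseI)
next
  assume "\<exists>f. continuous_on (sphere (0::complex) 1) f \<and> inj_on f (sphere 0 1) \<and> \<Gamma> = f ` sphere 0 1"
  then obtain f where f: "continuous_on (sphere (0::complex) 1) f" "inj_on f (sphere 0 1)"
    "\<Gamma> = f ` sphere 0 1" by blast
  let ?c = "\<lambda>t::real. cis (2 * pi * t)"
  have im: "path_image ?c = sphere 0 1"
  proof
    show "path_image ?c \<subseteq> sphere 0 1" by (auto simp: path_image_def)
    show "sphere 0 1 \<subseteq> path_image ?c"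
    proof
      fix z :: complex assume "z \<in> sphere 0 1"
      then have z: "cmod z = 1" by simp
      let ?t = "Arg2pi z / (2 * pi)"
      have "?t \<in> {0..1}"
        using Arg2pi_ge_0[of z] Arg2pi_lt_2pi[of z] by (auto simp: divide_simps)
      moreover have "z = ?c ?t"
        using Arg2pi_eq[of z] z by (simp add: cis_conv_exp)
      ultimately show "z \<in> path_image ?c" unfolding path_image_def by blast
    qed
  qed
  have "simple_path ?c"
  proof (rule simple_pathI)
    show "path ?c" unfolding path_def by (intro continuous_intros)
    fix x y :: real assume xy: "0 \<le> x" "x < y" "y \<le> 1" "?c x = ?c y"
    then have "exp (\<i> * (2 * pi * y)) = exp (\<i> * (2 * pi * x))"
      by (simp add: cis_conv_exp)
    then obtain n :: int where "\<i> * (2 * pi * y) = \<i> * (2 * pi * x) + of_int (2 * n) * pi * \<i>"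
      unfolding exp_eq by blast
    then have "2 * pi * y = 2 * pi * x + of_int (2 * n) * pi"
      by (simp add: complex_eq_iff)
    then have "2 * pi * y = 2 * pi * (x + of_int n)" by (simp add: algebra_simps)
    then have n: "y = x + of_int n" by simp
    with xy have "0 < n" by linarith
    then have "(1::real) \<le> of_int n" by linarith
    with n xy show "x = 0 \<and> y = 1" by linarith
  qed
  have "simple_path (f \<circ> ?c)"
    using f im \<open>simple_path ?c\<close> by (intro simple_path_continuous_image) simp_all
  moreover have "pathfinish (f \<circ> ?c) = pathstart (f \<circ> ?c)"
    by (simp add: pathstart_def pathfinish_def)
  moreover have "\<Gamma> = path_image (f \<circ> ?c)"
    using f(3) im by (simp add: path_image_compose)
  ultimately show "jordan_curve \<Gamma>"
    unfolding jordan_curve_def by blast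
qed

definition curve_length :: "(real \<Rightarrow> complex) \<Rightarrow> ennreal" where
  "curve_length \<sigma> =
     Sup {ennreal (\<Sum>k=1..n. cmod (\<sigma> (t k) - \<sigma> (t (k - 1)))) |n (t :: nat \<Rightarrow> real).
            t 0 = 0 \<and> t n = 1 \<and> (\<forall>k\<in>{1..n}. t (k - 1) \<le> t k)}"

definition rectifiable :: "(real \<Rightarrow> complex) \<Rightarrow> bool" where
  "rectifiable \<sigma> \<longleftrightarrow> curve_length \<sigma> < \<infinity>"

text \<open>
  The arcs here are the non-closed paths. They may cross themselves, unlike those described by
  the library constant \<^const>\<open>arc\<close>.
\<close>

definition nonclosed_arc :: "(real \<Rightarrow> complex) \<Rightarrow> bool" where
  "nonclosed_arc \<sigma> \<longleftrightarrow> path \<sigma> \<and> pathstart \<sigma> \<noteq> pathfinish \<sigma>"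

text \<open>
  One-dimensional Hausdorff (outer) measure, normalised so that a segment gets its length.
  Boundedness of the covering sets must be required separately, because
  \<^const>\<open>diameter\<close> is real-valued and has no meaningful value on unbounded sets. Covers by
  finitely many sets are included, since some of the covering sets may be empty.
\<close>

definition hausdorff_premeasure1 :: "real \<Rightarrow> complex set \<Rightarrow> ennreal" where
  "hausdorff_premeasure1 \<delta> A =
     Inf {\<Sum>i. ennreal (diameter (E i)) |E :: nat \<Rightarrow> complex set.
            A \<subseteq> (\<Union>i. E i) \<and> (\<forall>i. bounded (E i) \<and> diameter (E i) \<le> \<delta>)}"

definition hausdorff_measure1 :: "complex set \<Rightarrow> ennreal" where
  "hausdorff_measure1 A = (SUP \<delta>\<in>{0<..}. hausdorff_premeasure1 \<delta> A)"

end

theory Submission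
  imports Defs
begin

text \<open>
  The idea is to build the curve from tubes so that a crossing path has only two options at every
  scale: it cuts through the tube, which costs length inside the curve, or it follows a gap between
  neighbouring turns of the tube, which costs much total length.

  Everything happens in a plane that is 1-periodic in the real direction; the map
  \<open>z \<mapsto> exp (2 * pi * \<i> * z)\<close> wraps it around an annulus at the end. The first tube is the strip
  \<open>0 \<le> Im z \<le> 1\<close>. Given a tube with coordinates in which it is this strip, the next tube meanders
  inside it: it runs up and down along slanted columns of width \<open>p\<close> which climb the strip over a
  horizontal distance \<open>1 / s\<close>, and it leaves free only gaps that take up a share \<open>O(h)\<close> of the area.
  Gaps are open alternately to the lower and to the upper side. One such step is a homeomorphism
  \<open>step s p h\<close> of the plane, from the coordinates of a tube to those of the next one; composing them
  gives charts \<open>level s p h n\<close>, and the nested tubes \<open>Im (level s p h n z) \<in> {0..1}\<close>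
  intersect in a set that wraps to the Jordan curve.

  Why crossing is expensive: fix a level \<open>n\<close> and a later level \<open>m\<close>. There is a function on the plane
  with value 0 below the tube of level \<open>n\<close> and 1 above it, which is Lipschitz with a constant that
  does not depend on \<open>m\<close>, and which has at every point outside the tube of level \<open>m\<close> a local slope
  of at most \<open>\<delta> n\<close>, where \<open>\<delta> n \<longlonglongrightarrow> 0\<close> for odd \<open>n\<close> (\<open>potential_lipschitz\<close>, \<open>potential_off\<close>). It is
  obtained by recursion from \<open>m\<close> down to \<open>n\<close> (\<open>pull\<close>): in a gap it is a function of
  the real part alone, which climbs as slowly as the gap does, and across a column it interpolates
  between the values of the two adjacent gaps by means of the function of the next level. The columns
  fill a share \<open>1 - O(h)\<close> of each vertical line, so one step multiplies the vertical slope by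
  \<open>1 + O(h)\<close> only, and the parameters \<open>h\<close> are summable. If a path of length \<open>\<Lambda>\<close> joins the two sides,
  then the image of the path under this function contains \<open>{0..1}\<close>, while the part of the path
  outside the tube of level \<open>m\<close> contributes at most \<open>2 * \<delta> n * \<Lambda>\<close>
  (\<open>emeasure_image_off_open_le\<close>). If moreover the path meets the curve in a set of measure zero, then
  that set has a cover by small balls, by compactness the cover contains the part of the path in the
  tube of level \<open>m\<close> for large \<open>m\<close>, and the Lipschitz bound makes its contribution small too. For large
  \<open>n\<close> this is a contradiction (\<open>rectifiable_crossing_positive\<close>).

  Two demands compete in the choice of \<open>s\<close>. Small \<open>\<delta> n\<close> means that the gaps of level \<open>n\<close> are long;
  on the other hand pieces of the tube of coordinate length \<open>1 / s\<close> must shrink, for the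
  intersection to be a curve. Long gaps of small diameter exist only in a tube that already wiggles
  at a small scale. The levels therefore alternate. At an odd level \<open>s\<close> is kept
  from the level before, while the very small \<open>p\<close> of that level has made the tube extremely long.
  At every later even level \<open>s\<close> is increased so much that a piece of length \<open>1 / s\<close> is small.
\<close>

section \<open>The image of a rectifiable path under a function that is mostly flat\<close>

text \<open>
Bounds at single base points suffice because a segment can be chopped up by bisection. In this form
the maps below, which are given by cases, can be estimated at each point by the cases that
meet there.
\<close>

lemma local_to_global_bound:
  fixes f :: "'a::real_normed_vector \<Rightarrow> 'b::real_normed_vector"
  assumes loc: "\<And>z. \<forall>\<^sub>F w in nhds z. norm (f w - f z) \<le> c * norm (w - z)"
  shows "norm (f w - f z) \<le> c * norm (w - z)"
proof -
  define g where "g = (\<lambda>t. z + t *\<^sub>R (w - z))"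
  have g_diff: "g t - g s = (t - s) *\<^sub>R (w - z)" for s t
    by (simp add: g_def algebra_simps)
  have "norm (f (g 1) - f (g 0)) \<le> c * norm (w - z) * (1 - 0)"
  proof (rule Bolzano[of 0 1 "\<lambda>a b. norm (f (g b) - f (g a)) \<le> c * norm (w - z) * (b - a)"])
    show "(0::real) \<le> 1" by simp
  next
    fix a b d
    assume "norm (f (g b) - f (g a)) \<le> c * norm (w - z) * (b - a)"
      "norm (f (g d) - f (g b)) \<le> c * norm (w - z) * (d - b)"
    moreover have "norm (f (g d) - f (g a)) \<le> norm (f (g d) - f (g b)) + norm (f (g b) - f (g a))"
      using norm_triangle_ineq[of "f (g d) - f (g b)" "f (g b) - f (g a)"] by simp
    ultimately show "norm (f (g d) - f (g a)) \<le> c * norm (w - z) * (d - a)"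
      by (simp add: algebra_simps)
  next
    fix x :: real
    obtain e where e: "e > 0" "\<And>y. dist y (g x) < e \<Longrightarrow> norm (f y - f (g x)) \<le> c * norm (y - g x)"
      using loc[of "g x"] unfolding eventually_nhds_metric by blast
    have close: "norm (f (g y) - f (g x)) \<le> c * norm (w - z) * \<bar>y - x\<bar>"
      if "\<bar>y - x\<bar> < e / (norm (w - z) + 1)" for y
    proof -
      have "dist (g y) (g x) \<le> \<bar>y - x\<bar> * (norm (w - z) + 1)"
        by (simp add: dist_norm g_diff mult_left_mono)
      also have "\<dots> < e"
        using that by (simp add: pos_less_divide_eq add_nonneg_pos)
      finally have "norm (f (g y) - f (g x)) \<le> c * norm (g y - g x)" by (rule e(2))
      then show ?thesis by (simp add: g_diff mult_ac)
    qed
    show "\<exists>d>0. \<forall>a b. a \<le> x \<and> x \<le> b \<and> b - a < d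
        \<longrightarrow> norm (f (g b) - f (g a)) \<le> c * norm (w - z) * (b - a)"
    proof (intro exI[of _ "e / (norm (w - z) + 1)"] conjI allI impI)
      show "0 < e / (norm (w - z) + 1)" using e by (simp add: add_nonneg_pos)
      fix a b assume ab: "a \<le> x \<and> x \<le> b \<and> b - a < e / (norm (w - z) + 1)"
      have "norm (f (g b) - f (g a)) \<le> norm (f (g b) - f (g x)) + norm (f (g a) - f (g x))"
        by (metis norm_triangle_ineq4 diff_diff_eq2 diff_add_cancel add_diff_cancel_right)
      also have "\<dots> \<le> c * norm (w - z) * \<bar>b - x\<bar> + c * norm (w - z) * \<bar>a - x\<bar>"
        by (intro add_mono close) (use ab in auto)
      also have "\<dots> = c * norm (w - z) * (b - a)" using ab by (simp add: algebra_simps)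
      finally show "norm (f (g b) - f (g a)) \<le> c * norm (w - z) * (b - a)" .
    qed
  qed
  then show ?thesis by (simp add: g_def)
qed

text \<open>
A relation between the end points and the length of an inscribed polygon, since polygons are only
concatenated here and their vertices do not matter.
\<close>

definition polygonal_length :: "(real \<Rightarrow> complex) \<Rightarrow> real \<Rightarrow> real \<Rightarrow> real \<Rightarrow> bool" where
  "polygonal_length \<sigma> a b S \<longleftrightarrow> (\<exists>n (t :: nat \<Rightarrow> real). t 0 = a \<and> t n = b \<and>
     (\<forall>k\<in>{1..n}. t (k - 1) \<le> t k) \<and> S = (\<Sum>k=1..n. cmod (\<sigma> (t k) - \<sigma> (t (k - 1)))))"

lemma polygonal_length_segment: "a \<le> b \<Longrightarrow> polygonal_length \<sigma> a b (cmod (\<sigma> b - \<sigma> a))"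
  unfolding polygonal_length_def
  by (intro exI[of _ 1] exI[of _ "\<lambda>k. if k = 0 then a else b"]) simp

lemma polygonal_length_trans:
  assumes "polygonal_length \<sigma> a b S" "polygonal_length \<sigma> b c S'"
  shows "polygonal_length \<sigma> a c (S + S')"
proof -
  obtain n and t :: "nat \<Rightarrow> real" where t: "t 0 = a" "t n = b" "\<And>k. k \<in> {1..n} \<Longrightarrow> t (k - 1) \<le> t k"
    "S = (\<Sum>k=1..n. cmod (\<sigma> (t k) - \<sigma> (t (k - 1))))"
    using assms(1) unfolding polygonal_length_def by blast
  obtain m and r :: "nat \<Rightarrow> real" where r: "r 0 = b" "r m = c" "\<And>k. k \<in> {1..m} \<Longrightarrow> r (k - 1) \<le> r k"
    "S' = (\<Sum>k=1..m. cmod (\<sigma> (r k) - \<sigma> (r (k - 1))))"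
    using assms(2) unfolding polygonal_length_def by blast
  define q where "q = (\<lambda>k. if k \<le> n then t k else r (k - n))"
  have q_le: "q k = t k" if "k \<le> n" for k using that by (simp add: q_def)
  have q_ge: "q (k + n) = r k" for k using t(2) r(1) by (simp add: q_def)
  have q_ge': "q (k + n - 1) = r (k - 1)" if "1 \<le> k" for k
    using q_ge[of "k - 1"] that by simp
  have "(\<Sum>k=1..m+n. cmod (\<sigma> (q k) - \<sigma> (q (k - 1))))
      = (\<Sum>k=1..n. cmod (\<sigma> (q k) - \<sigma> (q (k - 1)))) + (\<Sum>k=1+n..m+n. cmod (\<sigma> (q k) - \<sigma> (q (k - 1))))"
    using sum.ub_add_nat[of 1 n "\<lambda>k. cmod (\<sigma> (q k) - \<sigma> (q (k - 1)))" m] by (simp add: add.commute)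
  also have "(\<Sum>k=1..n. cmod (\<sigma> (q k) - \<sigma> (q (k - 1)))) = S"
    unfolding t(4) by (intro sum.cong) (auto simp: q_le)
  also have "(\<Sum>k=1+n..m+n. cmod (\<sigma> (q k) - \<sigma> (q (k - 1)))) = S'"
    unfolding r(4) sum.shift_bounds_cl_nat_ivl 
  proof (intro sum.cong refl)
    fix k assume "k \<in> {1..m}"
    then show "cmod (\<sigma> (q (k + n)) - \<sigma> (q (k + n - 1))) = cmod (\<sigma> (r k) - \<sigma> (r (k - 1)))"
      using q_ge[of k] q_ge'[of k] by auto
  qed
  finally have sum: "S + S' = (\<Sum>k=1..m+n. cmod (\<sigma> (q k) - \<sigma> (q (k - 1))))" by simp
  have mono: "q (k - 1) \<le> q k" if "k \<in> {1..m+n}" for k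
  proof (cases "k \<le> n")
    case True then show ?thesis using t(3)[of k] that by (simp add: q_le)
  next
    case False
    define j where "j = k - n"
    have j: "k = j + n" "1 \<le> j" "j \<le> m" using False that unfolding j_def by auto
    then show ?thesis using r(3)[of j] q_ge[of j] q_ge'[of j] by auto
  qed
  have "q 0 = a" using t by (simp add: q_def)
  moreover have "q (m + n) = c" using q_ge[of m] r by simp
  ultimately show ?thesis unfolding polygonal_length_def using sum mono by blast
qed

lemma polygonal_length_le_curve_length:
  "polygonal_length \<sigma> 0 1 S \<Longrightarrow> ennreal S \<le> curve_length \<sigma>"
  unfolding polygonal_length_def curve_length_def by (rule Sup_upper) blast

lemma polygonal_length_nonneg: "polygonal_length \<sigma> a b S \<Longrightarrow> 0 \<le> S"
  unfolding polygonal_length_def by (auto intro: sum_nonneg)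

text \<open>
Off the open set \<open>V\<close> the function moves at most \<open>\<delta>\<close> times as fast as the path. By bisection the unit
interval falls into pieces, each of which is mapped into \<open>V\<close> or lies close to one of its end points,
the tag. A piece of the second kind has an image of measure at most \<open>2 * \<delta>\<close> times the largest
distance from the tag, and this distance is at most the length of a polygon inscribed in the piece.
The factor 2 is there because the image may extend to both sides of the value at the tag.
\<close>

lemma emeasure_image_off_open_le:
  fixes f :: "complex \<Rightarrow> real"
  assumes \<sigma>: "path \<sigma>" and f: "continuous_on UNIV f" and V: "open V" and \<delta>: "0 \<le> \<delta>"
    and loc: "\<And>t. t \<in> {0..1} \<Longrightarrow> f (\<sigma> t) \<in> V \<or>
      (\<forall>\<^sub>F w in nhds (\<sigma> t). \<bar>f w - f (\<sigma> t)\<bar> \<le> \<delta> * cmod (w - \<sigma> t))"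
  shows "\<exists>S. polygonal_length \<sigma> 0 1 S \<and> emeasure lborel (f ` \<sigma> ` {0..1} - V) \<le> ennreal (2 * \<delta> * S)"
proof -
  have cont: "continuous_on {0..1} \<sigma>" using \<sigma> by (simp add: path_def)
  have comp: "compact (f ` \<sigma> ` {a..b})" if "0 \<le> a" "b \<le> 1" for a b
    by (intro compact_continuous_image continuous_on_subset[OF f] continuous_on_subset[OF cont])
       (use that in auto)
  have meas: "f ` \<sigma> ` {a..b} - V \<in> sets lborel" if "0 \<le> a" "b \<le> 1" for a b
    using sets.Diff[OF borel_compact[OF comp[OF that]] borel_open[OF V]] by simp
  define P where "P = (\<lambda>a b. 0 \<le> a \<longrightarrow> b \<le> 1 \<longrightarrow>
    (\<exists>S. polygonal_length \<sigma> a b S \<and> emeasure lborel (f ` \<sigma> ` {a..b} - V) \<le> ennreal (2 * \<delta> * S)))"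
  have trans: "P a c" if PP: "P a b" "P b c" "a \<le> b" "b \<le> c" for a b c
    unfolding P_def
  proof (intro impI)
    have le: "0 \<le> a \<Longrightarrow> 0 \<le> b" "c \<le> 1 \<Longrightarrow> b \<le> 1" using PP by auto
    assume ac: "0 \<le> a" "c \<le> 1"
    obtain S where S: "polygonal_length \<sigma> a b S" "emeasure lborel (f ` \<sigma> ` {a..b} - V) \<le> ennreal (2 * \<delta> * S)"
      using PP(1,2) le ac unfolding P_def by blast
    obtain S' where S': "polygonal_length \<sigma> b c S'" "emeasure lborel (f ` \<sigma> ` {b..c} - V) \<le> ennreal (2 * \<delta> * S')"
      using PP(1,2) le ac unfolding P_def by blast
    have "f ` \<sigma> ` {a..c} - V = (f ` \<sigma> ` {a..b} - V) \<union> (f ` \<sigma> ` {b..c} - V)"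
      using ivl_disj_un_two_touch(4)[OF PP(3,4)] by (metis Un_Diff image_Un)
    moreover have "emeasure lborel ((f ` \<sigma> ` {a..b} - V) \<union> (f ` \<sigma> ` {b..c} - V))
        \<le> emeasure lborel (f ` \<sigma> ` {a..b} - V) + emeasure lborel (f ` \<sigma> ` {b..c} - V)"
      by (intro emeasure_subadditive meas) (use le ac in auto)
    ultimately have "emeasure lborel (f ` \<sigma> ` {a..c} - V)
        \<le> emeasure lborel (f ` \<sigma> ` {a..b} - V) + emeasure lborel (f ` \<sigma> ` {b..c} - V)" by simp
    also have "\<dots> \<le> ennreal (2 * \<delta> * S) + ennreal (2 * \<delta> * S')"
      by (intro add_mono S S')
    also have "\<dots> = ennreal (2 * \<delta> * (S + S'))"
      using polygonal_length_nonneg[OF S(1)] polygonal_length_nonneg[OF S'(1)] \<delta>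
      by (simp add: distrib_left flip: ennreal_plus)
    finally show "\<exists>S. polygonal_length \<sigma> a c S \<and> emeasure lborel (f ` \<sigma> ` {a..c} - V) \<le> ennreal (2 * \<delta> * S)"
      using polygonal_length_trans[OF S(1) S'(1)] by blast
  qed
  have small: "P a b" if x: "x \<in> {a, b}" "a \<le> b" and bd: "\<And>y. y \<in> {a..b} \<Longrightarrow> y \<in> {0..1} \<Longrightarrow>
      \<bar>f (\<sigma> y) - f (\<sigma> x)\<bar> \<le> \<delta> * cmod (\<sigma> y - \<sigma> x)" for a b x
    unfolding P_def
  proof (intro impI)
    assume ab: "0 \<le> a" "b \<le> 1"
    \<comment> \<open>The point at which the deviation from the tag is largest becomes a vertex of the polygon.\<close>
    obtain c where c: "c \<in> {a..b}" "\<And>y. y \<in> {a..b} \<Longrightarrow> cmod (\<sigma> y - \<sigma> x) \<le> cmod (\<sigma> c - \<sigma> x)"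
    proof -
      have "continuous_on {a..b} (\<lambda>y. cmod (\<sigma> y - \<sigma> x))"
        by (intro continuous_intros continuous_on_subset[OF cont]) (use ab in auto)
      then show thesis using continuous_attains_sup[of "{a..b}" "\<lambda>y. cmod (\<sigma> y - \<sigma> x)"] that x
        by (metis atLeastAtMost_iff compact_Icc empty_iff order_refl)
    qed
    define r where "r = \<delta> * cmod (\<sigma> c - \<sigma> x)"
    have "f ` \<sigma> ` {a..b} - V \<subseteq> {f (\<sigma> x) - r..f (\<sigma> x) + r}"
    proof -
      have "\<bar>f (\<sigma> y) - f (\<sigma> x)\<bar> \<le> r" if "y \<in> {a..b}" for y
        using bd[of y] mult_left_mono[OF c(2)[OF that] \<delta>] that ab unfolding r_def by simp
      then show ?thesis by (force simp: abs_le_iff)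
    qed
    then have "emeasure lborel (f ` \<sigma> ` {a..b} - V) \<le> emeasure lborel {f (\<sigma> x) - r..f (\<sigma> x) + r}"
      by (intro emeasure_mono) auto
    also have "\<dots> = ennreal (2 * r)" using \<delta> by (simp add: r_def)
    finally have 1: "emeasure lborel (f ` \<sigma> ` {a..b} - V) \<le> ennreal (2 * r)" .
    have pl: "polygonal_length \<sigma> a b (cmod (\<sigma> c - \<sigma> a) + cmod (\<sigma> b - \<sigma> c))"
      using c polygonal_length_trans[OF polygonal_length_segment polygonal_length_segment] by simp
    have "r \<le> \<delta> * (cmod (\<sigma> c - \<sigma> a) + cmod (\<sigma> b - \<sigma> c))"
      unfolding r_def using x \<delta> by (intro mult_left_mono) (auto simp: norm_minus_commute)
    then have "ennreal (2 * r) \<le> ennreal (2 * \<delta> * (cmod (\<sigma> c - \<sigma> a) + cmod (\<sigma> b - \<sigma> c)))"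
      by (intro ennreal_leI) (simp add: mult.assoc)
    with 1 pl show "\<exists>S. polygonal_length \<sigma> a b S \<and>
        emeasure lborel (f ` \<sigma> ` {a..b} - V) \<le> ennreal (2 * \<delta> * S)" by (meson order_trans)
  qed
  have "P 0 1"
  proof (rule Bolzano[of 0 1 P])
    show "(0::real) \<le> 1" by simp
    show "P a c" if "P a b" "P b c" "a \<le> b" "b \<le> c" for a b c using trans that by blast
    fix x :: real assume x: "0 \<le> x" "x \<le> 1"
    show "\<exists>d>0. \<forall>a b. a \<le> x \<and> x \<le> b \<and> b - a < d \<longrightarrow> P a b"
    proof (cases "f (\<sigma> x) \<in> V")
      case True
      have "continuous_on {0..1} (\<lambda>t. f (\<sigma> t))"
        by (intro continuous_on_compose2[OF f cont]) auto
      then have "\<forall>\<^sub>F y in at x within {0..1}. f (\<sigma> y) \<in> V"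
        using x V True unfolding continuous_on_def tendsto_def by auto
      then obtain d where d: "d > 0" "\<And>y. y \<in> {0..1} \<Longrightarrow> dist y x < d \<Longrightarrow> f (\<sigma> y) \<in> V"
        using True unfolding eventually_at by metis
      show ?thesis
      proof (intro exI[of _ d] conjI d allI impI)
        fix a b assume ab: "a \<le> x \<and> x \<le> b \<and> b - a < d"
        show "P a b" unfolding P_def
        proof (intro impI)
          assume "0 \<le> a" "b \<le> 1"
          then have "f (\<sigma> y) \<in> V" if "y \<in> {a..b}" for y
            using that ab by (intro d) (auto simp: dist_real_def)
          then have "f ` \<sigma> ` {a..b} - V = {}" by auto
          then show "\<exists>S. polygonal_length \<sigma> a b S \<and>
              emeasure lborel (f ` \<sigma> ` {a..b} - V) \<le> ennreal (2 * \<delta> * S)"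
            using polygonal_length_segment[of a b \<sigma>] ab by (metis emeasure_empty order_trans zero_le)
        qed
      qed
    next
      case False
      then obtain e where e: "e > 0" "\<And>w. dist w (\<sigma> x) < e \<Longrightarrow> \<bar>f w - f (\<sigma> x)\<bar> \<le> \<delta> * cmod (w - \<sigma> x)"
        using loc[of x] x unfolding eventually_nhds_metric by auto
      obtain d where d: "d > 0" "\<And>y. y \<in> {0..1} \<Longrightarrow> dist y x < d \<Longrightarrow> dist (\<sigma> y) (\<sigma> x) < e"
        using cont x e(1) unfolding continuous_on_iff by (metis atLeastAtMost_iff)
      show ?thesis
      proof (intro exI[of _ d] conjI d allI impI)
        fix a b assume ab: "a \<le> x \<and> x \<le> b \<and> b - a < d"
        have bd: "\<bar>f (\<sigma> y) - f (\<sigma> x)\<bar> \<le> \<delta> * cmod (\<sigma> y - \<sigma> x)" if "y \<in> {a..b}" "y \<in> {0..1}" for y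
          using that ab by (intro e d) (auto simp: dist_real_def)
        have "P a x" "P x b" using ab by (intro small[of x] bd; auto)+
        then show "P a b" using trans ab by blast
      qed
    qed
  qed
  then show ?thesis by (simp add: P_def)
qed

section \<open>One meander\<close>

text \<open>
Horizontal and vertical slopes are kept apart because only the vertical one has to be controlled up
to a factor close to 1. The bound compares with one base point only, which makes it stable
under gluing.
\<close>

definition slope_bound :: "(complex \<Rightarrow> real) \<Rightarrow> complex \<Rightarrow> real \<Rightarrow> real \<Rightarrow> bool" where
  "slope_bound f z a b \<longleftrightarrow>
     (\<forall>\<^sub>F w in nhds z. \<bar>f w - f z\<bar> \<le> a * \<bar>Re w - Re z\<bar> + b * \<bar>Im w - Im z\<bar>)"

text \<open>
The slope \<open>1 + 5 * h\<close> is large enough for a plateau of length \<open>2 * h\<close> at either end of the unit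
interval, yet it costs only a factor \<open>1 + O(h)\<close>.
\<close>

definition clip :: "real \<Rightarrow> real \<Rightarrow> real" where
  "clip h t = max 0 (min 1 (1/2 + (1 + 5 * h) * (t - 1/2)))"

lemma clip_nonneg: "0 \<le> clip h t" and clip_le_1: "clip h t \<le> 1"
  by (auto simp: clip_def)

lemma clip_eq_0:
  assumes "0 < h" "h \<le> 1/20" "t \<le> 2 * h" shows "clip h t = 0"
proof -
  have "(1 + 5 * h) * (t - 1/2) \<le> (1 + 5 * h) * (2 * h - 1/2)"
    using assms by (intro mult_left_mono) auto
  also have "\<dots> = 10 * h * h - h / 2 - 1/2" by (simp add: algebra_simps)
  also have "\<dots> \<le> - 1/2" using mult_left_mono[of h "1/20" "10 * h"] assms by simp
  finally show ?thesis by (simp add: clip_def)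
qed

lemma clip_eq_1:
  assumes "0 < h" "h \<le> 1/20" "1 - 2 * h \<le> t" shows "clip h t = 1"
proof -
  have "(1 + 5 * h) * (1/2 - 2 * h) \<le> (1 + 5 * h) * (t - 1/2)"
    using assms by (intro mult_left_mono) auto
  moreover have "(1 + 5 * h) * (1/2 - 2 * h) = h / 2 + 1/2 - 10 * h * h" by (simp add: algebra_simps)
  moreover have "10 * h * h \<le> h / 2" using mult_left_mono[of h "1/20" "10 * h"] assms by simp
  ultimately have "1/2 \<le> (1 + 5 * h) * (t - 1/2)" by linarith
  then show ?thesis by (simp add: clip_def)
qed

lemma clip_lipschitz: "0 \<le> h \<Longrightarrow> \<bar>clip h t - clip h t'\<bar> \<le> (1 + 5 * h) * \<bar>t - t'\<bar>"
proof -
  assume h: "0 \<le> h"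
  have "\<bar>clip h t - clip h t'\<bar> \<le> \<bar>(1 + 5 * h) * (t - 1/2) - (1 + 5 * h) * (t' - 1/2)\<bar>"
    unfolding clip_def by linarith
  also have "\<dots> = \<bar>(1 + 5 * h) * (t - t')\<bar>" by (simp add: algebra_simps)
  finally show ?thesis using h by (simp add: abs_mult)
qed

lemma clip_mono: "0 \<le> h \<Longrightarrow> t \<le> t' \<Longrightarrow> clip h t \<le> clip h t'"
  unfolding clip_def by (intro max.mono min.mono add_mono mult_left_mono) auto

lemma clip_close:
  assumes "0 \<le> h" "0 \<le> t" "t \<le> 1" shows "\<bar>clip h t - t\<bar> \<le> 3 * h"
proof -
  have "\<bar>1/2 + (1 + 5 * h) * (t - 1/2) - t\<bar> = 5 * h * \<bar>t - 1/2\<bar>"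
  proof -
    have "1/2 + (1 + 5 * h) * (t - 1/2) - t = (5 * h) * (t - 1/2)" by (simp add: algebra_simps)
    then show ?thesis using assms by (simp add: abs_mult)
  qed
  also have "\<dots> \<le> 5 * h * (1/2)" using assms by (intro mult_left_mono) (auto simp: abs_if)
  finally show ?thesis using assms unfolding clip_def by linarith
qed

text \<open>
The progress along the tube while it passes through one column, as a function of the offset \<open>e\<close> from
the left border of the column. For \<open>h \<le> e \<le> 1 - h\<close> the value is \<open>1 - \<omega>\<close>, where \<open>\<omega>\<close> will be read off
from the height. The two steep pieces near the borders only serve to
make the value 0 and 1 there for every \<open>\<omega>\<close>, so that adjacent columns fit together; inside the tube the
factor in front of the steep piece vanishes.
\<close>

definition lane :: "real \<Rightarrow> real \<Rightarrow> real \<Rightarrow> real" where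
  "lane h \<omega> e = (1 - \<omega>) * min 1 (e / h) + \<omega> * max 0 (1 - (1 - e) / h)"

text \<open>
Almost constant for heights in \<open>{h..1 - h}\<close>, where the tube runs straight along its column, and very
steep outside, where it turns round the end of a gap and stays inside the unit strip.
\<close>

definition rise :: "real \<Rightarrow> real \<Rightarrow> real" where
  "rise h v = h * (v - 1/2) + (4 / h) * (max 0 (v - 1 + h) - max 0 (h - v))"

text \<open>
The lines on which this is constant are the slanted lines that ascend by 1 over a horizontal distance
of \<open>1 / s\<close>. The columns of the meander lie between its consecutive integer values.
\<close>

definition skew :: "real \<Rightarrow> real \<Rightarrow> complex \<Rightarrow> real" where
  "skew s p z = (Re z - Im z / s) / p"

text \<open>
Even columns are passed downwards and odd columns upwards.
\<close>

definition turn :: "real \<Rightarrow> int \<Rightarrow> real \<Rightarrow> real" where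
  "turn h k v = (if even k then clip h v else 1 - clip h v)"

text \<open>
The new coordinates on column \<open>k\<close>. The imaginary part grows across the column, from left to right
if \<open>k\<close> is even and from right to left otherwise, and the factor \<open>1 + 5 * h\<close> makes it leave \<open>{0..1}\<close> near both
borders: these are the gaps. Around an even border the gap belongs to the lower side, around an odd
one to the upper side. The real part is \<open>p\<close> times the progress along the tube; the
small multiple of \<open>skew s p z\<close> makes it strictly increasing at fixed height.
\<close>

definition col_step :: "real \<Rightarrow> real \<Rightarrow> real \<Rightarrow> int \<Rightarrow> complex \<Rightarrow> complex" where
  "col_step s p h k z = (let e = skew s p z - k in
     Complex (p * (p * skew s p z + (1 - p) * (k + lane h (turn h k (Im z)) e)))
             (1/2 + (1 + 5 * h) * ((if even k then e else 1 - e) - 1/2) + rise h (Im z)))"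

definition step :: "real \<Rightarrow> real \<Rightarrow> real \<Rightarrow> complex \<Rightarrow> complex" where
  "step s p h z = col_step s p h \<lfloor>skew s p z\<rfloor> z"

text \<open>
The product \<open>s * p\<close> is the height that the slanted lines gain over the width of a column. Since it is at most
\<open>h / 2\<close>, it does not lead out of the plateaus of \<open>clip\<close>, of length \<open>2 * h\<close>, from heights within
\<open>3 * h / 2\<close> of 0 or 1; these heights include the bends of the tube.
\<close>

locale meander =
  fixes s p h :: real
  assumes s: "1 \<le> s" and p: "0 < p" "p \<le> 1/2" and h: "0 < h" "h \<le> 1/20" and sp: "s * p \<le> h / 2"
begin

abbreviation "N \<equiv> step s p h"
abbreviation "\<tau> \<equiv> skew s p"

lemma lane_0: "lane h \<omega> 0 = 0" and lane_1: "lane h \<omega> 1 = 1"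
  using h by (auto simp: lane_def min_def max_def)

lemma lane_nonneg: "0 \<le> \<omega> \<Longrightarrow> \<omega> \<le> 1 \<Longrightarrow> 0 \<le> e \<Longrightarrow> 0 \<le> lane h \<omega> e"
  using h by (simp add: lane_def)

lemma lane_le_1: "0 \<le> \<omega> \<Longrightarrow> \<omega> \<le> 1 \<Longrightarrow> e \<le> 1 \<Longrightarrow> lane h \<omega> e \<le> 1"
  using h unfolding lane_def by (intro convex_bound_le) auto

lemma lane_mono: "0 \<le> \<omega> \<Longrightarrow> \<omega> \<le> 1 \<Longrightarrow> e \<le> e' \<Longrightarrow> lane h \<omega> e \<le> lane h \<omega> e'"
  using h unfolding lane_def
  by (intro add_mono mult_left_mono max.mono min.mono diff_left_mono divide_right_mono) auto

lemma lane_diff: "lane h \<omega> e = min 1 (e / h) - \<omega> * (min 1 (e / h) - max 0 (1 - (1 - e) / h))"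
  by (simp add: lane_def algebra_simps)

lemma lane_gap: "0 \<le> e \<Longrightarrow> e \<le> 1 \<Longrightarrow> max 0 (1 - (1 - e) / h) \<le> min 1 (e / h)"
  using h by (auto simp: field_simps)

lemma lane_antimono: "\<omega>' \<le> \<omega> \<Longrightarrow> 0 \<le> e \<Longrightarrow> e \<le> 1 \<Longrightarrow> lane h \<omega> e \<le> lane h \<omega>' e"
  unfolding lane_diff using lane_gap[of e] by (intro diff_left_mono mult_right_mono) auto

lemma turn_range: "0 \<le> turn h k v" "turn h k v \<le> 1"
  by (auto simp: turn_def clip_nonneg clip_le_1)

text \<open>
The formulas of adjacent columns agree on the common border, so each of them may be used on the
closed column.
\<close>

lemma col_step_eq:
  assumes "of_int k \<le> \<tau> z" "\<tau> z \<le> of_int k + 1"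
  shows "N z = col_step s p h k z"
proof (cases "\<tau> z = of_int k + 1")
  case True
  then have fl: "\<lfloor>\<tau> z\<rfloor> = k + 1" by (simp add: floor_unique)
  show ?thesis unfolding step_def fl
    by (simp add: col_step_def Let_def True lane_0 lane_1 algebra_simps)
next
  case False
  then have "\<lfloor>\<tau> z\<rfloor> = k" using assms by (simp add: floor_eq_iff)
  then show ?thesis by (simp add: step_def)
qed

lemma between_integers:
  fixes t :: real
  obtains k :: int where "of_int k \<le> t" "t < of_int k + 1"
  using of_int_floor_le[of t] real_of_int_floor_add_one_gt[of t] by blast

lemma lipschitz_min: "\<bar>min 1 (e / h) - min 1 (e' / h)\<bar> \<le> \<bar>e - e'\<bar> / h"
proof -
  have "\<bar>min 1 (e / h) - min 1 (e' / h)\<bar> \<le> \<bar>e / h - e' / h\<bar>" by linarith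
  then show ?thesis using h by (simp add: diff_divide_distrib[symmetric])
qed

lemma lipschitz_max: "\<bar>max 0 (1 - (1 - e) / h) - max 0 (1 - (1 - e') / h)\<bar> \<le> \<bar>e - e'\<bar> / h"
proof -
  have "\<bar>max 0 (1 - (1 - e) / h) - max 0 (1 - (1 - e') / h)\<bar> \<le> \<bar>(1 - e') / h - (1 - e) / h\<bar>" by linarith
  then show ?thesis using h by (simp add: diff_divide_distrib[symmetric])
qed

lemma lipschitz_lane:
  assumes "0 \<le> \<omega>" "\<omega> \<le> 1" "0 \<le> e'" "e' \<le> 1"
  shows "\<bar>lane h \<omega> e - lane h \<omega>' e'\<bar> \<le> \<bar>e - e'\<bar> / h + \<bar>\<omega> - \<omega>'\<bar>"
proof -
  define A B where "A = (\<lambda>e. min 1 (e / h))" and "B = (\<lambda>e. max 0 (1 - (1 - e) / h))"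
  have "lane h \<omega> e - lane h \<omega>' e' = ((1 - \<omega>) * (A e - A e') + \<omega> * (B e - B e')) + (\<omega> - \<omega>') * (B e' - A e')"
    by (simp add: lane_def A_def B_def algebra_simps)
  moreover have "\<bar>(1 - \<omega>) * (A e - A e') + \<omega> * (B e - B e')\<bar> \<le> \<bar>e - e'\<bar> / h"
  proof -
    have "\<bar>(1 - \<omega>) * (A e - A e') + \<omega> * (B e - B e')\<bar> \<le> (1 - \<omega>) * \<bar>A e - A e'\<bar> + \<omega> * \<bar>B e - B e'\<bar>"
      using assms abs_triangle_ineq[of "(1 - \<omega>) * (A e - A e')" "\<omega> * (B e - B e')"] by (simp add: abs_mult)
    also have "\<dots> \<le> \<bar>e - e'\<bar> / h"
      using assms lipschitz_min lipschitz_max by (intro convex_bound_le) (auto simp: A_def B_def)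
    finally show ?thesis .
  qed
  moreover have "\<bar>(\<omega> - \<omega>') * (B e' - A e')\<bar> \<le> \<bar>\<omega> - \<omega>'\<bar> * 1"
    unfolding abs_mult using lane_gap[OF assms(3,4)] assms h
    by (intro mult_left_mono) (auto simp: A_def B_def abs_le_iff)
  ultimately show ?thesis using abs_triangle_ineq[of "(1 - \<omega>) * (A e - A e') + \<omega> * (B e - B e')" "(\<omega> - \<omega>') * (B e' - A e')"]
    by (metis add_mono mult.right_neutral order_trans)
qed

lemma lipschitz_turn: "\<bar>turn h k v - turn h k v'\<bar> \<le> (1 + 5 * h) * \<bar>v - v'\<bar>"
  using clip_lipschitz[of h v v'] h by (auto simp: turn_def abs_minus_commute)

lemma lipschitz_rise: "\<bar>rise h v - rise h v'\<bar> \<le> (h + 8 / h) * \<bar>v - v'\<bar>"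
proof -
  define m n where "m = max 0 (v - 1 + h) - max 0 (v' - 1 + h)" and "n = max 0 (h - v) - max 0 (h - v')"
  have mn: "\<bar>m\<bar> \<le> \<bar>v - v'\<bar>" "\<bar>n\<bar> \<le> \<bar>v - v'\<bar>" by (auto simp: m_def n_def max_def)
  have "rise h v - rise h v' = h * (v - v') + (4 / h) * (m - n)"
    by (simp add: rise_def m_def n_def algebra_simps)
  then have "\<bar>rise h v - rise h v'\<bar> \<le> \<bar>h * (v - v')\<bar> + \<bar>(4 / h) * (m - n)\<bar>" by linarith
  also have "\<dots> = h * \<bar>v - v'\<bar> + (4 / h) * \<bar>m - n\<bar>" unfolding abs_mult using h by simp
  also have "\<dots> \<le> h * \<bar>v - v'\<bar> + (4 / h) * (2 * \<bar>v - v'\<bar>)"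
  proof -
    have "\<bar>m - n\<bar> \<le> \<bar>v - v'\<bar> + \<bar>v - v'\<bar>"
      by (rule order_trans[OF abs_triangle_ineq4 add_mono[OF mn]])
    then show ?thesis using h by (intro add_left_mono mult_left_mono) auto
  qed
  finally show ?thesis by (simp add: algebra_simps)
qed

lemma rise_strict_mono: "v < v' \<Longrightarrow> rise h v < rise h v'"
proof -
  assume "v < v'"
  then have "h * (v - 1/2) < h * (v' - 1/2)" using h by simp
  moreover have "(4 / h) * (max 0 (v - 1 + h) - max 0 (h - v)) \<le> (4 / h) * (max 0 (v' - 1 + h) - max 0 (h - v'))"
    using h \<open>v < v'\<close> by (intro mult_left_mono) auto
  ultimately show ?thesis by (simp add: rise_def)
qed

lemma skew_diff: "\<bar>\<tau> z - \<tau> w\<bar> \<le> (\<bar>Re z - Re w\<bar> + \<bar>Im z - Im w\<bar> / s) / p"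
proof -
  have "\<tau> z - \<tau> w = ((Re z - Re w) - (Im z - Im w) / s) / p"
    by (simp add: skew_def diff_divide_distrib)
  then have "\<bar>\<tau> z - \<tau> w\<bar> = \<bar>(Re z - Re w) - (Im z - Im w) / s\<bar> / p" using p by simp
  also have "\<dots> \<le> (\<bar>Re z - Re w\<bar> + \<bar>(Im z - Im w) / s\<bar>) / p"
    using p by (intro divide_right_mono abs_triangle_ineq4) auto
  finally show ?thesis using s by simp
qed

lemma skew_tendsto: "(\<tau> \<longlongrightarrow> \<tau> z) (nhds z)"
  unfolding skew_def using p s by (intro tendsto_intros filterlim_ident) auto

lemma continuous_skew [continuous_intros]: "continuous_on A \<tau>"
  unfolding skew_def using p s by (intro continuous_intros) auto

lemma eventually_same_column:
  "\<forall>\<^sub>F w in nhds z. \<exists>k. of_int k \<le> \<tau> z \<and> \<tau> z \<le> of_int k + 1 \<and> of_int k \<le> \<tau> w \<and> \<tau> w \<le> of_int k + 1"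
proof -
  obtain k :: int where k: "of_int k \<le> \<tau> z" "\<tau> z < of_int k + 1" by (rule between_integers)
  have "\<forall>\<^sub>F w in nhds z. \<tau> w > (if \<tau> z = k then of_int k - 1 else of_int k)"
    using k by (intro order_tendstoD(1)[OF skew_tendsto]) auto
  moreover have "\<forall>\<^sub>F w in nhds z. \<tau> w < of_int k + 1"
    by (rule order_tendstoD(2)[OF skew_tendsto k(2)])
  ultimately show ?thesis
  proof eventually_elim
    case (elim w)
    show ?case
    proof (cases "of_int k \<le> \<tau> w")
      case True then show ?thesis using elim k by (intro exI[of _ k]) auto
    next
      case False then show ?thesis using elim k by (intro exI[of _ "k - 1"]) (auto split: if_splits)
    qed
  qed
qed

lemma col_step_lipschitz:
  assumes k: "of_int k \<le> \<tau> z" "\<tau> z \<le> of_int k + 1"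
  shows "cmod (col_step s p h k w - col_step s p h k z) \<le> (2 * (4 + 2/h + 2/p + 8 / h + 4/(h*p))) * cmod (w - z)"
    (is "_ \<le> (2 * ?L) * _")
proof -
  define d where "d = cmod (w - z)"
  have d: "\<bar>Re w - Re z\<bar> \<le> d" "\<bar>Im w - Im z\<bar> \<le> d" "0 \<le> d"
    using abs_Re_le_cmod[of "w - z"] abs_Im_le_cmod[of "w - z"] by (auto simp: d_def)
  have pos: "0 < h * p" using h p by simp
  have t: "\<bar>\<tau> w - \<tau> z\<bar> \<le> 2 * d / p"
  proof -
    have "\<bar>Im w - Im z\<bar> / s \<le> \<bar>Im w - Im z\<bar> / 1" using s by (intro divide_left_mono) auto
    then have "(\<bar>Re w - Re z\<bar> + \<bar>Im w - Im z\<bar> / s) / p \<le> (2 * d) / p"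
      using p d by (intro divide_right_mono) auto
    then show ?thesis using skew_diff[of w z] by linarith
  qed
  have th: "\<bar>\<tau> w - \<tau> z\<bar> / h \<le> 2 * d / p / h" using t h by (intro divide_right_mono) auto
  have c: "(1 + 5 * h) * x \<le> 2 * x" if "0 \<le> x" for x using that h by (intro mult_right_mono) auto
  have ln: "\<bar>lane h (turn h k (Im w)) (\<tau> w - k) - lane h (turn h k (Im z)) (\<tau> z - k)\<bar> \<le> 2 * d / p / h + 2 * d"
    using lipschitz_lane[OF turn_range[of k "Im w"], of "\<tau> z - k" "\<tau> w - k" "turn h k (Im z)"]
      lipschitz_turn[of k "Im w" "Im z"] c[of "\<bar>Im w - Im z\<bar>"] k d th by simp
  have "Re (col_step s p h k w) - Re (col_step s p h k z) = p * (p * (\<tau> w - \<tau> z)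
      + (1 - p) * (lane h (turn h k (Im w)) (\<tau> w - k) - lane h (turn h k (Im z)) (\<tau> z - k)))"
    by (simp add: col_step_def Let_def algebra_simps)
  then have "\<bar>Re (col_step s p h k w) - Re (col_step s p h k z)\<bar> = p * \<bar>p * (\<tau> w - \<tau> z)
      + (1 - p) * (lane h (turn h k (Im w)) (\<tau> w - k) - lane h (turn h k (Im z)) (\<tau> z - k))\<bar>"
    using p by (simp add: abs_mult)
  also have "\<dots> \<le> 1 * (p * \<bar>\<tau> w - \<tau> z\<bar> + (1 - p) * \<bar>lane h (turn h k (Im w)) (\<tau> w - k) - lane h (turn h k (Im z)) (\<tau> z - k)\<bar>)"
    using p by (intro mult_mono order_trans[OF abs_triangle_ineq]) (auto simp: abs_mult)
  also have "\<dots> \<le> 1 * (1 * (2 * d / p) + 1 * (2 * d / p / h + 2 * d))"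
    using p t ln by (intro mult_left_mono add_mono mult_mono) auto
  also have "\<dots> \<le> ?L * d"
  proof -
    have "1 * (1 * (2 * d / p) + 1 * (2 * d / p / h + 2 * d)) = (2 / p + 2 / (h * p) + 2) * d"
      by (simp add: algebra_simps)
    also have "\<dots> \<le> ?L * d"
    proof (rule mult_right_mono)
      have "2 / (h * p) \<le> 4 / (h * p)" "0 \<le> 2 / h" "0 \<le> 8 / h" using h p by (auto intro: divide_right_mono)
      then show "2 / p + 2 / (h * p) + 2 \<le> ?L" by linarith
    qed (rule d(3))
    finally show ?thesis .
  qed
  finally have re: "\<bar>Re (col_step s p h k w) - Re (col_step s p h k z)\<bar> \<le> ?L * d" .
  have "Im (col_step s p h k w) - Im (col_step s p h k z) =
      (1 + 5 * h) * ((if even k then \<tau> w - \<tau> z else \<tau> z - \<tau> w)) + (rise h (Im w) - rise h (Im z))"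
    by (simp add: col_step_def Let_def algebra_simps)
  then have "\<bar>Im (col_step s p h k w) - Im (col_step s p h k z)\<bar> \<le> \<bar>(1 + 5 * h) * (if even k then \<tau> w - \<tau> z else \<tau> z - \<tau> w)\<bar>
       + \<bar>rise h (Im w) - rise h (Im z)\<bar>" by linarith
  also have "\<bar>(1 + 5 * h) * (if even k then \<tau> w - \<tau> z else \<tau> z - \<tau> w)\<bar> = (1 + 5 * h) * \<bar>\<tau> w - \<tau> z\<bar>"
    using h by (simp add: abs_mult abs_minus_commute)
  also have "\<dots> \<le> 2 * (2 * d / p)" using c[of "\<bar>\<tau> w - \<tau> z\<bar>"] t by simp
  also have "\<bar>rise h (Im w) - rise h (Im z)\<bar> \<le> (h + 8 / h) * d"
    using lipschitz_rise[of "Im w" "Im z"] mult_left_mono[OF d(2), of "h + 8/h"] h by simp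
  also have "2 * (2 * d / p) + (h + 8 / h) * d \<le> ?L * d"
  proof -
    have "4 / p \<le> 4 / (h * p)" using h p by (intro divide_left_mono) auto
    moreover have "0 \<le> 2 / h" "0 \<le> 8 / h" "0 \<le> 2 / p" "0 \<le> 4 / (h * p)" using h p by auto
    ultimately have "4 / p + (h + 8 / h) \<le> ?L" using h by linarith
    then have "(4 / p + (h + 8 / h)) * d \<le> ?L * d" using d by (intro mult_right_mono) auto
    then show ?thesis by (simp add: algebra_simps)
  qed
  finally have im: "\<bar>Im (col_step s p h k w) - Im (col_step s p h k z)\<bar> \<le> ?L * d" by simp
  have "cmod (col_step s p h k w - col_step s p h k z) \<le> ?L * d + ?L * d"
    using cmod_le[of "col_step s p h k w - col_step s p h k z"] re im unfolding minus_complex.sel by linarith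
  then show ?thesis by (simp add: d_def algebra_simps)
qed

lemma step_lipschitz: "\<exists>L\<ge>1. \<forall>z w. cmod (N w - N z) \<le> L * cmod (w - z)"
proof -
  define L where "L = 2 * (4 + 2/h + 2/p + 8 / h + 4/(h*p))"
  have "cmod (N w - N z) \<le> L * cmod (w - z)" for w z
  proof (rule local_to_global_bound)
    fix z
    show "\<forall>\<^sub>F w in nhds z. cmod (N w - N z) \<le> L * cmod (w - z)"
      using eventually_same_column[of z]
      by eventually_elim (use col_step_eq col_step_lipschitz in \<open>auto simp: L_def\<close>)
  qed
  moreover have "1 \<le> L" using h p by (simp add: L_def add_increasing2)
  ultimately show ?thesis by blast
qed

lemma step_continuous: "continuous_on A N"
proof -
  obtain L where L: "L \<ge> 1" "\<And>z w. cmod (N w - N z) \<le> L * cmod (w - z)" using step_lipschitz by blast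
  have "L-lipschitz_on A N" using L by (intro lipschitz_onI) (auto simp: dist_norm)
  then show ?thesis by (rule lipschitz_on_continuous_on)
qed

lemma Re_step: "of_int k \<le> \<tau> z \<Longrightarrow> \<tau> z \<le> of_int k + 1 \<Longrightarrow>
    Re (N z) = p * (p * \<tau> z + (1 - p) * (k + lane h (turn h k (Im z)) (\<tau> z - k)))"
  and Im_step: "of_int k \<le> \<tau> z \<Longrightarrow> \<tau> z \<le> of_int k + 1 \<Longrightarrow>
    Im (N z) = 1/2 + (1 + 5 * h) * ((if even k then \<tau> z - k else 1 - (\<tau> z - k)) - 1/2) + rise h (Im z)"
  by (simp_all add: col_step_eq col_step_def Let_def)

text \<open>
Columns are mapped into columns. This makes the step injective across columns and bounds the
displacement along the tube.
\<close>

lemma Re_step_column: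
  assumes "of_int k \<le> \<tau> z" "\<tau> z \<le> of_int k + 1"
  shows "p * of_int k \<le> Re (N z)" "Re (N z) \<le> p * (of_int k + 1)"
    "\<tau> z < of_int k + 1 \<Longrightarrow> Re (N z) < p * (of_int k + 1)"
proof -
  define l where "l = lane h (turn h k (Im z)) (\<tau> z - k)"
  have l: "0 \<le> l" "l \<le> 1"
    using lane_nonneg[OF turn_range] lane_le_1[OF turn_range] assms by (auto simp: l_def)
  have eq: "Re (N z) = p * (k + (p * (\<tau> z - k) + (1 - p) * l))"
    by (simp add: Re_step[OF assms] l_def algebra_simps)
  have pl: "(1 - p) * l \<le> 1 - p" using l p by (simp add: mult_left_le)
  have "0 \<le> p * (\<tau> z - k) + (1 - p) * l" using l p assms by simp
  then show "p * of_int k \<le> Re (N z)" unfolding eq using p by (intro mult_left_mono) auto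
  have "p * (\<tau> z - k) \<le> p" using assms p by (simp add: mult_left_le)
  with pl have "k + (p * (\<tau> z - k) + (1 - p) * l) \<le> of_int k + 1" by linarith
  then show "Re (N z) \<le> p * (of_int k + 1)" unfolding eq using p by (intro mult_left_mono) auto
  assume "\<tau> z < of_int k + 1"
  then have "p * (\<tau> z - k) < p * 1" using p by (intro mult_strict_left_mono) auto
  with pl have "k + (p * (\<tau> z - k) + (1 - p) * l) < of_int k + 1" by linarith
  then show "Re (N z) < p * (of_int k + 1)" unfolding eq using p by (intro mult_strict_left_mono) auto
qed

text \<open>
On a curve in a column on which the new imaginary part is constant, moving right forces the height
to move monotonically, downwards in even and upwards in odd columns. In both cases the progress along
the tube increases.
\<close>

lemma step_same_column_less:
  assumes k: "of_int k \<le> \<tau> z" "\<tau> w \<le> of_int k + 1" and less: "\<tau> z < \<tau> w"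
    and im: "Im (N z) = Im (N w)"
  shows "Re (N z) < Re (N w)"
proof -
  have kz: "of_int k \<le> \<tau> z" "\<tau> z \<le> of_int k + 1" and kw: "of_int k \<le> \<tau> w" "\<tau> w \<le> of_int k + 1"
    using assms by auto
  have slope: "(1 + 5 * h) * (\<tau> z - \<tau> w) < 0" using less h by (simp add: mult_less_0_iff)
  have "turn h k (Im w) \<le> turn h k (Im z)"
  proof (cases "even k")
    case True
    have "rise h (Im w) < rise h (Im z)"
      using im slope True by (simp add: Im_step[OF kz] Im_step[OF kw] algebra_simps)
    then have "Im w < Im z" using rise_strict_mono by (metis less_asym linorder_neqE_linordered_idom order_less_irrefl)
    then show ?thesis using True h clip_mono[of h "Im w" "Im z"] by (simp add: turn_def)
  next
    case False
    have "rise h (Im z) < rise h (Im w)"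
      using im slope False by (simp add: Im_step[OF kz] Im_step[OF kw] algebra_simps)
    then have "Im z < Im w" using rise_strict_mono by (metis less_asym linorder_neqE_linordered_idom order_less_irrefl)
    then show ?thesis using False h clip_mono[of h "Im z" "Im w"] by (simp add: turn_def)
  qed
  then have "lane h (turn h k (Im z)) (\<tau> z - k) \<le> lane h (turn h k (Im w)) (\<tau> z - k)"
    using kz by (intro lane_antimono) auto
  also have "\<dots> \<le> lane h (turn h k (Im w)) (\<tau> w - k)"
    using less by (intro lane_mono turn_range) auto
  finally have "(1 - p) * (k + lane h (turn h k (Im z)) (\<tau> z - k)) \<le> (1 - p) * (k + lane h (turn h k (Im w)) (\<tau> w - k))"
    using p by (intro mult_left_mono) auto
  moreover have "p * \<tau> z < p * \<tau> w" using less p by simp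
  ultimately have "p * \<tau> z < p * \<tau> w"
    "(1 - p) * (k + lane h (turn h k (Im z)) (\<tau> z - k)) \<le> (1 - p) * (k + lane h (turn h k (Im w)) (\<tau> w - k))"
    by auto
  then show ?thesis unfolding Re_step[OF kz] Re_step[OF kw]
    by (rule mult_strict_left_mono[OF add_less_le_mono p(1)])
qed

lemma step_inj: "inj N"
proof (rule injI)
  fix z w assume eq: "N z = N w"
  obtain k :: int where kz: "of_int k \<le> \<tau> z" "\<tau> z < of_int k + 1" by (rule between_integers)
  obtain l :: int where kw: "of_int l \<le> \<tau> w" "\<tau> w < of_int l + 1" by (rule between_integers)
  have a: "p * of_int k \<le> Re (N z)" "Re (N z) < p * (of_int k + 1)"
    using Re_step_column[of k z] kz by auto
  have b: "p * of_int l \<le> Re (N w)" "Re (N w) < p * (of_int l + 1)"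
    using Re_step_column[of l w] kw by auto
  have "p * of_int k < p * (of_int l + 1)" "p * of_int l < p * (of_int k + 1)" using a b eq by auto
  then have "(of_int k :: real) < of_int l + 1" "(of_int l :: real) < of_int k + 1"
    using p by (auto simp only: mult_less_cancel_left_pos)
  then have kl: "k = l" by linarith
  have "\<not> \<tau> z < \<tau> w" "\<not> \<tau> w < \<tau> z"
    using step_same_column_less[of k z w] step_same_column_less[of k w z] kz kw kl eq by auto
  then have t: "\<tau> z = \<tau> w" by simp
  have "of_int k \<le> \<tau> z" "\<tau> z \<le> of_int k + 1" "of_int k \<le> \<tau> w" "\<tau> w \<le> of_int k + 1"
    using kz t by auto
  then have "rise h (Im z) = rise h (Im w)"
    using Im_step[of k z] Im_step[of k w] unfolding eq t by linarith
  then have im: "Im z = Im w" using rise_strict_mono by (metis linorder_neqE_linordered_idom order_less_irrefl)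
  then have "Re z = Re w" using t p by (simp add: skew_def)
  with im show "z = w" by (simp add: complex_eq_iff)
qed

lemma skew_mult: "p * \<tau> z = Re z - Im z / s"
  using p by (simp add: skew_def)

lemma Re_step_skew: "\<bar>Re (N z) - (Re z - Im z / s)\<bar> \<le> p"
proof -
  obtain k :: int where k: "of_int k \<le> \<tau> z" "\<tau> z < of_int k + 1" by (rule between_integers)
  have "p * of_int k \<le> p * \<tau> z" "p * \<tau> z \<le> p * (of_int k + 1)" using k p by auto
  then have "\<bar>Re (N z) - p * \<tau> z\<bar> \<le> p"
    using Re_step_column(1,2)[of k z] k by (auto simp: abs_le_iff algebra_simps)
  then show ?thesis by (simp add: skew_mult)
qed

lemma Re_step_close: "\<bar>Re (N z) - Re z\<bar> \<le> p + \<bar>Im z\<bar> / s"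
proof -
  have "\<bar>Im z / s\<bar> = \<bar>Im z\<bar> / s" using s by simp
  then show ?thesis using Re_step_skew[of z] by linarith
qed

lemma Im_step_bounds:
  obtains d where "\<bar>d\<bar> \<le> 5/8" "Im (N z) = 1/2 + d + rise h (Im z)"
proof -
  obtain k :: int where k: "of_int k \<le> \<tau> z" "\<tau> z < of_int k + 1" by (rule between_integers)
  define e where "e = (if even k then \<tau> z - k else 1 - (\<tau> z - k)) - 1/2"
  have "\<bar>e\<bar> \<le> 1/2" using k by (cases "even k") (simp_all add: e_def abs_if)
  then have "\<bar>(1 + 5 * h) * e\<bar> \<le> (5/4) * (1/2)" unfolding abs_mult using h by (intro mult_mono) auto
  then show thesis using that[of "(1 + 5 * h) * e"] Im_step[of k z] k by (simp add: e_def)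
qed

lemma rise_above: "h \<le> v \<Longrightarrow> rise h v = h * (v - 1/2) + (4 / h) * max 0 (v - 1 + h)"
  and rise_below: "v \<le> 1 - h \<Longrightarrow> rise h v = h * (v - 1/2) - (4 / h) * max 0 (h - v)"
  by (simp_all add: rise_def)

lemma rise_ge: assumes "1 \<le> v" shows "4 * v \<le> rise h v"
proof -
  define A where "A = (4 / h) * (v - 1)"
  have "rise h v = h * (v - 1/2) + (4 / h) * (v - 1 + h)" using assms h by (simp add: rise_above)
  also have "(4 / h) * (v - 1 + h) = A + 4" using h by (simp add: A_def field_simps)
  finally have "rise h v = h * (v - 1/2) + (A + 4)" .
  moreover have "4 * (v - 1) \<le> A" unfolding A_def
    using assms h by (intro mult_right_mono) (auto simp: field_simps)
  moreover have "0 \<le> h * (v - 1/2)" using assms h by simp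
  ultimately show ?thesis by argo
qed

lemma rise_le: assumes "v \<le> 0" shows "rise h v \<le> 4 * v - 4"
proof -
  define A where "A = (4 / h) * (- v)"
  have "rise h v = h * (v - 1/2) - (4 / h) * (h - v)" using assms h by (simp add: rise_below)
  also have "(4 / h) * (h - v) = A + 4" using h by (simp add: A_def field_simps)
  finally have "rise h v = h * (v - 1/2) - (A + 4)" .
  moreover have "4 * (- v) \<le> A" unfolding A_def
    using assms h by (intro mult_right_mono) (auto simp: field_simps)
  moreover have "h * (v - 1/2) \<le> 0" using assms h by (simp add: mult_le_0_iff)
  ultimately show ?thesis by argo
qed

lemma Im_step_above: "1 \<le> Im z \<Longrightarrow> 1 < Im (N z)"
proof -
  assume a: "1 \<le> Im z"
  obtain d where "\<bar>d\<bar> \<le> 5/8" "Im (N z) = 1/2 + d + rise h (Im z)" by (rule Im_step_bounds)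
  then have "- 5/8 \<le> d" "d \<le> 5/8" "Im (N z) = 1/2 + d + rise h (Im z)" by (auto simp: abs_le_iff)
  then show ?thesis using a rise_ge[OF a] by linarith
qed

lemma Im_step_below: "Im z \<le> 0 \<Longrightarrow> Im (N z) < 0"
proof -
  assume a: "Im z \<le> 0"
  obtain d where "\<bar>d\<bar> \<le> 5/8" "Im (N z) = 1/2 + d + rise h (Im z)" by (rule Im_step_bounds)
  then have "- 5/8 \<le> d" "d \<le> 5/8" "Im (N z) = 1/2 + d + rise h (Im z)" by (auto simp: abs_le_iff)
  then show ?thesis using a rise_le[OF a] by linarith
qed

lemma step_proper: "cmod z \<le> 4 * cmod (N z) + 8"
proof -
  have im: "\<bar>Im z\<bar> \<le> \<bar>Im (N z)\<bar> + 2"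
  proof -
    obtain d where d: "\<bar>d\<bar> \<le> 5/8" "Im (N z) = 1/2 + d + rise h (Im z)" by (rule Im_step_bounds)
    then have d': "- 5/8 \<le> d" "d \<le> 5/8" by (auto simp: abs_le_iff)
    consider "Im z \<le> 0" | "0 \<le> Im z \<and> Im z \<le> 1" | "1 \<le> Im z" by linarith
    then show ?thesis
    proof cases
      case 1 then show ?thesis using rise_le[of "Im z"] d' d(2) by linarith
    next
      case 2 then show ?thesis by linarith
    next
      case 3 then show ?thesis using rise_ge[of "Im z"] d' d(2) by linarith
    qed
  qed
  have "\<bar>Im z\<bar> / s \<le> \<bar>Im z\<bar> / 1" using s by (intro divide_left_mono) auto
  then have "\<bar>Re z\<bar> \<le> \<bar>Re (N z)\<bar> + 1 + \<bar>Im z\<bar>" using Re_step_close[of z] p by linarith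
  then show ?thesis using im cmod_le[of z] abs_Re_le_cmod[of "N z"] abs_Im_le_cmod[of "N z"] by linarith
qed

text \<open>
A continuous injective map of the plane is open by invariance of domain, and a proper map has a closed
image.
\<close>

lemma step_surj: "surj N"
proof -
  have "open (range N)"
    by (rule invariance_of_domain_gen) (auto simp: step_continuous step_inj)
  moreover have "closed (range N)"
    unfolding closed_sequential_limits
  proof (intro allI impI)
    fix x l assume "(\<forall>n. x n \<in> range N) \<and> x \<longlonglongrightarrow> l"
    then have "\<forall>n. \<exists>y. x n = N y" and lim: "x \<longlonglongrightarrow> l" by blast+
    then obtain z where z: "\<And>n. x n = N (z n)" by metis
    obtain B where B: "\<And>n. cmod (x n) \<le> B"
      using convergent_imp_Bseq[OF convergentI[OF lim]] unfolding Bseq_def by blast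
    have "z n \<in> cball 0 (4 * B + 8)" for n
      using step_proper[of "z n"] B[of n] by (simp add: z dist_norm)
    then obtain y r where r: "strict_mono (r :: nat \<Rightarrow> nat)" "(z \<circ> r) \<longlonglongrightarrow> y"
      using compact_cball[of "0::complex" "4 * B + 8", unfolded compact_def] by metis
    have "(\<lambda>n. N ((z \<circ> r) n)) \<longlonglongrightarrow> N y"
      by (rule continuous_on_tendsto_compose[OF step_continuous[of UNIV] r(2)]) auto
    moreover have "(\<lambda>n. N ((z \<circ> r) n)) \<longlonglongrightarrow> l"
      using LIMSEQ_subseq_LIMSEQ[OF lim r(1)] by (simp add: o_def z)
    ultimately show "l \<in> range N" using LIMSEQ_unique by blast
  qed
  ultimately show ?thesis using clopen[of "range N"] by blast
qed

lemma step_translate: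
  fixes K :: nat
  assumes K: "p = 1 / (2 * real K)"
  shows "N (z + 1) = N z + 1"
proof -
  have K0: "K > 0" using K p by (cases K) auto
  then have pK: "p * (2 * real K) = 1" using K by simp
  have t: "\<tau> (z + 1) = \<tau> z + 2 * real K"
    using K K0 p by (simp add: skew_def field_simps)
  obtain k :: int where k: "of_int k \<le> \<tau> z" "\<tau> z < of_int k + 1" by (rule between_integers)
  define k' where "k' = k + 2 * int K"
  have k': "of_int k' \<le> \<tau> (z + 1)" "\<tau> (z + 1) \<le> of_int k' + 1" and e: "\<tau> (z + 1) - k' = \<tau> z - k"
    and ev: "even k' = even k"
    using k by (auto simp: k'_def t)
  have turn: "turn h k' (Im (z + 1)) = turn h k (Im z)" by (simp add: turn_def ev)
  have "Re (N (z + 1)) = Re (N z) + (p * (2 * real K)) * (p + (1 - p))"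
    unfolding Re_step[OF k'] Re_step[OF k(1) less_imp_le[OF k(2)]] turn e
    by (simp add: t k'_def distrib_left distrib_right right_diff_distrib left_diff_distrib mult_ac)
  moreover have "Im (N (z + 1)) = Im (N z)"
    unfolding Im_step[OF k'] using k by (simp only: e ev Im_step[of k]) simp
  ultimately show ?thesis using pK by (simp add: complex_eq_iff)
qed

text \<open>
The new imaginary part leaves \<open>{0..1}\<close> at a distance of about \<open>5 * h / 2\<close> from a border, and on the straight part
of a gap \<open>rise\<close> shifts it by at most \<open>h / 2\<close>. Hence a neighbourhood of radius \<open>3 * h / 2\<close> of the border is
outside the new tube.
\<close>

lemma gap_signs:
  assumes t: "\<bar>\<tau> z - of_int k\<bar> < 3 * h / 2"
  shows "even k \<Longrightarrow> Im z \<le> 1 - h \<Longrightarrow> Im (N z) < 0"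
    and "odd k \<Longrightarrow> h \<le> Im z \<Longrightarrow> 1 < Im (N z)"
proof -
  \<comment> \<open>The quadratic error of the product with \<open>1 + 5 * h\<close> is less than the margin \<open>h / 2\<close>.\<close>
  have sm: "15 * h * h / 2 < h / 2" using h mult_strict_left_mono[of "15 * h" 1 h] by simp
  obtain l :: int where l: "of_int l \<le> \<tau> z" "\<tau> z \<le> of_int l + 1" "l = k \<or> l = k - 1"
  proof (cases "of_int k \<le> \<tau> z")
    case True then show ?thesis using t h that[of k] by auto
  next
    case False then show ?thesis using t h that[of "k - 1"] by auto
  qed
  define d where "d = (if even l then \<tau> z - l else 1 - (\<tau> z - l))"
  have im: "Im (N z) = 1/2 + (1 + 5 * h) * (d - 1/2) + rise h (Im z)"
    using Im_step[OF l(1,2)] by (simp add: d_def)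
  { assume k: "even k" and v: "Im z \<le> 1 - h"
    have "d \<le> 3 * h / 2" using l t k by (auto simp: d_def)
    then have "(1 + 5 * h) * (d - 1/2) \<le> (1 + 5 * h) * (3 * h / 2 - 1/2)" using h by (intro mult_left_mono) auto
    also have "\<dots> = 15 * h * h / 2 - h - 1/2" by (simp add: algebra_simps)
    finally have 1: "(1 + 5 * h) * (d - 1/2) \<le> 15 * h * h / 2 - h - 1/2" .
    have "0 \<le> (4 / h) * max 0 (h - Im z)" using h by simp
    moreover have "h * (Im z - 1/2) \<le> h * (1/2)" using h v by (intro mult_left_mono) auto
    ultimately have "rise h (Im z) \<le> h / 2"
      unfolding rise_below[OF v] by linarith
    with 1 sm im show "Im (N z) < 0" by linarith }
  { assume k: "odd k" and v: "h \<le> Im z"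
    have "1 - 3 * h / 2 \<le> d" using l t k by (auto simp: d_def)
    then have "(1 + 5 * h) * (1/2 - 3 * h / 2) \<le> (1 + 5 * h) * (d - 1/2)" using h by (intro mult_left_mono) auto
    moreover have "(1 + 5 * h) * (1/2 - 3 * h / 2) = h + 1/2 - 15 * h * h / 2" by (simp add: field_simps)
    ultimately have 1: "h + 1/2 - 15 * h * h / 2 \<le> (1 + 5 * h) * (d - 1/2)" by simp
    have "0 \<le> (4 / h) * max 0 (Im z - 1 + h)" using h by simp
    moreover have "h * (- 1/2) \<le> h * (Im z - 1/2)" using h v by (intro mult_left_mono) auto
    ultimately have "- h / 2 \<le> rise h (Im z)"
      unfolding rise_above[OF v] by linarith
    with 1 sm im show "1 < Im (N z)" by linarith }
qed

lemma Re_step_straight: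
  assumes "of_int k + h \<le> \<tau> z" "\<tau> z \<le> of_int k + 1 - h"
  shows "Re (N z) = p * (p * \<tau> z + (1 - p) * (k + (1 - turn h k (Im z))))"
proof -
  have "h \<le> \<tau> z - k" "\<tau> z - k \<le> 1 - h" using assms by auto
  then have "lane h (turn h k (Im z)) (\<tau> z - k) = 1 - turn h k (Im z)"
    using h by (simp add: lane_def min_def max_def field_simps)
  then show ?thesis using assms h by (simp add: Re_step[of k])
qed

text \<open>
Where the tube turns round the end of a gap, the progress along it practically stands still.
\<close>

lemma Re_step_bend:
  assumes t: "\<bar>\<tau> z - of_int k\<bar> < 3 * h / 2" and c: "clip h (Im z) = (if even k then 1 else 0)"
  shows "Re (N z) = p * (p * \<tau> z + (1 - p) * k)"
proof (cases "of_int k \<le> \<tau> z")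
  case True
  have "\<tau> z - k \<le> 1 - h" using t h by linarith
  then have "lane h 1 (\<tau> z - k) = 0" using h by (simp add: lane_def field_simps)
  then show ?thesis using Re_step[of k z] True t h c by (auto simp: turn_def)
next
  case False
  have e: "h \<le> \<tau> z - (k - 1)" using t h by linarith
  then have "1 \<le> (\<tau> z - (k - 1)) / h" using h by simp
  then have "lane h 0 (\<tau> z - (k - 1)) = 1" using h by (simp add: lane_def)
  moreover have "turn h (k - 1) (Im z) = 0" using c by (auto simp: turn_def)
  ultimately show ?thesis using Re_step[of "k - 1" z] False t h by (simp add: algebra_simps)
qed

lemma column_cases:
  obtains (gap) k :: int where "\<bar>t - of_int k\<bar> < 3 * h / 2"
    | (straight) k :: int where "of_int k + h < t" "t < of_int k + 1 - h"
proof -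
  obtain k :: int where k: "of_int k \<le> t" "t < of_int k + 1" by (rule between_integers)
  consider "t - k < 3 * h / 2" | "k + 1 - t < 3 * h / 2" | "of_int k + h < t \<and> t < of_int k + 1 - h"
    using h by linarith
  then show thesis
  proof cases
    case 1 then show ?thesis using k by (intro gap[of k]) auto
  next
    case 2 then show ?thesis using k by (intro gap[of "k + 1"]) auto
  next
    case 3 then show ?thesis using straight by blast
  qed
qed

lemma tube_bend:
  assumes t: "\<bar>\<tau> z - of_int k\<bar> < 3 * h / 2" and tube: "0 \<le> Im (N z)" "Im (N z) \<le> 1"
  shows "if even k then 1 - h < Im z else Im z < h"
  using gap_signs[OF t] tube by (cases "even k"; force)

lemma skew_Re_diff: "p * \<bar>\<tau> w - \<tau> z\<bar> \<le> \<bar>Re w - Re z\<bar> + \<bar>Im w - Im z\<bar>"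
proof -
  have "\<bar>Im w - Im z\<bar> / s \<le> \<bar>Im w - Im z\<bar> / 1" using s by (intro divide_left_mono) auto
  moreover have "p * \<bar>\<tau> w - \<tau> z\<bar> \<le> p * ((\<bar>Re w - Re z\<bar> + \<bar>Im w - Im z\<bar> / s) / p)"
    using p skew_diff[of w z] by (intro mult_left_mono) auto
  ultimately show ?thesis using p by simp
qed

lemma Re_step_straight_diff:
  assumes "of_int k + h \<le> \<tau> z" "\<tau> z \<le> of_int k + 1 - h" "of_int k + h \<le> \<tau> w" "\<tau> w \<le> of_int k + 1 - h"
  shows "\<bar>Re (N w) - Re (N z)\<bar> \<le> p * (p * \<bar>\<tau> w - \<tau> z\<bar>) + p * (1 + 5 * h) * \<bar>Im w - Im z\<bar>"
proof -
  define x y where "x = \<tau> w - \<tau> z" and "y = turn h k (Im z) - turn h k (Im w)"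
  have y: "\<bar>y\<bar> \<le> (1 + 5 * h) * \<bar>Im w - Im z\<bar>" using lipschitz_turn[of k "Im z" "Im w"]
    by (simp add: y_def abs_minus_commute)
  have "Re (N w) - Re (N z) = p * (p * x) + p * ((1 - p) * y)"
    unfolding Re_step_straight[OF assms(1,2)] Re_step_straight[OF assms(3,4)] x_def y_def
    by (simp add: algebra_simps)
  then have "\<bar>Re (N w) - Re (N z)\<bar> \<le> \<bar>p * (p * x)\<bar> + \<bar>p * ((1 - p) * y)\<bar>" by linarith
  also have "\<dots> = p * (p * \<bar>x\<bar>) + p * ((1 - p) * \<bar>y\<bar>)" using p by (simp add: abs_mult)
  also have "(1 - p) * \<bar>y\<bar> \<le> 1 * \<bar>y\<bar>" using p by (intro mult_right_mono) auto
  also have "1 * \<bar>y\<bar> \<le> (1 + 5 * h) * \<bar>Im w - Im z\<bar>" using y by simp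
  finally show ?thesis using p by (simp add: x_def mult.assoc)
qed

text \<open>
Inside the new tube its real coordinate has slope \<open>O(p)\<close>: the tube needs a whole column to advance
by \<open>p\<close>. This is how a small \<open>p\<close> makes the tube long.
\<close>

lemma Re_step_slow:
  assumes tube: "0 \<le> Im (N z)" "Im (N z) \<le> 1"
  shows "\<forall>\<^sub>F w in nhds z. \<bar>Re (N w) - Re (N z)\<bar> \<le> 3 * p * (\<bar>Re w - Re z\<bar> + \<bar>Im w - Im z\<bar>)"
proof (rule column_cases[of "\<tau> z"])
  fix k assume t: "\<bar>\<tau> z - of_int k\<bar> < 3 * h / 2"
  have v: "if even k then 1 - h < Im z else Im z < h" by (rule tube_bend[OF t tube])
  define U where "U = {w. \<bar>\<tau> w - of_int k\<bar> < 3 * h / 2 \<and> (if even k then 1 - h < Im w else Im w < h)}"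
  have U: "open U" unfolding U_def
    by (cases "even k") (auto intro!: open_Collect_conj open_Collect_less continuous_intros)
  have zU: "z \<in> U" using t v by (simp add: U_def)
  have bend: "Re (N w) = p * (p * \<tau> w + (1 - p) * k)" if "w \<in> U" for w
    using that h clip_eq_1[of h "Im w"] clip_eq_0[of h "Im w"]
    by (intro Re_step_bend) (auto simp: U_def split: if_splits)
  show ?thesis
    using eventually_nhds_in_open[OF U zU]
  proof eventually_elim
    case (elim w)
    have "Re (N w) - Re (N z) = p * (p * (\<tau> w - \<tau> z))"
      unfolding bend[OF elim] bend[OF zU] by (simp add: algebra_simps)
    then have "\<bar>Re (N w) - Re (N z)\<bar> = p * (p * \<bar>\<tau> w - \<tau> z\<bar>)"
      using p by (simp add: abs_mult)
    also have "\<dots> \<le> p * (\<bar>Re w - Re z\<bar> + \<bar>Im w - Im z\<bar>)"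
      using p skew_Re_diff[of w z] by (intro mult_left_mono) auto
    also have "\<dots> \<le> 3 * p * (\<bar>Re w - Re z\<bar> + \<bar>Im w - Im z\<bar>)"
      using p by (intro mult_right_mono) auto
    finally show ?case .
  qed
next
  fix k :: int assume t: "of_int k + h < \<tau> z" "\<tau> z < of_int k + 1 - h"
  have "\<forall>\<^sub>F w in nhds z. of_int k + h < \<tau> w" "\<forall>\<^sub>F w in nhds z. \<tau> w < of_int k + 1 - h"
    using order_tendstoD[OF skew_tendsto] t by auto
  then show ?thesis
  proof eventually_elim
    case (elim w)
    have "\<bar>Re (N w) - Re (N z)\<bar> \<le> p * (p * \<bar>\<tau> w - \<tau> z\<bar>) + p * (1 + 5 * h) * \<bar>Im w - Im z\<bar>"
      using t elim by (intro Re_step_straight_diff[of k]) auto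
    also have "p * (p * \<bar>\<tau> w - \<tau> z\<bar>) \<le> p * (\<bar>Re w - Re z\<bar> + \<bar>Im w - Im z\<bar>)"
      using p skew_Re_diff[of w z] by (intro mult_left_mono) auto
    also have "p * (1 + 5 * h) * \<bar>Im w - Im z\<bar> \<le> 2 * p * (\<bar>Re w - Re z\<bar> + \<bar>Im w - Im z\<bar>)"
    proof (rule mult_mono)
      have "p * (1 + 5 * h) \<le> p * 2" using p h by (intro mult_left_mono) auto
      then show "p * (1 + 5 * h) \<le> 2 * p" by simp
    qed (use p in auto)
    finally show ?case by (simp add: algebra_simps)
  qed
qed

end

section \<open>Pulling a crossing function back through a meander\<close>

definition crossing_function :: "(complex \<Rightarrow> real) \<Rightarrow> bool" where
  "crossing_function F \<longleftrightarrow> (\<forall>z. 0 \<le> F z \<and> F z \<le> 1 \<and> (Im z \<le> 0 \<longrightarrow> F z = 0) \<and> (1 \<le> Im z \<longrightarrow> F z = 1))"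

text \<open>
If \<open>F\<close> is replaced by its constant values 0 and 1 on the two sides of the new tube, then the argument
of \<open>clip\<close> becomes \<open>s * (Re z - p * k)\<close> near the border with number \<open>k\<close> (\<open>pull_gap\<close>, \<open>height_skew\<close>). In a gap
it thus climbs with the horizontal slope \<open>s\<close> of the gap and does not depend on the height. Across a
column \<open>F\<close> interpolates between the values for the two adjacent gaps. Clipping makes
the function constant near the bends of the tube.
\<close>

definition pull :: "real \<Rightarrow> real \<Rightarrow> real \<Rightarrow> (complex \<Rightarrow> real) \<Rightarrow> complex \<Rightarrow> real" where
  "pull s p h F z = (let k = \<lfloor>skew s p z\<rfloor>; y = F (step s p h z) in
     clip h (Im z + s * p * ((skew s p z - k) - (if even k then y else 1 - y))))"

context meander begin

lemma pull_eq:
  assumes "of_int k \<le> \<tau> z" "\<tau> z < of_int k + 1"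
  shows "pull s p h F z = clip h (Im z + s * p * ((\<tau> z - k) - (if even k then F (N z) else 1 - F (N z))))"
proof -
  have "\<lfloor>\<tau> z\<rfloor> = k" using assms by (simp add: floor_eq_iff)
  then show ?thesis by (simp add: pull_def Let_def)
qed

lemma pull_far:
  assumes F: "crossing_function F"
  shows "Im z \<le> 3 * h / 2 \<Longrightarrow> pull s p h F z = 0" "1 - 3 * h / 2 \<le> Im z \<Longrightarrow> pull s p h F z = 1"
proof -
  obtain k :: int where k: "of_int k \<le> \<tau> z" "\<tau> z < of_int k + 1" by (rule between_integers)
  define y where "y = (\<tau> z - k) - (if even k then F (N z) else 1 - F (N z))"
  have "\<bar>y\<bar> \<le> 1"
  proof -
    have "0 \<le> F (N z)" "F (N z) \<le> 1" using F by (auto simp: crossing_function_def)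
    then show ?thesis using k unfolding y_def by (cases "even k"; simp add: abs_le_iff; linarith)
  qed
  then have "\<bar>s * p * y\<bar> \<le> h / 2 * 1" unfolding abs_mult[of "s * p"] using s p sp h by (intro mult_mono) auto
  moreover have "pull s p h F z = clip h (Im z + s * p * y)" using pull_eq[OF k] by (simp add: y_def)
  ultimately show "Im z \<le> 3 * h / 2 \<Longrightarrow> pull s p h F z = 0" "1 - 3 * h / 2 \<le> Im z \<Longrightarrow> pull s p h F z = 1"
    using h by (auto intro!: clip_eq_0 clip_eq_1)
qed

lemma crossing_function_pull: "crossing_function F \<Longrightarrow> crossing_function (pull s p h F)"
  using pull_far[of F] h
  by (auto simp: crossing_function_def pull_def Let_def clip_nonneg clip_le_1)

lemma pull_gap:
  assumes F: "crossing_function F" and t: "\<bar>\<tau> z - of_int k\<bar> < 3 * h / 2" and v: "h \<le> Im z" "Im z \<le> 1 - h"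
  shows "pull s p h F z = clip h (Im z + s * p * (\<tau> z - k))"
proof -
  have y: "F (N z) = (if even k then 0 else 1)"
    using gap_signs[OF t] v F by (auto simp: crossing_function_def less_imp_le)
  show ?thesis
  proof (cases "of_int k \<le> \<tau> z")
    case True then show ?thesis using pull_eq[of k z F] t h y by (auto simp: abs_le_iff)
  next
    case False
    then have "pull s p h F z = clip h (Im z + s * p * ((\<tau> z - (k - 1)) - 1))"
      using pull_eq[of "k - 1" z F] t h y by (auto simp: abs_le_iff)
    then show ?thesis by simp
  qed
qed

lemma height_skew: "Im z + s * p * (\<tau> z - c) = s * (Re z - p * c)"
  using s p by (simp add: skew_def field_simps)

text \<open>
The new function is constant at the bends, linear with slope \<open>O(s)\<close> in the gaps, and on the straight
parts of the columns one differentiates through the chart. Moving up at a fixed real part crosses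
the columns sideways at the rate \<open>1 / (s * p)\<close>, and \<open>F\<close> enters with the weight \<open>s * p\<close>; so the vertical slope of
\<open>F\<close> is only stretched by the ratio \<open>1 + O(h)\<close> between a column with its gap and the column alone, and
by \<open>clip\<close>. The slope \<open>a\<close> of \<open>F\<close> along the tube enters with a factor \<open>p\<^sup>2\<close>, as both the weight of \<open>F\<close> and the
speed along the tube are proportional to \<open>p\<close>.
\<close>

lemma slope_bound_pull:
  assumes F: "crossing_function F" and slope: "slope_bound F (N z) a b" and ab: "0 \<le> a" "0 \<le> b"
  shows "slope_bound (pull s p h F) z ((1 + 5 * h) * s * (1 + p\<^sup>2 * a + (1 + 5 * h) * b))
           (6 * s * p\<^sup>2 * a + (1 + 12 * h) * b)" (is "slope_bound ?G z ?A ?B")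
proof -
  define c where "c = 1 + 5 * h"
  have c: "1 \<le> c" "c \<le> 5/4" using h by (auto simp: c_def)
  have B0: "0 \<le> ?B" using s h ab by simp
  have c1: "c * s * 1 \<le> ?A"
    unfolding c_def using s h ab by (intro mult_left_mono) auto
  then have A0: "0 \<le> ?A" using c s by (smt (verit) mult_nonneg_nonneg)
  have const: "slope_bound ?G z ?A ?B" if "\<forall>\<^sub>F w in nhds z. ?G w = ?G z"
    unfolding slope_bound_def using that
    by eventually_elim (use A0 B0 in simp)
  have tIm: "(Im \<longlongrightarrow> Im z) (nhds z)" by (intro tendsto_intros filterlim_ident)
  \<comment> \<open>The first two cases contain all bends; the cases overlap, so that each of them is open.\<close>
  consider "Im z < 3 * h / 2" | "1 - 3 * h / 2 < Im z" | "h < Im z" "Im z < 1 - h" using h by linarith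
  then show ?thesis
  proof cases
    case 1
    then have "\<forall>\<^sub>F w in nhds z. Im w < 3 * h / 2" using tIm by (rule order_tendstoD(2)[rotated])
    then have "\<forall>\<^sub>F w in nhds z. ?G w = ?G z"
      by eventually_elim (use 1 pull_far[OF F] in simp)
    then show ?thesis by (rule const)
  next
    case 2
    then have "\<forall>\<^sub>F w in nhds z. 1 - 3 * h / 2 < Im w" using tIm by (rule order_tendstoD(1)[rotated])
    then have "\<forall>\<^sub>F w in nhds z. ?G w = ?G z"
      by eventually_elim (use 2 pull_far[OF F] in simp)
    then show ?thesis by (rule const)
  next
    case 3
    have ev: "\<forall>\<^sub>F w in nhds z. h < Im w" "\<forall>\<^sub>F w in nhds z. Im w < 1 - h"
      using order_tendstoD[OF tIm] 3 by auto
    show ?thesis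
    proof (rule column_cases[of "\<tau> z"])
      fix k assume t: "\<bar>\<tau> z - of_int k\<bar> < 3 * h / 2"
      have "open {w. \<bar>\<tau> w - of_int k\<bar> < 3 * h / 2}" by (intro open_Collect_less continuous_intros)
      then have "\<forall>\<^sub>F w in nhds z. \<bar>\<tau> w - of_int k\<bar> < 3 * h / 2"
        using t eventually_nhds_in_open[of "{w. \<bar>\<tau> w - of_int k\<bar> < 3 * h / 2}" z] by simp
      with ev show ?thesis unfolding slope_bound_def
      proof eventually_elim
        case (elim w)
        have "?G w = clip h (s * (Re w - p * k))" "?G z = clip h (s * (Re z - p * k))"
          using elim 3 t pull_gap[OF F, of _ k] by (simp_all add: height_skew)
        then have "\<bar>?G w - ?G z\<bar> \<le> c * \<bar>s * (Re w - p * k) - s * (Re z - p * k)\<bar>"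
          using clip_lipschitz[of h] h by (simp add: c_def)
        also have "s * (Re w - p * k) - s * (Re z - p * k) = s * (Re w - Re z)" by (simp add: algebra_simps)
        also have "c * \<bar>s * (Re w - Re z)\<bar> = (c * s * 1) * \<bar>Re w - Re z\<bar>" using s by (simp add: abs_mult)
        also have "\<dots> \<le> ?A * \<bar>Re w - Re z\<bar>" using c1 by (intro mult_right_mono) auto
        finally show ?case using mult_nonneg_nonneg[OF B0, of "\<bar>Im w - Im z\<bar>"] by simp
      qed
    next
      fix k :: int assume t: "of_int k + h < \<tau> z" "\<tau> z < of_int k + 1 - h"
      have evt: "\<forall>\<^sub>F w in nhds z. of_int k + h < \<tau> w" "\<forall>\<^sub>F w in nhds z. \<tau> w < of_int k + 1 - h"
        using order_tendstoD[OF skew_tendsto] t by auto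
      have "isCont N z" using step_continuous[of UNIV] by (simp add: continuous_on_eq_continuous_at)
      then have "filterlim N (nhds (N z)) (nhds z)" by (simp add: continuous_at tendsto_at_iff_tendsto_nhds)
      then have "\<forall>\<^sub>F w in nhds z. \<bar>F (N w) - F (N z)\<bar> \<le> a * \<bar>Re (N w) - Re (N z)\<bar> + b * \<bar>Im (N w) - Im (N z)\<bar>"
        using slope unfolding slope_bound_def filterlim_iff by blast
      with ev evt show ?thesis unfolding slope_bound_def
      proof eventually_elim
        case (elim w)
        define X Y u where "X = \<bar>Re w - Re z\<bar>" and "Y = \<bar>Im w - Im z\<bar>" and "u = p * \<bar>\<tau> w - \<tau> z\<bar>"
        have XY: "0 \<le> X" "0 \<le> Y" by (auto simp: X_def Y_def)
        have u: "u \<le> X + Y / s" "0 \<le> u"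
        proof -
          have "p * \<bar>\<tau> w - \<tau> z\<bar> \<le> p * ((X + Y / s) / p)"
            unfolding X_def Y_def using p skew_diff[of w z] by (intro mult_left_mono) auto
          then show "u \<le> X + Y / s" using p by (simp add: u_def)
        qed (use p in \<open>simp add: u_def\<close>)
        have R: "\<bar>Re (N w) - Re (N z)\<bar> \<le> p * u + p * c * Y"
          using Re_step_straight_diff[of k z w] t elim by (simp add: u_def c_def Y_def)
        have I: "p * \<bar>Im (N w) - Im (N z)\<bar> \<le> c * u + p * h * Y"
        proof -
          have "rise h (Im w) - rise h (Im z) = h * (Im w - Im z)"
            using elim 3 by (simp add: rise_def algebra_simps)
          have "Im (N w) - Im (N z) = c * (if even k then \<tau> w - \<tau> z else \<tau> z - \<tau> w) + h * (Im w - Im z)"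
          proof -
            have "of_int k \<le> \<tau> w" "\<tau> w \<le> of_int k + 1" "of_int k \<le> \<tau> z" "\<tau> z \<le> of_int k + 1"
              using t elim h by auto
            then have "Im (N w) - Im (N z) = (1 + 5 * h) * ((if even k then \<tau> w - k else 1 - (\<tau> w - k)) -
                (if even k then \<tau> z - k else 1 - (\<tau> z - k))) + (rise h (Im w) - rise h (Im z))"
              by (simp only: Im_step) (simp add: algebra_simps)
            then show ?thesis using \<open>rise h (Im w) - rise h (Im z) = h * (Im w - Im z)\<close>
              by (simp add: c_def)
          qed
          then have "\<bar>Im (N w) - Im (N z)\<bar> \<le> \<bar>c * (if even k then \<tau> w - \<tau> z else \<tau> z - \<tau> w)\<bar> + \<bar>h * (Im w - Im z)\<bar>"
            by linarith
          also have "\<dots> = c * \<bar>\<tau> w - \<tau> z\<bar> + h * Y" using c h by (simp add: abs_mult Y_def abs_minus_commute)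
          finally have "p * \<bar>Im (N w) - Im (N z)\<bar> \<le> p * (c * \<bar>\<tau> w - \<tau> z\<bar> + h * Y)"
            using p by (intro mult_left_mono) auto
          then show ?thesis by (simp add: u_def algebra_simps)
        qed
        have pF: "p * \<bar>F (N w) - F (N z)\<bar> \<le> a * (p * (p * u + p * c * Y)) + b * (c * u + p * h * Y)"
        proof -
          have "p * \<bar>F (N w) - F (N z)\<bar> \<le> p * (a * \<bar>Re (N w) - Re (N z)\<bar> + b * \<bar>Im (N w) - Im (N z)\<bar>)"
            using elim p by (intro mult_left_mono) auto
          also have "\<dots> = a * (p * \<bar>Re (N w) - Re (N z)\<bar>) + b * (p * \<bar>Im (N w) - Im (N z)\<bar>)"
            by (simp add: algebra_simps)
          also have "\<dots> \<le> a * (p * (p * u + p * c * Y)) + b * (c * u + p * h * Y)"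
            using ab p R I by (intro add_mono mult_left_mono) auto
          finally show ?thesis .
        qed
        define D where "D = (if even k then F (N w) - F (N z) else F (N z) - F (N w))"
        have D: "\<bar>D\<bar> = \<bar>F (N w) - F (N z)\<bar>" by (simp add: D_def abs_minus_commute)
        have "?G w = clip h (Im w + s * p * ((\<tau> w - k) - (if even k then F (N w) else 1 - F (N w))))"
          "?G z = clip h (Im z + s * p * ((\<tau> z - k) - (if even k then F (N z) else 1 - F (N z))))"
          using pull_eq[of k] t elim h by auto
        then have "\<bar>?G w - ?G z\<bar> \<le> c * \<bar>(Im w + s * p * ((\<tau> w - k) - (if even k then F (N w) else 1 - F (N w))))
            - (Im z + s * p * ((\<tau> z - k) - (if even k then F (N z) else 1 - F (N z))))\<bar>"
          using clip_lipschitz[of h] h by (simp add: c_def)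
        also have "(Im w + s * p * ((\<tau> w - k) - (if even k then F (N w) else 1 - F (N w))))
            - (Im z + s * p * ((\<tau> z - k) - (if even k then F (N z) else 1 - F (N z))))
            = (Im w + s * p * (\<tau> w - k)) - (Im z + s * p * (\<tau> z - k)) - s * (p * D)"
          by (simp add: D_def algebra_simps)
        also have "\<dots> = s * (Re w - Re z) - s * (p * D)" unfolding height_skew by (simp add: algebra_simps)
        also have "c * \<bar>s * (Re w - Re z) - s * (p * D)\<bar> \<le> c * (s * X + s * (p * \<bar>D\<bar>))"
        proof (rule mult_left_mono)
          have "\<bar>s * (Re w - Re z) - s * (p * D)\<bar> \<le> \<bar>s * (Re w - Re z)\<bar> + \<bar>s * (p * D)\<bar>" by (rule abs_triangle_ineq4)
          then show "\<bar>s * (Re w - Re z) - s * (p * D)\<bar> \<le> s * X + s * (p * \<bar>D\<bar>)"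
            using s p by (simp add: abs_mult X_def)
        qed (use c in simp)
        also have "\<dots> \<le> c * (s * X + s * (a * (p * (p * u + p * c * Y)) + b * (c * u + p * h * Y)))"
          unfolding D using c s pF by (intro mult_left_mono add_left_mono) auto
        also have "\<dots> \<le> c * (s * X + s * (a * (p * (p * (X + Y / s) + p * c * Y)) + b * (c * (X + Y / s) + p * h * Y)))"
          using c s p ab u by (intro mult_left_mono add_left_mono add_mono add_right_mono) auto
        also have "\<dots> = (c * s * (1 + p\<^sup>2 * a + c * b)) * X + (c * (a * p\<^sup>2 + s * c * a * p\<^sup>2) + c * (c + h * (s * p)) * b) * Y"
          using s by (simp add: power2_eq_square field_simps)
        also have "c * s * (1 + p\<^sup>2 * a + c * b) = ?A" by (simp only: c_def)
        also have "?A * X + (c * (a * p\<^sup>2 + s * c * a * p\<^sup>2) + c * (c + h * (s * p)) * b) * Y \<le> ?A * X + ?B * Y"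
        proof (intro add_left_mono mult_right_mono add_mono XY)
          have "c * (a * p\<^sup>2 + s * c * a * p\<^sup>2) \<le> c * (s * (a * p\<^sup>2) + s * c * (a * p\<^sup>2))"
            using c s ab by (intro mult_left_mono add_mono) (auto intro: mult_right_mono[of 1 s, simplified])
          also have "\<dots> = (c * (1 + c)) * (s * p\<^sup>2 * a)" by (simp add: algebra_simps)
          also have "\<dots> \<le> 6 * (s * p\<^sup>2 * a)"
          proof (rule mult_right_mono)
            have "c * (1 + c) \<le> (5/4) * (1 + 5/4)" using c by (intro mult_mono) auto
            then show "c * (1 + c) \<le> 6" by simp
          qed (use s ab in simp)
          finally show "c * (a * p\<^sup>2 + s * c * a * p\<^sup>2) \<le> 6 * s * p\<^sup>2 * a" by simp
          have "c * (c + h * (s * p)) \<le> 1 + 12 * h"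
          proof -
            have hh: "h * h \<le> h * (1/20)" "0 \<le> h * h" using h by (auto intro: mult_left_mono)
            have "h * (s * p) \<le> h * h" using h sp by (intro mult_left_mono) auto
            then have "c * (c + h * (s * p)) \<le> c * (c + h * h)" using c by (intro mult_left_mono) auto
            also have "\<dots> = 1 + 10 * h + 26 * (h * h) + 5 * h * (h * h)" by (simp add: c_def algebra_simps)
            also have "5 * h * (h * h) \<le> 1 * (h * h)" using h hh by (intro mult_right_mono) auto
            finally show ?thesis using hh h by linarith
          qed
          then show "c * (c + h * (s * p)) \<le> 1 + 12 * h" .
        qed (rule ab(2))
        finally show ?case by (simp add: X_def Y_def)
      qed
    qed
  qed
qed

end

section \<open>Towers of meanders and their crossing functions\<close>

lemma translate_of_int:
  fixes f :: "complex \<Rightarrow> 'a::ring_1"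
  assumes f: "\<And>z. f (z + 1) = f z + c"
  shows "f (z + of_int k) = f z + of_int k * c"
proof -
  have nat: "f (z + of_nat j) = f z + of_nat j * c" for z j
  proof (induction j)
    case (Suc j)
    then show ?case using f[of "z + of_nat j"] by (simp add: algebra_simps)
  qed simp
  show ?thesis
  proof (cases "k \<ge> 0")
    case True then show ?thesis using nat[of z "nat k"] by simp
  next
    case False then show ?thesis using nat[of "z + of_int k" "nat (- k)"] by (simp add: algebra_simps)
  qed
qed

lemma slope_bound_mono:
  assumes "slope_bound f z a b" "a \<le> a'" "b \<le> b'"
  shows "slope_bound f z a' b'"
  using assms(1) unfolding slope_bound_def
proof eventually_elim
  case (elim w)
  have "a * \<bar>Re w - Re z\<bar> \<le> a' * \<bar>Re w - Re z\<bar>" "b * \<bar>Im w - Im z\<bar> \<le> b' * \<bar>Im w - Im z\<bar>"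
    using assms by (auto intro: mult_right_mono)
  then show ?case using elim by linarith
qed

text \<open>
The chart of the tube with number \<open>n\<close> as a map on the plane of the first tube; \<open>ascend d n\<close> is the change of
coordinates from level \<open>n\<close> to level \<open>n + d\<close>, and \<open>profile d n\<close> the crossing function of the tube with
number \<open>n\<close>, in its own coordinates, that is flat off the tube with number \<open>n + d\<close>.
\<close>

primrec level :: "(nat \<Rightarrow> real) \<Rightarrow> (nat \<Rightarrow> real) \<Rightarrow> (nat \<Rightarrow> real) \<Rightarrow> nat \<Rightarrow> complex \<Rightarrow> complex" where
  "level s p h 0 z = z"
| "level s p h (Suc n) z = step (s n) (p n) (h n) (level s p h n z)"

primrec ascend :: "(nat \<Rightarrow> real) \<Rightarrow> (nat \<Rightarrow> real) \<Rightarrow> (nat \<Rightarrow> real) \<Rightarrow> nat \<Rightarrow> nat \<Rightarrow> complex \<Rightarrow> complex" where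
  "ascend s p h 0 n z = z"
| "ascend s p h (Suc d) n z = ascend s p h d (Suc n) (step (s n) (p n) (h n) z)"

primrec profile :: "(nat \<Rightarrow> real) \<Rightarrow> (nat \<Rightarrow> real) \<Rightarrow> (nat \<Rightarrow> real) \<Rightarrow> nat \<Rightarrow> nat \<Rightarrow> complex \<Rightarrow> real" where
  "profile s p h 0 n = (\<lambda>z. max 0 (min 1 (Im z)))"
| "profile s p h (Suc d) n = pull (s n) (p n) (h n) (profile s p h d (Suc n))"

lemma ascend_level: "ascend s p h d n (level s p h n z) = level s p h (n + d) z"
proof (induction d arbitrary: n)
  case (Suc d)
  have "ascend s p h (Suc d) n (level s p h n z) = ascend s p h d (Suc n) (level s p h (Suc n) z)" by simp
  then show ?case using Suc.IH[of "Suc n"] by simp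
qed simp

text \<open>
The bounds on \<open>h n\<close> and on \<open>s (Suc n)\<close> keep the vertical slopes of all profiles bounded, and they keep the
vertical slopes off the later tubes so small that the Lipschitz constant \<open>L n\<close> of the chart does no
harm. For even
\<open>n\<close> the next level has very long gaps: the slope \<open>s (Suc n)\<close> of a profile in a gap is small when
measured in the plane. For odd \<open>n\<close> the next level is fine: a piece of the tube of length
\<open>8 / s (Suc n)\<close> in its own coordinate has diameter at most \<open>(1/2) ^ n\<close>.
\<close>

locale tower =
  fixes s p h L :: "nat \<Rightarrow> real"
  assumes meander: "\<And>n. meander (s n) (p n) (h n)"
    and period: "\<And>n. \<exists>K::nat. p n = 1 / (2 * real K)"
    and L: "\<And>n. 1 \<le> L n" "\<And>n. L n \<le> L (Suc n)"
      "\<And>n z w. cmod (level s p h n w - level s p h n z) \<le> L n * cmod (w - z)"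
    and h_small: "\<And>n. h n \<le> (1/2) ^ n / 200"
    and s_next: "\<And>n. 48 * s n * (p n)\<^sup>2 * s (Suc n) \<le> (1/2) ^ n / (8 * L n)"
    and s_even: "\<And>n. even n \<Longrightarrow> s (Suc n) = s n" "\<And>n. even n \<Longrightarrow> s n * p n * L n \<le> (1/2) ^ n"
    and s_odd: "\<And>n. odd n \<Longrightarrow> 4 * s n \<le> s (Suc n)"
    and fine: "\<And>n z w. odd n \<Longrightarrow> Im (level s p h (Suc n) z) \<in> {0..1} \<Longrightarrow> Im (level s p h (Suc n) w) \<in> {0..1} \<Longrightarrow>
      \<bar>Re (level s p h (Suc n) z) - Re (level s p h (Suc n) w)\<bar> \<le> 8 / s (Suc n) \<Longrightarrow> cmod (z - w) \<le> (1/2) ^ n"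
begin

abbreviation "H \<equiv> level s p h"
abbreviation "F \<equiv> profile s p h"

lemma s: "1 \<le> s n" and p: "0 < p n" "p n \<le> 1/2" and h: "0 < h n" "h n \<le> 1/20" and sp: "s n * p n \<le> h n / 2"
  using meander[of n] unfolding meander_def by auto

lemma crossing_function_profile: "crossing_function (F d n)"
proof (induction d arbitrary: n)
  case 0 show ?case by (auto simp: crossing_function_def)
next
  case (Suc d)
  show ?case unfolding profile.simps by (rule meander.crossing_function_pull[OF meander Suc])
qed

text \<open>
Any sequence \<open>b\<close> that dominates the recursion of \<open>slope_bound_pull\<close> for the vertical slope bounds all
vertical slopes, from the starting value at the last level downwards; the horizontal slope is \<open>O(s n)\<close>
whatever happened above.
\<close>

lemma slope_bound_profile:
  assumes b: "\<And>n. 0 \<le> b n" "\<And>n. b n \<le> 2"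
      "\<And>n. (1 + 12 * h n) * b (Suc n) + (1/2) ^ n / (8 * L n) \<le> b n"
    and base: "slope_bound (F 0 (n + d)) (ascend s p h d n z) 0 (b (n + d))"
  shows "slope_bound (F d n) z (8 * s n) (b n)"
  using base
proof (induction d arbitrary: n z)
  case 0
  have "0 \<le> 8 * s n" using s[of n] by simp
  then show ?case using slope_bound_mono[OF 0] by simp
next
  case (Suc d)
  define c where "c = 1 + 5 * h n"
  have c: "1 \<le> c" "c \<le> 5/4" using h[of n] by (auto simp: c_def)
  have "slope_bound (F d (Suc n)) (step (s n) (p n) (h n) z) (8 * s (Suc n)) (b (Suc n))"
    by (rule Suc.IH) (use Suc.prems in simp)
  then have sb: "slope_bound (F (Suc d) n) z (c * s n * (1 + (p n)\<^sup>2 * (8 * s (Suc n)) + c * b (Suc n)))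
      (6 * s n * (p n)\<^sup>2 * (8 * s (Suc n)) + (1 + 12 * h n) * b (Suc n))"
    unfolding profile.simps c_def
    using s[of "Suc n"] b(1) by (intro meander.slope_bound_pull[OF meander crossing_function_profile]) auto
  have ps: "48 * (s n * (p n)\<^sup>2 * s (Suc n)) \<le> (1/2) ^ n / (8 * L n)"
    using s_next[of n] by (simp add: mult.assoc)
  also have "\<dots> \<le> 1 / 8"
    using L(1)[of n] power_le_one[of "1/2::real" n] by (intro frac_le) auto
  finally have ps8: "s n * (p n)\<^sup>2 * s (Suc n) \<le> 1 / 384" by simp
  have "1 * ((p n)\<^sup>2 * s (Suc n)) \<le> s n * ((p n)\<^sup>2 * s (Suc n))"
    using s[of n] s[of "Suc n"] by (intro mult_right_mono) auto
  with ps8 have pp: "(p n)\<^sup>2 * (8 * s (Suc n)) \<le> 1" by (simp add: mult.assoc)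
  have cb: "c * b (Suc n) \<le> 5/4 * 2" using c b(1,2)[of "Suc n"] by (intro mult_mono) auto
  have "c * s n * (1 + (p n)\<^sup>2 * (8 * s (Suc n)) + c * b (Suc n)) \<le> c * s n * (1 + 1 + 5/4 * 2)"
    using c s[of n] pp cb by (intro mult_left_mono add_mono) auto
  also have "\<dots> \<le> (5/4 * s n) * (1 + 1 + 5/4 * 2)"
    using c s[of n] by (intro mult_right_mono) auto
  also have "\<dots> \<le> 8 * s n" using s[of n] by simp
  finally have 1: "c * s n * (1 + (p n)\<^sup>2 * (8 * s (Suc n)) + c * b (Suc n)) \<le> 8 * s n" .
  have "6 * s n * (p n)\<^sup>2 * (8 * s (Suc n)) = 48 * (s n * (p n)\<^sup>2 * s (Suc n))" by simp
  then have 2: "6 * s n * (p n)\<^sup>2 * (8 * s (Suc n)) + (1 + 12 * h n) * b (Suc n) \<le> b n"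
    using ps b(3)[of n] by linarith
  show ?case by (rule slope_bound_mono[OF sb 1 2])
qed

lemma slope_bound_profile_general: "slope_bound (F d n) z (8 * s n) 2"
proof -
  \<comment> \<open>The base slope is 1, and the surplus \<open>(1/2) ^ n\<close> absorbs the errors of all later levels.\<close>
  define b where "b = (\<lambda>n. 1 + (1/2::real) ^ n)"
  have "slope_bound (F d n) z (8 * s n) (b n)"
  proof (rule slope_bound_profile)
    fix m
    have q: "0 \<le> (1/2::real) ^ m" "(1/2::real) ^ m \<le> 1" by (auto simp: power_le_one)
    show "0 \<le> b m" "b m \<le> 2" using q by (auto simp: b_def)
    have 1: "(1/2) ^ m / (8 * L m) \<le> (1/2) ^ m / 8"
      using L(1)[of m] q by (intro divide_left_mono) auto
    have 2: "12 * h m * (1 + (1/2) ^ Suc m) \<le> 12 * ((1/2) ^ m / 200) * 2"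
      using q h[of m] h_small[of m] by (intro mult_mono) auto
    show "(1 + 12 * h m) * b (Suc m) + (1/2) ^ m / (8 * L m) \<le> b m"
    proof -
      have "(1 + 12 * h m) * b (Suc m) = 1 + (1/2) ^ m / 2 + 12 * h m * (1 + (1/2) ^ Suc m)"
        by (simp add: b_def algebra_simps)
      moreover have "12 * ((1/2) ^ m / 200) * 2 = (3/25) * (1/2::real) ^ m" by simp
      ultimately show ?thesis using 1 2 q unfolding b_def by linarith
    qed
  next
    show "slope_bound (F 0 (n + d)) (ascend s p h d n z) 0 (b (n + d))"
      unfolding slope_bound_def
    proof (rule always_eventually, rule allI)
      fix w
      let ?z = "ascend s p h d n z"
      have "\<bar>F 0 (n + d) w - F 0 (n + d) ?z\<bar> \<le> 1 * \<bar>Im w - Im ?z\<bar>" by auto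
      also have "\<dots> \<le> b (n + d) * \<bar>Im w - Im ?z\<bar>" by (intro mult_right_mono) (auto simp: b_def)
      finally show "\<bar>F 0 (n + d) w - F 0 (n + d) ?z\<bar> \<le> 0 * \<bar>Re w - Re ?z\<bar> + b (n + d) * \<bar>Im w - Im ?z\<bar>" by simp
    qed
  qed
  then show ?thesis by (rule slope_bound_mono) (auto simp: b_def power_le_one)
qed

text \<open>
Off the last tube the recursion starts with slope 0, and only the error terms accumulate.
\<close>

lemma slope_bound_profile_off:
  assumes off: "Im (ascend s p h d n z) \<notin> {0..1}"
  shows "slope_bound (F d n) z (8 * s n) ((1/2) ^ n / (2 * L n))"
proof (rule slope_bound_profile)
  fix m
  define x where "x = (1/2::real) ^ m / L m"
  have q: "0 \<le> (1/2::real) ^ m" "(1/2::real) ^ m \<le> 1" by (auto simp: power_le_one)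
  have x: "0 \<le> x" "x \<le> 1" unfolding x_def using L(1)[of m] q by (auto simp: divide_le_eq)
  have bm: "(1/2) ^ m / (2 * L m) = x / 2" by (simp add: x_def)
  show "0 \<le> (1/2) ^ m / (2 * L m)" "(1/2) ^ m / (2 * L m) \<le> 2" unfolding bm using x by auto
  have "(1/2) ^ Suc m / (2 * L (Suc m)) \<le> (1/2) ^ Suc m / (2 * L m)"
    using L(1)[of m] L(1)[of "Suc m"] L(2)[of m] by (intro divide_left_mono) auto
  also have "\<dots> = x / 4" by (simp add: x_def)
  finally have bS: "(1/2) ^ Suc m / (2 * L (Suc m)) \<le> x / 4" .
  have h12: "12 * h m \<le> 3/50" using h_small[of m] q by simp
  have "(1 + 12 * h m) * ((1/2) ^ Suc m / (2 * L (Suc m))) \<le> (1 + 3/50) * (x / 4)"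
    using h12 h[of m] bS L(1)[of "Suc m"] by (intro mult_mono) auto
  moreover have "(1/2) ^ m / (8 * L m) = x / 8" by (simp add: x_def)
  moreover have "(1 + 3/50) * (x / 4) = (53/200) * x" by simp
  ultimately show "(1 + 12 * h m) * ((1/2) ^ Suc m / (2 * L (Suc m))) + (1/2) ^ m / (8 * L m) \<le> (1/2) ^ m / (2 * L m)"
    unfolding bm using x by linarith
next
  let ?z = "ascend s p h d n z"
  have tIm: "(Im \<longlongrightarrow> Im ?z) (nhds ?z)" by (intro tendsto_intros filterlim_ident)
  have "\<forall>\<^sub>F w in nhds ?z. (Im w < 0 \<and> Im ?z < 0) \<or> (1 < Im w \<and> 1 < Im ?z)"
  proof (cases "Im ?z < 0")
    case True
    show ?thesis using order_tendstoD(2)[OF tIm True] by eventually_elim (use True in simp)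
  next
    case False
    then have 1: "1 < Im ?z" using off by auto
    show ?thesis using order_tendstoD(1)[OF tIm 1] by eventually_elim (use 1 in simp)
  qed
  then show "slope_bound (F 0 (n + d)) ?z 0 ((1/2) ^ (n + d) / (2 * L (n + d)))"
    unfolding slope_bound_def
  proof eventually_elim
    case (elim w)
    then have "F 0 (n + d) w = F 0 (n + d) ?z" by auto
    then show ?case using L(1)[of "n + d"] by simp
  qed
qed

end

section \<open>The core of a tower is a line, and wraps to a Jordan curve\<close>

context tower begin

definition core :: "complex set" where "core = {z. \<forall>n. Im (H n z) \<in> {0..1}}"

lemma s_lower: "4 ^ j \<le> s (2 * j)"
proof (induction j)
  case 0 show ?case using s[of 0] by simp
next
  case (Suc j)
  have "4 * s (Suc (2 * j)) \<le> s (Suc (Suc (2 * j)))" by (intro s_odd) simp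
  moreover have "s (Suc (2 * j)) = s (2 * j)" by (intro s_even) simp
  ultimately show ?case using Suc by simp
qed

lemma level_surj: "\<exists>z. H n z = w"
proof (induction n arbitrary: w)
  case (Suc n)
  obtain y where "w = step (s n) (p n) (h n) y"
    using meander.step_surj[OF meander[of n]] by (metis surjD)
  then show ?case using Suc[of y] by auto
qed simp

lemma level_inj: "inj (H n)"
proof (induction n)
  case (Suc n)
  have "H (Suc n) = step (s n) (p n) (h n) \<circ> H n" by auto
  then show ?case using inj_compose[OF meander.step_inj[OF meander[of n]] Suc] by (simp only:)
qed (simp add: inj_on_def)

lemma level_continuous: "continuous_on A (H n)"
proof -
  have "(L n)-lipschitz_on A (H n)" using L[of n] order_trans[OF zero_le_one] by (intro lipschitz_onI) (auto simp: dist_norm)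
  then show ?thesis by (rule lipschitz_on_continuous_on)
qed

lemma level_tendsto: "(H n \<longlongrightarrow> H n z) (nhds z)"
  using level_continuous[of UNIV n] by (simp add: continuous_on_eq_continuous_at continuous_at tendsto_at_iff_tendsto_nhds)

lemma level_translate: "H n (z + of_int k) = H n z + of_int k"
proof -
  have "H n (z + 1) = H n z + 1" for z
  proof (induction n)
    case (Suc n)
    obtain K :: nat where "p n = 1 / (2 * real K)" using period by blast
    then show ?case using Suc meander.step_translate[OF meander[of n]] by simp
  qed simp
  from translate_of_int[of "H n", OF this] show ?thesis by simp
qed

lemma level_below: "n \<le> m \<Longrightarrow> Im (H n z) < 0 \<Longrightarrow> Im (H m z) < 0"
  by (induction m rule: dec_induct) (auto intro: meander.Im_step_below[OF meander])

lemma level_above: "n \<le> m \<Longrightarrow> 1 < Im (H n z) \<Longrightarrow> 1 < Im (H m z)"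
  by (induction m rule: dec_induct) (auto intro: meander.Im_step_above[OF meander])

lemma level_nested: "n \<le> m \<Longrightarrow> Im (H m z) \<in> {0..1} \<Longrightarrow> Im (H n z) \<in> {0..1}"
  using level_below[of n m z] level_above[of n m z] by (auto simp: not_less[symmetric])

lemma drift_step:
  assumes "Im (H n z) \<in> {0..1}"
  shows "\<bar>Re (H (Suc n) z) - Re (H n z)\<bar> \<le> (41/40) / s n"
proof -
  have "\<bar>Re (H (Suc n) z) - Re (H n z)\<bar> \<le> p n + \<bar>Im (H n z)\<bar> / s n"
    using meander.Re_step_close[OF meander[of n], of "H n z"] by simp
  also have "\<dots> \<le> (1/40) / s n + 1 / s n"
  proof (intro add_mono divide_right_mono)
    have "p n * s n \<le> 1/40" using sp[of n] h[of n] by (simp add: mult.commute)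
    then show "p n \<le> (1/40) / s n" using s[of n] by (simp add: pos_le_divide_eq)
  qed (use assms s[of n] in auto)
  finally show ?thesis by (simp add: add_divide_distrib[symmetric])
qed

text \<open>
The coordinate along the tube hardly changes from level to level: each step moves it by \<open>O(1 / s n)\<close>,
and these bounds add up like a geometric series.
\<close>

lemma drift:
  assumes n: "even n" "n \<le> m" and z: "Im (H m z) \<in> {0..1}"
  shows "\<bar>Re (H m z) - Re (H n z)\<bar> \<le> 3 / s n"
proof -
  have even_case: "\<bar>Re (H (n + 2 * j) z) - Re (H n z)\<bar> \<le> 3 / s n - 3 / s (n + 2 * j)" if "n + 2 * j \<le> m" for j
    using that
  proof (induction j)
    case (Suc j)
    let ?k = "n + 2 * j"
    have k: "even ?k" using n by simp
    have s_eq: "s (Suc ?k) = s ?k" using k by (rule s_even)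
    have 1: "\<bar>Re (H (Suc ?k) z) - Re (H ?k z)\<bar> \<le> (41/40) / s ?k"
      using Suc.prems by (intro drift_step level_nested[OF _ z]) simp
    have 2: "\<bar>Re (H (Suc (Suc ?k)) z) - Re (H (Suc ?k) z)\<bar> \<le> (41/40) / s ?k"
      using Suc.prems by (subst s_eq[symmetric], intro drift_step level_nested[OF _ z]) simp
    have 3: "3 / s (Suc (Suc ?k)) \<le> (3/4) / s ?k"
    proof -
      have "4 * s ?k \<le> s (Suc (Suc ?k))" using s_odd[of "Suc ?k"] k s_eq by simp
      then have "3 / s (Suc (Suc ?k)) \<le> 3 / (4 * s ?k)" using s[of ?k] s[of "Suc (Suc ?k)"] by (intro divide_left_mono) auto
      then show ?thesis by simp
    qed
    have 4: "\<bar>Re (H ?k z) - Re (H n z)\<bar> \<le> 3 / s n - 3 / s ?k" using Suc by simp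
    have 5: "(41/40) / s ?k + (41/40) / s ?k \<le> 3 / s ?k - (3/4) / s ?k"
      using s[of ?k] by (simp add: divide_simps)
    have "n + 2 * Suc j = Suc (Suc ?k)" by simp
    then show ?case using 1 2 3 4 5 by (simp only:)
  qed simp
  show ?thesis
  proof (cases "even m")
    case True
    then have "even (m - n)" using n by simp
    then obtain j where "m - n = 2 * j" by (elim evenE)
    then have j: "m = n + 2 * j" using n by simp
    have "0 \<le> 3 / s m" using s[of m] by simp
    moreover have "\<bar>Re (H m z) - Re (H n z)\<bar> \<le> 3 / s n - 3 / s m" using even_case[of j] by (simp add: j)
    ultimately show ?thesis by linarith
  next
    case False
    then have "even (m - Suc n)" "Suc n \<le> m" using n by (auto simp: Suc_le_eq le_less)
    then obtain j where "m - Suc n = 2 * j" by (elim evenE)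
    then have j: "m = Suc (n + 2 * j)" using \<open>Suc n \<le> m\<close> by simp
    have "\<bar>Re (H m z) - Re (H (n + 2 * j) z)\<bar> \<le> (41/40) / s (n + 2 * j)"
      unfolding j by (intro drift_step level_nested[OF _ z]) (simp add: j)
    moreover have "(41/40) / s (n + 2 * j) \<le> 3 / s (n + 2 * j)"
      using s[of "n + 2 * j"] by (intro divide_right_mono) auto
    moreover have "\<bar>Re (H (n + 2 * j) z) - Re (H n z)\<bar> \<le> 3 / s n - 3 / s (n + 2 * j)"
      using even_case[of j] j by simp
    ultimately show ?thesis by linarith
  qed
qed

abbreviation ev :: "nat \<Rightarrow> nat" where "ev j \<equiv> Suc (Suc (2 * j))"

lemma ev_even: "even (ev j)" by simp

lemma fine_even:
  assumes "Im (H (ev j) z) \<in> {0..1}" "Im (H (ev j) w) \<in> {0..1}"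
    "\<bar>Re (H (ev j) z) - Re (H (ev j) w)\<bar> \<le> 8 / s (ev j)"
  shows "cmod (z - w) \<le> (1/2) ^ Suc (2 * j)"
  by (rule fine[OF _ assms]) simp

lemma small_power: assumes "0 < (e::real)" obtains j where "(1/2::real) ^ Suc (2 * j) < e"
proof -
  obtain j where j: "(1/2::real) ^ j < e" using real_arch_pow_inv[OF assms, of "1/2"] by auto
  have "(1/2::real) ^ Suc (2 * j) \<le> (1/2) ^ j" by (intro power_decreasing) auto
  then show thesis using j that by (meson le_less_trans)
qed

lemma inv_s_small: assumes "0 < (e::real)" obtains j where "1 / s (ev j) < e"
proof -
  obtain j where j: "(1/2::real) ^ j < e" using real_arch_pow_inv[OF assms, of "1/2"] by auto
  have "(2::real) ^ j \<le> 4 ^ j" by (intro power_mono) auto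
  also have "\<dots> \<le> 4 ^ Suc j" by (intro power_increasing) auto
  also have "\<dots> \<le> s (ev j)" using s_lower[of "Suc j"] by simp
  finally have "1 / s (ev j) \<le> 1 / 2 ^ j" by (intro divide_left_mono) (use s[of "ev j"] in auto)
  then show thesis using j by (intro that[of j]) (simp add: power_one_over)
qed

text \<open>
The limit of the coordinates along the tubes; it parametrizes the core by the real line.
\<close>

definition coord :: "complex \<Rightarrow> real" where "coord z = lim (\<lambda>n. Re (H n z))"

lemma core_nested: "z \<in> core \<Longrightarrow> Im (H n z) \<in> {0..1}"
  unfolding core_def by blast

lemma coord_lim:
  assumes z: "z \<in> core" shows "(\<lambda>n. Re (H n z)) \<longlonglongrightarrow> coord z"
proof -
  have "Cauchy (\<lambda>n. Re (H n z))"
  proof (rule metric_CauchyI)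
    fix e :: real assume "0 < e"
    then obtain j where j: "1 / s (ev j) < e / 6" using inv_s_small[of "e / 6"] by auto
    show "\<exists>M. \<forall>m\<ge>M. \<forall>n\<ge>M. dist (Re (H m z)) (Re (H n z)) < e"
    proof (intro exI[of _ "ev j"] allI impI)
      fix m n assume "ev j \<le> m" "ev j \<le> n"
      then have "\<bar>Re (H m z) - Re (H (ev j) z)\<bar> \<le> 3 / s (ev j)" "\<bar>Re (H n z) - Re (H (ev j) z)\<bar> \<le> 3 / s (ev j)"
        using drift[OF ev_even _ core_nested[OF z]] by blast+
      moreover have "3 / s (ev j) = 3 * (1 / s (ev j))" by simp
      ultimately show "dist (Re (H m z)) (Re (H n z)) < e" using j unfolding dist_real_def by linarith
    qed
  qed
  then show ?thesis unfolding coord_def using Cauchy_convergent_iff convergent_LIMSEQ_iff by blast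
qed

lemma coord_close:
  assumes z: "z \<in> core" shows "\<bar>coord z - Re (H (ev j) z)\<bar> \<le> 3 / s (ev j)"
proof (rule LIMSEQ_le_const2)
  show "(\<lambda>m. \<bar>Re (H m z) - Re (H (ev j) z)\<bar>) \<longlonglongrightarrow> \<bar>coord z - Re (H (ev j) z)\<bar>"
    by (intro tendsto_rabs tendsto_diff tendsto_const coord_lim[OF z])
  show "\<exists>N. \<forall>m\<ge>N. \<bar>Re (H m z) - Re (H (ev j) z)\<bar> \<le> 3 / s (ev j)"
    using drift[OF ev_even _ core_nested[OF z]] by blast
qed

text \<open>
Points with close limit coordinates have close coordinates in every tube of even number, and these tubes are fine.
Hence the inverse of \<open>coord\<close> is continuous.
\<close>

lemma coord_modulus:
  assumes "z \<in> core" "w \<in> core" "\<bar>coord z - coord w\<bar> \<le> 2 / s (ev j)"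
  shows "cmod (z - w) \<le> (1/2) ^ Suc (2 * j)"
proof (rule fine_even)
  have "8 / s (ev j) = 3 / s (ev j) + 3 / s (ev j) + 2 / s (ev j)" by (simp flip: add_divide_distrib)
  then show "\<bar>Re (H (ev j) z) - Re (H (ev j) w)\<bar> \<le> 8 / s (ev j)"
    using coord_close[OF assms(1), of j] coord_close[OF assms(2), of j] assms(3) by linarith
qed (use assms core_nested in blast)+

lemma coord_inj:
  assumes "z \<in> core" "w \<in> core" "coord z = coord w" shows "z = w"
proof (rule ccontr)
  assume "z \<noteq> w"
  then obtain j where "(1/2::real) ^ Suc (2 * j) < cmod (z - w)" using small_power[of "cmod (z - w)"] by auto
  moreover have "cmod (z - w) \<le> (1/2) ^ Suc (2 * j)"
    using assms s[of "ev j"] by (intro coord_modulus) auto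
  ultimately show False by linarith
qed

text \<open>
Take the point on the centre line of each tube with the given coordinate. By fineness these points form
a Cauchy sequence, and its limit lies in all tubes.
\<close>

lemma coord_surj: "\<exists>z\<in>core. coord z = x"
proof -
  have "\<forall>n. \<exists>z. H n z = Complex x (1/2)" using level_surj by blast
  then obtain y where y: "\<And>n. H n (y n) = Complex x (1/2)" by metis
  have tube: "Im (H n (y m)) \<in> {0..1}" if "n \<le> m" for n m
    using level_nested[OF that, of "y m"] by (simp add: y)
  have close: "cmod (y m - y (ev j)) \<le> (1/2) ^ Suc (2 * j)" if "ev j \<le> m" for m j
  proof (rule fine_even)
    have "\<bar>Re (H m (y m)) - Re (H (ev j) (y m))\<bar> \<le> 3 / s (ev j)"
      by (rule drift[OF ev_even that]) (simp add: y)
    also have "\<dots> \<le> 8 / s (ev j)" using s[of "ev j"] by (intro divide_right_mono) auto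
    finally show "\<bar>Re (H (ev j) (y m)) - Re (H (ev j) (y (ev j)))\<bar> \<le> 8 / s (ev j)"
      unfolding y complex.sel by (simp add: abs_minus_commute del: level.simps)
  qed (use tube that in blast)+
  have "Cauchy y"
  proof (rule metric_CauchyI)
    fix e :: real assume "0 < e"
    then obtain j where j: "(1/2::real) ^ Suc (2 * j) < e / 2" using small_power[of "e / 2"] by auto
    show "\<exists>M. \<forall>m\<ge>M. \<forall>n\<ge>M. dist (y m) (y n) < e"
    proof (intro exI[of _ "ev j"] allI impI)
      fix m n assume "ev j \<le> m" "ev j \<le> n"
      then have "dist (y m) (y (ev j)) < e / 2" "dist (y n) (y (ev j)) < e / 2"
        using close[of j] j unfolding dist_norm by (meson le_less_trans)+
      then show "dist (y m) (y n) < e" by (rule dist_triangle_half_l)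
    qed
  qed
  then obtain z where z: "y \<longlonglongrightarrow> z" using Cauchy_convergent_iff convergent_def by blast
  have Hz: "(\<lambda>m. H n (y m)) \<longlonglongrightarrow> H n z" for n
    using continuous_on_tendsto_compose[OF level_continuous[of UNIV n] z] by simp
  have "Im (H n z) \<in> {0..1}" for n
  proof -
    have "(\<lambda>m. Im (H n (y (m + n)))) \<longlonglongrightarrow> Im (H n z)"
      using LIMSEQ_ignore_initial_segment[OF tendsto_Im[OF Hz[of n]], of n] by simp
    then show ?thesis
      by (rule closed_sequentially[OF closed_atLeastAtMost _, rotated]) (use tube in simp)
  qed
  then have core: "z \<in> core" by (simp add: core_def)
  have near: "\<bar>Re (H (ev j) z) - x\<bar> \<le> 3 / s (ev j)" for j
  proof (rule LIMSEQ_le_const2)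
    show "(\<lambda>m. \<bar>Re (H (ev j) (y m)) - x\<bar>) \<longlonglongrightarrow> \<bar>Re (H (ev j) z) - x\<bar>"
      by (intro tendsto_rabs tendsto_diff tendsto_const tendsto_Re Hz)
    have "\<bar>Re (H (ev j) (y m)) - x\<bar> \<le> 3 / s (ev j)" if "ev j \<le> m" for m
      using drift[OF ev_even that, of "y m"] by (simp add: y abs_minus_commute del: level.simps)
    then show "\<exists>N. \<forall>m\<ge>N. \<bar>Re (H (ev j) (y m)) - x\<bar> \<le> 3 / s (ev j)" by blast
  qed
  have "coord z = x"
  proof (rule ccontr)
    assume "coord z \<noteq> x"
    then obtain j where j: "1 / s (ev j) < \<bar>coord z - x\<bar> / 6" using inv_s_small[of "\<bar>coord z - x\<bar> / 6"] by auto
    then have "6 * (1 / s (ev j)) < \<bar>coord z - x\<bar>" by simp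
    moreover have "3 / s (ev j) = 3 * (1 / s (ev j))" by simp
    moreover have "\<bar>coord z - x\<bar> \<le> \<bar>coord z - Re (H (ev j) z)\<bar> + \<bar>Re (H (ev j) z) - x\<bar>" by linarith
    ultimately show False using near[of j] coord_close[OF core, of j] by linarith
  qed
  with core show ?thesis by blast
qed

lemma core_translate: "z + of_int k \<in> core \<longleftrightarrow> z \<in> core"
  by (simp add: core_def level_translate)

lemma coord_translate: "z \<in> core \<Longrightarrow> coord (z + of_int k) = coord z + of_int k"
proof -
  assume z: "z \<in> core"
  have "(\<lambda>n. Re (H n z) + of_int k) \<longlonglongrightarrow> coord z + of_int k" by (intro tendsto_intros coord_lim z)
  moreover have "(\<lambda>n. Re (H n (z + of_int k))) \<longlonglongrightarrow> coord (z + of_int k)"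
    by (rule coord_lim) (simp add: core_translate z)
  ultimately show ?thesis by (simp add: level_translate LIMSEQ_unique)
qed

definition point :: "real \<Rightarrow> complex" where "point x = (SOME z. z \<in> core \<and> coord z = x)"

lemma point: "point x \<in> core" "coord (point x) = x"
proof -
  have "\<exists>z. z \<in> core \<and> coord z = x" using coord_surj[of x] by blast
  from someI_ex[OF this] show "point x \<in> core" "coord (point x) = x" unfolding point_def by auto
qed

lemma point_coord: "z \<in> core \<Longrightarrow> point (coord z) = z"
  by (rule coord_inj) (auto simp: point)

lemma point_translate: "point (x + of_int k) = point x + of_int k"
  by (rule coord_inj) (simp_all add: point core_translate coord_translate)

lemma point_continuous: "continuous_on A point"
  unfolding continuous_on_iff
proof (intro ballI allI impI)
  fix x and e :: real assume "0 < e"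
  then obtain j where j: "(1/2::real) ^ Suc (2 * j) < e" using small_power by blast
  show "\<exists>d>0. \<forall>x'\<in>A. dist x' x < d \<longrightarrow> dist (point x') (point x) < e"
  proof (intro exI[of _ "2 / s (ev j)"] conjI ballI impI)
    show "0 < 2 / s (ev j)" using s[of "ev j"] by simp
    fix x' assume "dist x' x < 2 / s (ev j)"
    then have "cmod (point x' - point x) \<le> (1/2) ^ Suc (2 * j)"
      by (intro coord_modulus point) (simp add: point dist_real_def)
    then show "dist (point x') (point x) < e" using j unfolding dist_norm by linarith
  qed
qed

end

definition wrap :: "complex \<Rightarrow> complex" where "wrap z = exp (2 * of_real pi * \<i> * z)"

lemma wrap_eq: "wrap z = wrap w \<longleftrightarrow> (\<exists>k::int. z = w + of_int k)"
proof -
  have "2 * of_real pi * \<i> * z = 2 * of_real pi * \<i> * w + of_int (2 * k) * pi * \<i> \<longleftrightarrow> z = w + of_int k" for k :: int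
  proof -
    have "2 * of_real pi * \<i> * w + of_int (2 * k) * pi * \<i> = (2 * of_real pi * \<i>) * (w + of_int k)"
      by (simp add: algebra_simps)
    then show ?thesis by (simp only: mult_cancel_left) simp
  qed
  then show ?thesis by (simp add: wrap_def exp_eq)
qed

lemma wrap_continuous: "continuous_on A wrap"
  unfolding wrap_def by (intro continuous_intros)

context tower begin

definition curve :: "complex set" where "curve = wrap ` core"

text \<open>
The parametrization of the core by the real line commutes with integer translations, and the
wrapping map identifies exactly the points that differ by an integer.
\<close>

lemma jordan_curve_curve: "jordan_curve curve"
  unfolding jordan_curve_def
proof (intro exI[of _ "wrap \<circ> point"] conjI)
  show "simple_path (wrap \<circ> point)"
  proof (rule simple_pathI)
    show "path (wrap \<circ> point)" unfolding path_def
      by (intro continuous_on_compose point_continuous wrap_continuous)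
    fix x y :: real assume xy: "0 \<le> x" "x < y" "y \<le> 1" "(wrap \<circ> point) x = (wrap \<circ> point) y"
    then obtain k :: int where "point y = point x + of_int k" by (metis comp_apply wrap_eq)
    then have y: "y = x + of_int k" by (metis point(2) point_translate)
    then have "k = 1" using xy by linarith
    then show "x = 0 \<and> y = 1" using xy y by auto
  qed
  have "point 1 = point 0 + of_int 1" using point_translate[of 0 1] by simp
  then show "pathfinish (wrap \<circ> point) = pathstart (wrap \<circ> point)"
    unfolding pathfinish_def pathstart_def comp_def by (metis wrap_eq)
  show "curve = path_image (wrap \<circ> point)"
  proof
    show "path_image (wrap \<circ> point) \<subseteq> curve" by (auto simp: path_image_def curve_def point)
    show "curve \<subseteq> path_image (wrap \<circ> point)"
    proof
      fix u assume "u \<in> curve"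
      then obtain z where z: "z \<in> core" "u = wrap z" by (auto simp: curve_def)
      have "z = point (frac (coord z)) + of_int \<lfloor>coord z\<rfloor>"
        using point_coord[OF z(1)] point_translate[of "frac (coord z)" "\<lfloor>coord z\<rfloor>"] by (simp add: frac_def)
      then have "u = (wrap \<circ> point) (frac (coord z))" using z by (metis comp_apply wrap_eq)
      moreover have "frac (coord z) \<in> {0..1}" using frac_lt_1[of "coord z"] by simp
      ultimately show "u \<in> path_image (wrap \<circ> point)" unfolding path_image_def by blast
    qed
  qed
qed

end

section \<open>Crossing functions on the plane\<close>

text \<open>
Each covering set is put into a ball around one of its points, with a slightly larger radius.
\<close>

lemma hausdorff_null_cover:
  assumes null: "hausdorff_measure1 K = 0" and \<eta>: "0 < \<eta>"
  obtains c :: "nat \<Rightarrow> complex" and r :: "nat \<Rightarrow> real"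
  where "\<And>i. 0 < r i" "K \<subseteq> (\<Union>i. ball (c i) (r i))" "(\<Sum>i. ennreal (r i)) \<le> ennreal (2 * \<eta>)"
proof -
  have "hausdorff_premeasure1 1 K \<le> hausdorff_measure1 K"
    unfolding hausdorff_measure1_def by (rule SUP_upper) simp
  then have "hausdorff_premeasure1 1 K < ennreal \<eta>" using null \<eta> by simp
  then obtain E where E: "K \<subseteq> (\<Union>i. E i)" "\<And>i. bounded (E i)" "(\<Sum>i. ennreal (diameter (E i))) < ennreal \<eta>"
    unfolding hausdorff_premeasure1_def Inf_less_iff by blast
  define c where "c i = (SOME x. x \<in> E i)" for i
  define r where "r i = diameter (E i) + \<eta> * (1/2) ^ Suc i" for i
  have r: "0 < r i" for i unfolding r_def using diameter_ge_0[OF E(2)] \<eta> by (simp add: add_nonneg_pos)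
  have "E i \<subseteq> ball (c i) (r i)" for i
  proof
    fix x assume x: "x \<in> E i"
    then have "c i \<in> E i" unfolding c_def by (rule someI)
    then have "dist (c i) x \<le> diameter (E i)" using x E(2) by (intro diameter_bounded_bound) auto
    moreover have "0 < \<eta> * (1/2) ^ Suc i" using \<eta> by simp
    ultimately have "dist (c i) x < r i" unfolding r_def by linarith
    then show "x \<in> ball (c i) (r i)" by simp
  qed
  then have "(\<Union>i. E i) \<subseteq> (\<Union>i. ball (c i) (r i))" by (rule SUP_mono')
  then have "K \<subseteq> (\<Union>i. ball (c i) (r i))" using E(1) by (rule order_trans[rotated])
  moreover have "(\<Sum>i. ennreal (r i)) \<le> ennreal (2 * \<eta>)"
  proof -
    have "(\<Sum>i. ennreal (r i)) = (\<Sum>i. ennreal (diameter (E i))) + (\<Sum>i. ennreal (\<eta> * (1/2) ^ Suc i))"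
      unfolding r_def using diameter_ge_0[OF E(2)] \<eta> by (simp add: ennreal_plus suminf_add)
    also have "(\<Sum>i. ennreal (\<eta> * (1/2) ^ Suc i)) = ennreal \<eta>"
      using sums_mult[OF power_half_series, of \<eta>] \<eta> by (intro suminf_ennreal_eq) auto
    also have "(\<Sum>i. ennreal (diameter (E i))) + ennreal \<eta> \<le> ennreal \<eta> + ennreal \<eta>"
      using E(3) by (intro add_right_mono less_imp_le)
    also have "\<dots> = ennreal (2 * \<eta>)" using \<eta> by (simp flip: ennreal_plus)
    finally show ?thesis .
  qed
  ultimately show thesis using r that by blast
qed

lemma cmod_wrap: "cmod (wrap z) = exp (- 2 * pi * Im z)"
  by (simp add: wrap_def)

lemma wrap_surj: assumes "u \<noteq> 0" shows "\<exists>z. u = wrap z"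
proof -
  have "wrap (Ln u / (2 * of_real pi * \<i>)) = u" using assms by (simp add: wrap_def)
  then show ?thesis by metis
qed

text \<open>
A branch of the logarithm near a given point, with the Lipschitz bound that comes from the logarithm near 1.
\<close>

lemma wrap_lift:
  assumes close: "cmod (u - wrap z) < cmod (wrap z) / 2"
  obtains z' where "u = wrap z'" "cmod (z' - z) \<le> cmod (u - wrap z) / cmod (wrap z)"
proof -
  define x where "x = u / wrap z - 1"
  have nz: "wrap z \<noteq> 0" by (simp add: wrap_def)
  have "x = (u - wrap z) / wrap z" using nz by (simp add: x_def diff_divide_distrib)
  then have x: "cmod x = cmod (u - wrap z) / cmod (wrap z)" by (simp add: norm_divide)
  have x2: "cmod x < 1/2" using close nz by (simp add: x divide_less_eq)
  have x1: "1 + x \<noteq> 0"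
  proof
    assume "1 + x = 0"
    then have "x = -1" by (simp add: add_eq_0_iff)
    then show False using x2 by simp
  qed
  define z' where "z' = z + Ln (1 + x) / (2 * of_real pi * \<i>)"
  have "wrap z' = wrap z * exp (Ln (1 + x))"
    unfolding wrap_def z'_def by (simp add: distrib_left exp_add)
  also have "\<dots> = u" using x1 nz by (simp add: x_def)
  finally have 1: "u = wrap z'" ..
  have "cmod (z' - z) = cmod (Ln (1 + x)) / (2 * pi)" by (simp add: z'_def norm_divide norm_mult)
  also have "\<dots> \<le> 2 * cmod x / (2 * pi)" using norm_Ln_le[of x] x2 by (intro divide_right_mono) auto
  also have "\<dots> = cmod x / pi" by simp
  also have "\<dots> \<le> cmod x / 1" using pi_gt3 by (intro divide_left_mono) auto
  finally show thesis using 1 x that by simp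
qed

context meander begin

lemma pull_translate:
  fixes K :: nat
  assumes K: "p = 1 / (2 * real K)" and F: "\<And>z. F (z + 1) = F z"
  shows "pull s p h F (z + 1) = pull s p h F z"
proof -
  have K0: "K > 0" using K p by (cases K) auto
  have t: "\<tau> (z + 1) = \<tau> z + of_int (2 * int K)"
    using K K0 p by (simp add: skew_def field_simps)
  show ?thesis unfolding pull_def Let_def t floor_add_int[symmetric] by (simp add: step_translate[OF K] F)
qed

end

context tower begin

definition wave :: "nat \<Rightarrow> nat \<Rightarrow> complex \<Rightarrow> real" where "wave d n z = F d n (H n z)"

lemma profile_range: "0 \<le> F d n z" "F d n z \<le> 1"
  and profile_0: "Im z \<le> 0 \<Longrightarrow> F d n z = 0" and profile_1: "1 \<le> Im z \<Longrightarrow> F d n z = 1"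
  using crossing_function_profile[of d n] unfolding crossing_function_def by blast+

lemma wave_translate: "wave d n (z + of_int k) = wave d n z"
proof -
  have 1: "F d n (z + 1) = F d n z" for z
  proof (induction d arbitrary: n z)
    case (Suc d)
    obtain K :: nat where "p n = 1 / (2 * real K)" using period by blast
    then show ?case using meander.pull_translate[OF meander[of n], of K "F d (Suc n)" z] Suc by simp
  qed simp
  have "F d n (z + of_int k) = F d n z" for z
    using translate_of_int[of "F d n" 0] 1 by simp
  then show ?thesis by (simp add: wave_def level_translate)
qed

definition lip :: "nat \<Rightarrow> real" where "lip n = (8 * s n + 2) * L n"

lemma lip_ge: "2 \<le> lip n"
proof -
  have "2 * 1 \<le> (8 * s n + 2) * L n" using s[of n] L(1)[of n] by (intro mult_mono) auto
  then show ?thesis by (simp add: lip_def)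
qed

lemma wave_lipschitz: "\<bar>wave d n w - wave d n z\<bar> \<le> lip n * cmod (w - z)"
proof -
  have "norm (F d n w - F d n z) \<le> (8 * s n + 2) * cmod (w - z)" for w z
  proof (rule local_to_global_bound)
    fix z
    show "\<forall>\<^sub>F w in nhds z. norm (F d n w - F d n z) \<le> (8 * s n + 2) * cmod (w - z)"
      using slope_bound_profile_general[of d n z] unfolding slope_bound_def
    proof eventually_elim
      case (elim w)
      have "8 * s n * \<bar>Re w - Re z\<bar> \<le> 8 * s n * cmod (w - z)"
        using abs_Re_le_cmod[of "w - z"] s[of n] by (intro mult_left_mono) auto
      moreover have "\<bar>Im w - Im z\<bar> \<le> cmod (w - z)" using abs_Im_le_cmod[of "w - z"] by simp
      ultimately show ?case using elim by (simp add: distrib_right)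
    qed
  qed
  from this[of "H n w" "H n z"] have "\<bar>wave d n w - wave d n z\<bar> \<le> (8 * s n + 2) * cmod (H n w - H n z)"
    by (simp add: wave_def)
  also have "\<dots> \<le> (8 * s n + 2) * (L n * cmod (w - z))"
    using L(3)[of n w z] s[of n] by (intro mult_left_mono) auto
  finally show ?thesis by (simp add: lip_def mult.assoc)
qed

lemma wave_below: "Im (H n z) < 0 \<Longrightarrow> wave d n z = 0"
  and wave_above: "1 < Im (H n z) \<Longrightarrow> wave d n z = 1"
  by (simp_all add: wave_def profile_0 profile_1)

text \<open>
In the tube with odd number \<open>n\<close> the horizontal slope \<open>8 * s n\<close> of the profile is harmless because the
coordinate along that tube varies slowly (\<open>Re_step_slow\<close> and the choice of \<open>p\<close> one level before). The
vertical slope is small by \<open>slope_bound_profile_off\<close>. Outside that tube the profile is constant.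
\<close>

lemma wave_off:
  assumes n: "odd n" and off: "Im (H (n + d) z) \<notin> {0..1}"
  shows "\<forall>\<^sub>F w in nhds z. \<bar>wave d n w - wave d n z\<bar> \<le> 100 * (1/2) ^ n * cmod (w - z)"
proof -
  have tIm: "((\<lambda>w. Im (H n w)) \<longlongrightarrow> Im (H n z)) (nhds z)" by (intro tendsto_Im level_tendsto)
  consider "Im (H n z) < 0" | "1 < Im (H n z)" | "Im (H n z) \<in> {0..1}" by force
  then show ?thesis
  proof cases
    case 1
    show ?thesis using order_tendstoD(2)[OF tIm 1] by eventually_elim (use 1 in \<open>simp add: wave_below\<close>)
  next
    case 2
    show ?thesis using order_tendstoD(1)[OF tIm 2] by eventually_elim (use 2 in \<open>simp add: wave_above\<close>)
  next
    case 3
    obtain k where k: "n = Suc k" "even k" using n by (cases n) auto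
    have tube: "0 \<le> Im (step (s k) (p k) (h k) (H k z))" "Im (step (s k) (p k) (h k) (H k z)) \<le> 1"
      using 3 k by auto
    have "\<forall>\<^sub>F w in nhds z. \<bar>Re (H n w) - Re (H n z)\<bar> \<le> 3 * p k * (\<bar>Re (H k w) - Re (H k z)\<bar> + \<bar>Im (H k w) - Im (H k z)\<bar>)"
      using meander.Re_step_slow[OF meander tube] level_tendsto[of k z] unfolding filterlim_iff k(1) level.simps by blast
    moreover have "slope_bound (F d n) (H n z) (8 * s n) ((1/2) ^ n / (2 * L n))"
      by (rule slope_bound_profile_off) (simp only: ascend_level off not_False_eq_True)
    then have "\<forall>\<^sub>F w in nhds z. \<bar>F d n (H n w) - F d n (H n z)\<bar>
        \<le> 8 * s n * \<bar>Re (H n w) - Re (H n z)\<bar> + (1/2) ^ n / (2 * L n) * \<bar>Im (H n w) - Im (H n z)\<bar>"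
      using level_tendsto[of n z] unfolding filterlim_iff slope_bound_def by blast
    ultimately show ?thesis
    proof eventually_elim
      case (elim w)
      let ?d = "cmod (w - z)"
      have Hk: "\<bar>Re (H k w) - Re (H k z)\<bar> \<le> L k * ?d" "\<bar>Im (H k w) - Im (H k z)\<bar> \<le> L k * ?d"
        using L(3)[of k w z] abs_Re_le_cmod[of "H k w - H k z"] abs_Im_le_cmod[of "H k w - H k z"] by auto
      have Hn: "\<bar>Im (H n w) - Im (H n z)\<bar> \<le> L n * ?d"
        using L(3)[of n w z] abs_Im_le_cmod[of "H n w - H n z"] by auto
      have "8 * s n * \<bar>Re (H n w) - Re (H n z)\<bar> \<le> 8 * s n * (3 * p k * (L k * ?d + L k * ?d))"
        using elim(1) Hk s[of n] p[of k] by (intro mult_left_mono order_trans[OF elim(1)] add_mono) auto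
      also have "\<dots> = 48 * (s k * p k * L k) * ?d" using s_even(1)[OF k(2)] k(1) by simp
      also have "\<dots> \<le> 48 * (1/2) ^ k * ?d"
        using s_even(2)[OF k(2)] by (intro mult_right_mono mult_left_mono) auto
      finally have 1: "8 * s n * \<bar>Re (H n w) - Re (H n z)\<bar> \<le> 96 * (1/2) ^ n * ?d" by (simp add: k(1))
      have "(1/2) ^ n / (2 * L n) * \<bar>Im (H n w) - Im (H n z)\<bar> \<le> (1/2) ^ n / (2 * L n) * (L n * ?d)"
        using Hn L(1)[of n] by (intro mult_left_mono) auto
      also have "\<dots> = (1/2) * (1/2) ^ n * ?d" using L(1)[of n] by simp
      also have "\<dots> \<le> 4 * (1/2) ^ n * ?d" by (intro mult_right_mono) auto
      finally have 2: "(1/2) ^ n / (2 * L n) * \<bar>Im (H n w) - Im (H n z)\<bar> \<le> 4 * (1/2) ^ n * ?d" .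
      have "96 * (1/2) ^ n * ?d + 4 * (1/2) ^ n * ?d = 100 * (1/2) ^ n * ?d" by simp
      then show ?case unfolding wave_def using elim(2) 1 2 by linarith
    qed
  qed
qed

text \<open>
The crossing function on the wrapped plane. The centre 0 of the annulus belongs to the upper side, which
fixes its value there.
\<close>

definition potential :: "nat \<Rightarrow> nat \<Rightarrow> complex \<Rightarrow> real" where
  "potential d n u = (if u = 0 then 1 else wave d n (SOME z. u = wrap z))"

lemma potential_wrap: "potential d n (wrap z) = wave d n z"
proof -
  have "wrap z = wrap (SOME y. wrap z = wrap y)" by (rule someI[of _ z]) simp
  then obtain k :: int where "z = (SOME y. wrap z = wrap y) + of_int k" unfolding wrap_eq by blast
  then have "wave d n z = wave d n (SOME y. wrap z = wrap y)" by (metis wave_translate)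
  then show ?thesis by (simp add: potential_def wrap_def)
qed

lemma potential_near_0:
  assumes "cmod u < exp (- 2 * pi)" shows "potential d n u = 1"
proof (cases "u = 0")
  case False
  then obtain z where z: "u = wrap z" using wrap_surj by blast
  then have "1 < Im (H 0 z)" using assms by (simp add: cmod_wrap)
  then have "1 < Im (H n z)" by (rule level_above[rotated]) simp
  then show ?thesis by (simp add: z potential_wrap wave_above)
qed (simp add: potential_def)

lemma potential_range: "0 \<le> potential d n u" "potential d n u \<le> 1"
  using profile_range by (auto simp: potential_def wave_def)

text \<open>
Nearby points have nearby lifts; distant points are harmless since the values lie in \<open>{0..1}\<close>.
\<close>

lemma potential_lipschitz_aux:
  assumes u: "exp (- 2 * pi) \<le> cmod u"
  shows "\<bar>potential d n u' - potential d n u\<bar> \<le> lip n * exp (2 * pi) * cmod (u' - u)"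
proof (cases "cmod (u' - u) < cmod u / 2")
  case True
  have "u \<noteq> 0" using u by auto
  then obtain z where z: "u = wrap z" using wrap_surj by blast
  obtain z' where z': "u' = wrap z'" "cmod (z' - z) \<le> cmod (u' - u) / cmod u"
    using wrap_lift[of u' z] True z by metis
  have "\<bar>potential d n u' - potential d n u\<bar> \<le> lip n * cmod (z' - z)"
    using wave_lipschitz by (simp add: z z' potential_wrap)
  also have "\<dots> \<le> lip n * (cmod (u' - u) / exp (- 2 * pi))"
  proof (rule mult_left_mono)
    have "cmod (u' - u) / cmod u \<le> cmod (u' - u) / exp (- 2 * pi)"
      using u by (intro divide_left_mono) (auto simp: \<open>u \<noteq> 0\<close>)
    then show "cmod (z' - z) \<le> cmod (u' - u) / exp (- 2 * pi)" using z'(2) by linarith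
  qed (use lip_ge[of n] in simp)
  finally show ?thesis by (simp add: exp_minus divide_inverse mult_ac)
next
  case False
  have "exp (- 2 * pi) / 2 \<le> cmod (u' - u)" using False u by simp
  then have "(2 * exp (2 * pi)) * (exp (- 2 * pi) / 2) \<le> (lip n * exp (2 * pi)) * cmod (u' - u)"
    using lip_ge[of n] by (intro mult_mono) auto
  then have "1 \<le> lip n * exp (2 * pi) * cmod (u' - u)" by (simp flip: exp_add)
  then show ?thesis using potential_range[of d n u] potential_range[of d n u'] by (simp add: abs_le_iff)
qed

lemma potential_lipschitz: "\<bar>potential d n u' - potential d n u\<bar> \<le> lip n * exp (2 * pi) * cmod (u' - u)"
proof (cases "exp (- 2 * pi) \<le> cmod u")
  case True then show ?thesis by (rule potential_lipschitz_aux)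
next
  case u: False
  show ?thesis
  proof (cases "exp (- 2 * pi) \<le> cmod u'")
    case True
    then show ?thesis using potential_lipschitz_aux[of u' d n u] by (simp add: abs_minus_commute norm_minus_commute)
  next
    case False
    then show ?thesis using u lip_ge[of n] by (simp add: potential_near_0 not_le)
  qed
qed

definition tube :: "nat \<Rightarrow> complex set" where "tube m = wrap ` {z. Im (H m z) \<in> {0..1}}"

lemma wrap_in_tube: "wrap z \<in> tube m \<longleftrightarrow> Im (H m z) \<in> {0..1}"
proof
  assume "wrap z \<in> tube m"
  then obtain y where "wrap z = wrap y" "Im (H m y) \<in> {0..1}" unfolding tube_def by blast
  moreover then obtain k :: int where "z = y + of_int k" using wrap_eq by blast
  ultimately show "Im (H m z) \<in> {0..1}" by (simp add: level_translate)
qed (auto simp: tube_def)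

lemma potential_off:
  assumes n: "odd n" and off: "u \<notin> tube (n + d)"
  shows "\<forall>\<^sub>F u' in nhds u. \<bar>potential d n u' - potential d n u\<bar> \<le> 100 * (1/2) ^ n * exp (2 * pi) * cmod (u' - u)"
proof (cases "cmod u < exp (- 2 * pi)")
  case True
  have "(cmod \<longlongrightarrow> cmod u) (nhds u)" by (intro tendsto_norm filterlim_ident)
  then have "\<forall>\<^sub>F u' in nhds u. cmod u' < exp (- 2 * pi)" using True by (rule order_tendstoD(2))
  then show ?thesis by eventually_elim (use True in \<open>simp add: potential_near_0\<close>)
next
  case False
  then have nz: "u \<noteq> 0" by auto
  then obtain z where z: "u = wrap z" using wrap_surj by blast
  then have "Im (H (n + d) z) \<notin> {0..1}" using off wrap_in_tube by blast
  then obtain e where e: "0 < e" "\<And>z'. dist z' z < e \<Longrightarrow> \<bar>wave d n z' - wave d n z\<bar> \<le> 100 * (1/2) ^ n * cmod (z' - z)"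
    using wave_off[OF n] unfolding eventually_nhds_metric by blast
  have "\<forall>\<^sub>F u' in nhds u. dist u' u < min (cmod u / 2) (e * cmod u)"
    using nz e(1) by (auto simp: eventually_nhds_metric intro!: exI[of _ "min (cmod u / 2) (e * cmod u)"])
  then show ?thesis
  proof eventually_elim
    case (elim u')
    then have "cmod (u' - wrap z) < cmod (wrap z) / 2" by (simp add: dist_norm z)
    then obtain z' where z': "u' = wrap z'" "cmod (z' - z) \<le> cmod (u' - u) / cmod u"
      using wrap_lift[of u' z] z by metis
    have "cmod (u' - u) / cmod u < e" using elim nz by (simp add: dist_norm divide_less_eq)
    then have "\<bar>potential d n u' - potential d n u\<bar> \<le> 100 * (1/2) ^ n * cmod (z' - z)"
      using z'(2) e(2)[of z'] by (simp add: z z'(1) potential_wrap dist_norm)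
    also have "\<dots> \<le> 100 * (1/2) ^ n * (cmod (u' - u) / exp (- 2 * pi))"
    proof (rule mult_left_mono)
      have "cmod (u' - u) / cmod u \<le> cmod (u' - u) / exp (- 2 * pi)"
        using False nz by (intro divide_left_mono) auto
      then show "cmod (z' - z) \<le> cmod (u' - u) / exp (- 2 * pi)" using z'(2) by linarith
    qed simp
    also have "cmod (u' - u) / exp (- 2 * pi) = exp (2 * pi) * cmod (u' - u)"
      by (simp add: exp_minus divide_inverse)
    finally show ?case by (simp only: mult.assoc)
  qed
qed

end

section \<open>The two sides of the curve, and the crossing estimate\<close>

context tower begin

lemma tube_compact: "compact (tube m)"
proof -
  let ?B = "cbox (Complex 0 0) (Complex 1 1) \<inter> {z. Im (H m z) \<in> {0..1}}"
  have "{z. Im (H m z) \<in> {0..1}} = {z. 0 \<le> Im (H m z)} \<inter> {z. Im (H m z) \<le> 1}" by auto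
  then have "closed {z. Im (H m z) \<in> {0..1}}"
    by (simp only:) (intro closed_Int closed_Collect_le continuous_intros level_continuous)
  then have "compact (wrap ` ?B)"
    by (intro compact_continuous_image wrap_continuous compact_Int_closed) auto
  moreover have "tube m = wrap ` ?B"
  proof
    show "tube m \<subseteq> wrap ` ?B"
    proof
      fix u assume "u \<in> tube m"
      then obtain z where z: "u = wrap z" "Im (H m z) \<in> {0..1}" unfolding tube_def by blast
      define y where "y = z + of_int (- \<lfloor>Re z\<rfloor>)"
      have Hy: "Im (H m y) \<in> {0..1}" unfolding y_def level_translate using z(2) by simp
      then have "Im (H 0 y) \<in> {0..1}" by (rule level_nested[rotated]) simp
      then have "y \<in> cbox (Complex 0 0) (Complex 1 1)"
        by (simp add: in_cbox_complex_iff y_def) linarith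
      moreover have "z = y + of_int \<lfloor>Re z\<rfloor>" by (simp add: y_def)
      then have "wrap z = wrap y" unfolding wrap_eq by blast
      ultimately show "u \<in> wrap ` ?B" using Hy z(1) by blast
    qed
  qed (auto simp: tube_def)
  ultimately show ?thesis by simp
qed

lemma tube_antimono: "n \<le> m \<Longrightarrow> tube m \<subseteq> tube n"
  unfolding tube_def using level_nested by blast

lemma curve_eq_Inter_tube: "curve = (\<Inter>m. tube m)"
proof
  show "curve \<subseteq> (\<Inter>m. tube m)" by (auto simp: curve_def tube_def core_def)
  show "(\<Inter>m. tube m) \<subseteq> curve"
  proof
    fix u assume u: "u \<in> (\<Inter>m. tube m)"
    then obtain z where z: "u = wrap z" unfolding tube_def by blast
    then have "z \<in> core" using u wrap_in_tube unfolding core_def by blast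
    then show "u \<in> curve" using z by (simp add: curve_def)
  qed
qed

text \<open>
The two sides of the wrapped tube. Points with large imaginary part wrap to a punctured
neighbourhood of 0, so 0 is added to the upper side.
\<close>

definition below :: "nat \<Rightarrow> complex set" where "below m = wrap ` {z. Im (H m z) < 0}"
definition above :: "nat \<Rightarrow> complex set" where "above m = insert 0 (wrap ` {z. 1 < Im (H m z)})"

text \<open>
The charts are homeomorphisms of the plane, by invariance of domain.
\<close>

lemma connected_level_preimage:
  assumes "connected S" shows "connected {z. H m z \<in> S}"
proof -
  have gf: "inv (H m) (H m z) = z" for z using level_inj by simp
  have "surj (H m)" unfolding surj_def using level_surj by metis
  moreover have "continuous_on (H m ` UNIV) (inv (H m))"
    by (rule continuous_on_inverse_open[OF open_UNIV level_continuous]) (auto simp: gf)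
  ultimately have "connected (inv (H m) ` S)"
    using assms by (intro connected_continuous_image) (auto intro: continuous_on_subset)
  moreover have "inv (H m) ` S = {z. H m z \<in> S}"
    using \<open>surj (H m)\<close> gf by (auto simp: surj_f_inv_f) (metis image_eqI)
  ultimately show ?thesis by simp
qed

lemma below_connected: "connected (below m)"
proof -
  have "connected {z. H m z \<in> {w. Im w < 0}}"
    by (intro connected_level_preimage convex_connected convex_halfspace_Im_lt)
  then show ?thesis unfolding below_def
    by (intro connected_continuous_image wrap_continuous) simp
qed

lemma above_connected: "connected (above m)"
proof -
  have "connected {z. H m z \<in> {w. 1 < Im w}}"
    by (intro connected_level_preimage convex_connected convex_halfspace_Im_gt)
  then have c: "connected (wrap ` {z. 1 < Im (H m z)})"
    by (intro connected_continuous_image wrap_continuous) simp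
  have "0 \<in> closure (wrap ` {z. 1 < Im (H m z)})"
    unfolding closure_approachable
  proof (intro allI impI)
    fix e :: real assume e: "0 < e"
    define y where "y = 2 + \<bar>ln e\<bar>"
    let ?z = "Complex 0 y"
    have "1 < Im (H 0 ?z)" by (simp add: y_def)
    then have "1 < Im (H m ?z)" by (rule level_above[rotated]) simp
    moreover have "dist (wrap ?z) 0 < e"
    proof -
      have "1 * y \<le> 2 * pi * y" using pi_gt3 by (intro mult_right_mono) (auto simp: y_def)
      then have "- 2 * pi * y < ln e" by (simp add: y_def)
      then have "exp (- 2 * pi * y) < exp (ln e)" by (simp only: exp_less_cancel_iff)
      then show ?thesis using e by (simp add: dist_norm cmod_wrap)
    qed
    ultimately show "\<exists>u\<in>wrap ` {z. 1 < Im (H m z)}. dist u 0 < e" by blast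
  qed
  then show ?thesis unfolding above_def
    by (intro connected_intermediate_closure[OF c]) (auto intro: closure_subset[THEN subsetD])
qed

lemma below_mono: "n \<le> m \<Longrightarrow> below n \<subseteq> below m"
  and above_mono: "n \<le> m \<Longrightarrow> above n \<subseteq> above m"
  unfolding below_def above_def using level_below level_above by blast+

lemma curve_complement: "- curve = (\<Union>m. below m) \<union> (\<Union>m. above m)"
proof
  show "- curve \<subseteq> (\<Union>m. below m) \<union> (\<Union>m. above m)"
  proof
    fix u assume "u \<in> - curve"
    then obtain m where m: "u \<notin> tube m" unfolding curve_eq_Inter_tube by blast
    show "u \<in> (\<Union>m. below m) \<union> (\<Union>m. above m)"
    proof (cases "u = 0")
      case False
      then obtain z where z: "u = wrap z" using wrap_surj by blast
      then have "Im (H m z) < 0 \<or> 1 < Im (H m z)" using m wrap_in_tube[of z m] by auto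
      then show ?thesis using z unfolding below_def above_def by blast
    qed (auto simp: above_def)
  qed
  have "wrap z \<notin> curve" if "Im (H m z) < 0 \<or> 1 < Im (H m z)" for z m
    using that wrap_in_tube[of z m] unfolding curve_eq_Inter_tube by auto
  moreover have "0 \<notin> curve" by (auto simp: curve_def wrap_def)
  ultimately show "(\<Union>m. below m) \<union> (\<Union>m. above m) \<subseteq> - curve"
    unfolding below_def above_def by auto
qed

lemma below_Union_connected: "connected (\<Union>m. below m)"
proof (rule connected_Union)
  have "Im (H m (Complex 0 (-1))) < 0" for m by (rule level_below[of 0]) auto
  then have "wrap (Complex 0 (-1)) \<in> below m" for m by (auto simp: below_def)
  then show "\<Inter>(range below) \<noteq> {}" by blast
qed (auto simp: below_connected)

lemma above_Union_connected: "connected (\<Union>m. above m)"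
proof (rule connected_Union)
  have "0 \<in> above m" for m by (simp add: above_def)
  then show "\<Inter>(range above) \<noteq> {}" by blast
qed (auto simp: above_connected)

text \<open>
The lower sides increase with the level, and so do the upper sides. Each of the two unions is connected
and together they exhaust the complement of the curve, so points of distinct components are on
different sides of some tube.
\<close>

lemma separated_by_levels:
  assumes U: "U \<in> components (- curve)" "V \<in> components (- curve)" "U \<noteq> V" and pq: "u \<in> U" "v \<in> V"
  obtains m where "u \<in> below m \<and> v \<in> above m \<or> v \<in> below m \<and> u \<in> above m"
proof -
  have disj: "U \<inter> V = {}" using U components_nonoverlap by blast
  have sub: "U \<subseteq> - curve" "V \<subseteq> - curve" using U in_components_subset by blast+
  have no: "\<not> (u \<in> T \<and> v \<in> T)" if T: "connected T" "T \<subseteq> - curve" for T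
  proof
    assume "u \<in> T \<and> v \<in> T"
    then have "T \<subseteq> U" using components_maximal[OF U(1) T] pq by blast
    then show False using disj pq \<open>u \<in> T \<and> v \<in> T\<close> by blast
  qed
  have "\<not> (u \<in> (\<Union>m. below m) \<and> v \<in> (\<Union>m. below m))" "\<not> (u \<in> (\<Union>m. above m) \<and> v \<in> (\<Union>m. above m))"
    using no[OF below_Union_connected] no[OF above_Union_connected] curve_complement by blast+
  moreover have "u \<in> (\<Union>m. below m) \<union> (\<Union>m. above m)" "v \<in> (\<Union>m. below m) \<union> (\<Union>m. above m)"
    using sub pq curve_complement by blast+
  ultimately consider i j where "u \<in> below i" "v \<in> above j" | i j where "v \<in> below i" "u \<in> above j" by blast
  then show thesis
  proof cases
    case 1
    then show ?thesis using below_mono[of i "max i j"] above_mono[of j "max i j"] that[of "max i j"] by auto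
  next
    case 2
    then show ?thesis using below_mono[of i "max i j"] above_mono[of j "max i j"] that[of "max i j"] by auto
  qed
qed

lemma potential_below: "u \<in> below m \<Longrightarrow> m \<le> n \<Longrightarrow> potential d n u = 0"
  and potential_above: "u \<in> above m \<Longrightarrow> m \<le> n \<Longrightarrow> potential d n u = 1"
proof -
  show "u \<in> below m \<Longrightarrow> m \<le> n \<Longrightarrow> potential d n u = 0"
    unfolding below_def using level_below by (auto simp: potential_wrap wave_below)
  show "potential d n u = 1" if u: "u \<in> above m" and mn: "m \<le> n"
  proof (cases "u = 0")
    case True then show ?thesis by (simp add: potential_def)
  next
    case False
    then obtain z where "u = wrap z" "1 < Im (H m z)" using u by (auto simp: above_def)
    then show ?thesis using level_above[OF mn] by (simp add: potential_wrap wave_above)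
  qed
qed

text \<open>
The level \<open>n\<close> is chosen first, so large that the part of the path off the tubes is negligible; then the
cover of the intersection, whose size depends on the Lipschitz constant for \<open>n\<close>; and only then the
number \<open>n + d\<close> of a tube that meets the path inside the cover. This order is possible because the
Lipschitz constant does not depend on \<open>d\<close>.
\<close>

theorem rectifiable_crossing_positive:
  assumes \<sigma>: "path \<sigma>" "rectifiable \<sigma>"
    and UV: "U \<in> components (- curve)" "V \<in> components (- curve)" "U \<noteq> V" "pathstart \<sigma> \<in> U" "pathfinish \<sigma> \<in> V"
  shows "0 < hausdorff_measure1 (path_image \<sigma> \<inter> curve)"
proof (rule ccontr)
  assume "\<not> 0 < hausdorff_measure1 (path_image \<sigma> \<inter> curve)"
  then have null: "hausdorff_measure1 (path_image \<sigma> \<inter> curve) = 0" by (simp add: not_gr_zero)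
  define \<Lambda> where "\<Lambda> = enn2real (curve_length \<sigma>)"
  have \<Lambda>: "curve_length \<sigma> = ennreal \<Lambda>" "0 \<le> \<Lambda>"
    using \<sigma>(2) by (auto simp: rectifiable_def \<Lambda>_def)
  obtain m0 where m0: "pathstart \<sigma> \<in> below m0 \<and> pathfinish \<sigma> \<in> above m0 \<or> pathfinish \<sigma> \<in> below m0 \<and> pathstart \<sigma> \<in> above m0"
    using separated_by_levels[OF UV] by blast
  obtain n where n: "odd n" "m0 \<le> n" "2 * (100 * (1/2) ^ n * exp (2 * pi)) * \<Lambda> < 1/4"
  proof -
    have pos: "0 < 800 * exp (2 * pi) * (\<Lambda> + 1)" using \<Lambda> by simp
    then obtain j where j: "(1/2::real) ^ j < 1 / (800 * exp (2 * pi) * (\<Lambda> + 1))"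
      using real_arch_pow_inv[of "1 / (800 * exp (2 * pi) * (\<Lambda> + 1))" "1/2"] by auto
    define n where "n = 2 * (j + m0) + 1"
    have "(1/2::real) ^ n \<le> (1/2) ^ j" unfolding n_def by (intro power_decreasing) auto
    with j have "(1/2::real) ^ n < 1 / (800 * exp (2 * pi) * (\<Lambda> + 1))" by linarith
    then have "(1/2::real) ^ n * (800 * exp (2 * pi) * (\<Lambda> + 1)) < 1"
      by (simp only: pos_less_divide_eq[OF pos])
    moreover have "(1/2::real) ^ n * (800 * exp (2 * pi) * \<Lambda>) \<le> (1/2::real) ^ n * (800 * exp (2 * pi) * (\<Lambda> + 1))"
      by (intro mult_left_mono) auto
    ultimately have "(1/2::real) ^ n * (800 * exp (2 * pi) * \<Lambda>) < 1" by (rule le_less_trans[rotated])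
    then have "2 * (100 * (1/2) ^ n * exp (2 * pi)) * \<Lambda> < 1/4" by (simp add: mult_ac)
    then show thesis by (intro that[of n]) (auto simp: n_def)
  qed
  define \<delta> where "\<delta> = 100 * (1/2::real) ^ n * exp (2 * pi)"
  have \<delta>: "0 \<le> \<delta>" "2 * \<delta> * \<Lambda> < 1/4" using n by (auto simp: \<delta>_def)
  define C where "C = lip n * exp (2 * pi)"
  have C: "0 < C" using lip_ge[of n] by (simp add: C_def)
  obtain c r where cr: "\<And>i. 0 < r i" "path_image \<sigma> \<inter> curve \<subseteq> (\<Union>i. ball (c i) (r i))"
    "(\<Sum>i. ennreal (r i)) \<le> ennreal (2 * (1 / (16 * C)))"
  proof -
    have "0 < 1 / (16 * C)" using C by simp
    from hausdorff_null_cover[OF null this] show thesis using that by blast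
  qed
  \<comment> \<open>By compactness the part of the path outside the small balls already avoids some tube.\<close>
  obtain d where d: "path_image \<sigma> \<inter> tube (n + d) \<subseteq> (\<Union>i. ball (c i) (r i))"
  proof -
    define B where "B = (\<Union>i. ball (c i) (r i))"
    define R where "R = path_image \<sigma> - B"
    have "compact R" unfolding R_def B_def using \<sigma>(1) by (intro compact_diff compact_path_image open_UN) auto
    moreover have "closed (tube m)" for m using tube_compact compact_imp_closed by blast
    moreover have "R \<inter> (\<Inter>m. tube m) = {}"
      using cr(2) unfolding R_def B_def[symmetric] curve_eq_Inter_tube[symmetric] by blast
    ultimately obtain I where I: "finite I" "R \<inter> (\<Inter>m\<in>I. tube m) = {}"
      using compact_imp_fip_image[of R UNIV tube] by blast
    define d where "d = Max (insert 0 I)"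
    have "tube (n + d) \<subseteq> tube m" if "m \<in> I" for m
      using that I(1) by (intro tube_antimono) (simp add: d_def trans_le_add2)
    then have "tube (n + d) \<subseteq> (\<Inter>m\<in>I. tube m)" by (rule INT_greatest)
    then have "path_image \<sigma> \<inter> tube (n + d) \<subseteq> B" using I(2) unfolding R_def by blast
    then show thesis using that[of d] unfolding B_def by blast
  qed
  define f where "f = potential d n"
  have f_lip: "\<bar>f u' - f u\<bar> \<le> C * cmod (u' - u)" for u u'
    unfolding f_def C_def by (rule potential_lipschitz)
  have "C-lipschitz_on UNIV f" using C f_lip by (intro lipschitz_onI) (auto simp: dist_norm)
  then have f_cont: "continuous_on UNIV f" by (rule lipschitz_on_continuous_on)
  define W where "W = (\<Union>i. {f (c i) - C * r i <..< f (c i) + C * r i})"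
  have W: "open W" unfolding W_def by (intro open_UN ballI open_greaterThanLessThan)
  have W_small: "emeasure lborel W \<le> ennreal (1/4)"
  proof -
    have "emeasure lborel W \<le> (\<Sum>i. emeasure lborel {f (c i) - C * r i <..< f (c i) + C * r i})"
      unfolding W_def by (rule emeasure_subadditive_countably) auto
    also have "\<dots> = (\<Sum>i. ennreal (2 * C) * ennreal (r i))"
      using C cr(1) by (intro suminf_cong) (simp add: less_imp_le ennreal_mult[symmetric])
    also have "\<dots> = ennreal (2 * C) * (\<Sum>i. ennreal (r i))" by (rule ennreal_suminf_cmult)
    also have "\<dots> \<le> ennreal (2 * C) * ennreal (2 * (1 / (16 * C)))" by (intro mult_left_mono cr(3)) simp
    also have "\<dots> = ennreal (1/4)" using C by (simp add: ennreal_mult[symmetric])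
    finally show ?thesis .
  qed
  have "f (\<sigma> t) \<in> W \<or> (\<forall>\<^sub>F u in nhds (\<sigma> t). \<bar>f u - f (\<sigma> t)\<bar> \<le> \<delta> * cmod (u - \<sigma> t))" if t: "t \<in> {0..1}" for t
  proof (cases "\<sigma> t \<in> tube (n + d)")
    case True
    moreover have "\<sigma> t \<in> path_image \<sigma>" using t by (simp add: path_image_def)
    ultimately have "\<sigma> t \<in> (\<Union>i. ball (c i) (r i))" using d by (meson IntI subsetD)
    then obtain i where "\<sigma> t \<in> ball (c i) (r i)" by (rule UN_E)
    then have "cmod (\<sigma> t - c i) < r i" by (simp add: dist_norm norm_minus_commute)
    then have "C * cmod (\<sigma> t - c i) < C * r i" using C by simp
    then have "\<bar>f (\<sigma> t) - f (c i)\<bar> < C * r i" using f_lip[of "\<sigma> t" "c i"] by linarith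
    then have "f (\<sigma> t) \<in> {f (c i) - C * r i <..< f (c i) + C * r i}" by (auto simp: abs_less_iff)
    then show ?thesis unfolding W_def by (intro disjI1 UN_I[of i]) auto
  next
    case False
    then show ?thesis unfolding f_def \<delta>_def using potential_off[OF n(1)] by blast
  qed
  then obtain S where S: "polygonal_length \<sigma> 0 1 S" "emeasure lborel (f ` \<sigma> ` {0..1} - W) \<le> ennreal (2 * \<delta> * S)"
    using emeasure_image_off_open_le[OF \<sigma>(1) f_cont W \<delta>(1)] by blast
  have "ennreal S \<le> ennreal \<Lambda>" using polygonal_length_le_curve_length[OF S(1)] \<Lambda> by simp
  then have "S \<le> \<Lambda>" using \<Lambda>(2) by (simp add: ennreal_le_iff)
  then have "2 * \<delta> * S \<le> 2 * \<delta> * \<Lambda>" using \<delta>(1) by (intro mult_left_mono) auto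
  then have off: "emeasure lborel (f ` \<sigma> ` {0..1} - W) \<le> ennreal (1/4)"
    using S(2) \<delta>(2) by (intro order_trans[OF S(2)] ennreal_leI) linarith
  have cont: "continuous_on {0..1} (\<lambda>t. f (\<sigma> t))"
    using \<sigma>(1) by (intro continuous_on_compose2[OF f_cont]) (auto simp: path_def)
  have "{0..1} \<subseteq> f ` \<sigma> ` {0..1}"
  proof -
    have conn: "connected ((\<lambda>t. f (\<sigma> t)) ` {0..1})" using cont by (intro connected_continuous_image) auto
    have "f (\<sigma> 0) = 0 \<and> f (\<sigma> 1) = 1 \<or> f (\<sigma> 1) = 0 \<and> f (\<sigma> 0) = 1"
      using m0 potential_below[OF _ n(2)] potential_above[OF _ n(2)]
      unfolding f_def pathstart_def pathfinish_def by blast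
    moreover have "f (\<sigma> 0) \<in> (\<lambda>t. f (\<sigma> t)) ` {0..1}" "f (\<sigma> 1) \<in> (\<lambda>t. f (\<sigma> t)) ` {0..1}"
      by (intro imageI; simp)+
    ultimately have "0 \<in> (\<lambda>t. f (\<sigma> t)) ` {0..1}" "1 \<in> (\<lambda>t. f (\<sigma> t)) ` {0..1}" by auto
    then show ?thesis using connected_contains_Icc[OF conn] by (simp add: image_image)
  qed
  then have "{0..1} \<subseteq> W \<union> (f ` \<sigma> ` {0..1} - W)" by blast
  have meas: "f ` \<sigma> ` {0..1} - W \<in> sets lborel"
  proof -
    have "compact (f ` \<sigma> ` {0..1})" using compact_continuous_image[OF cont] by (simp add: image_image)
    then show ?thesis using sets.Diff[OF borel_compact borel_open[OF W]] by simp
  qed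
  have "emeasure lborel {0..1::real} \<le> emeasure lborel (W \<union> (f ` \<sigma> ` {0..1} - W))"
    using \<open>{0..1} \<subseteq> W \<union> _\<close> W meas by (intro emeasure_mono sets.Un) auto
  also have "\<dots> \<le> emeasure lborel W + emeasure lborel (f ` \<sigma> ` {0..1} - W)"
    by (intro emeasure_subadditive meas) (simp add: W)
  also have "\<dots> \<le> ennreal (1/4) + ennreal (1/4)" by (intro add_mono W_small off)
  also have "\<dots> = ennreal (1/2)" by (simp flip: ennreal_plus)
  finally have "emeasure lborel {0..1::real} \<le> ennreal (1/2)" .
  moreover have "emeasure lborel {0..1::real} = ennreal 1" by simp
  moreover have "\<not> ennreal 1 \<le> ennreal (1/2)" by (subst ennreal_le_iff) auto
  ultimately show False by (simp only:)
qed

end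

section \<open>Existence of a tower\<close>

text \<open>
A triangle wave: up to small errors, the height is 1 minus its value at the progress along the tube.
\<close>

definition zigzag :: "real \<Rightarrow> real" where
  "zigzag t = (if even \<lfloor>t\<rfloor> then t - \<lfloor>t\<rfloor> else 1 - (t - \<lfloor>t\<rfloor>))"

lemma zigzag_column:
  assumes "of_int k \<le> t" "t \<le> of_int k + 1"
  shows "zigzag t = (if even k then t - k else 1 - (t - k))"
proof (cases "t = of_int k + 1")
  case True
  then have "\<lfloor>t\<rfloor> = k + 1" by (simp add: floor_unique)
  then show ?thesis using True by (simp add: zigzag_def)
next
  case False
  then have "\<lfloor>t\<rfloor> = k" using assms by (simp add: floor_eq_iff)
  then show ?thesis by (simp add: zigzag_def)
qed

lemma zigzag_range: "0 \<le> zigzag t" "zigzag t \<le> 1"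
proof -
  obtain k :: int where k: "of_int k \<le> t" "t \<le> of_int k + 1"
    using of_int_floor_le[of t] real_of_int_floor_add_one_ge[of t] by blast
  show "0 \<le> zigzag t" "zigzag t \<le> 1" using k by (auto simp: zigzag_column[OF k])
qed

lemma zigzag_lipschitz: "\<bar>zigzag t - zigzag u\<bar> \<le> \<bar>t - u\<bar>"
proof -
  have *: "\<bar>zigzag t - zigzag u\<bar> \<le> u - t" if "t \<le> u" for t u
  proof -
    obtain k :: int where k: "of_int k \<le> t" "t \<le> of_int k + 1"
      using of_int_floor_le[of t] real_of_int_floor_add_one_ge[of t] by blast
    consider "u \<le> of_int k + 1" | "of_int k + 1 \<le> u" "u \<le> of_int k + 2" | "of_int k + 2 \<le> u" by linarith
    then show ?thesis
    proof cases
      case 1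
      then show ?thesis using zigzag_column[OF k] zigzag_column[of k u] k that by (cases "even k") auto
    next
      case 2
      then have u: "zigzag u = (if even (k + 1) then u - (k + 1) else 1 - (u - (k + 1)))"
        using zigzag_column[of "k + 1" u] by simp
      show ?thesis unfolding u zigzag_column[OF k] using 2 k by (cases "even k") (auto simp: abs_le_iff)
    next
      case 3
      then have "1 \<le> u - t" using k by linarith
      then show ?thesis using zigzag_range[of t] zigzag_range[of u] by (simp add: abs_le_iff)
    qed
  qed
  show ?thesis using *[of t u] *[of u t] by (cases "t \<le> u") (auto simp: abs_minus_commute)
qed

context meander begin

text \<open>
Inside the tube the old coordinates are determined by the new real part up to small errors: the
real part gives the column, and within the column it gives the height.
\<close>

lemma height_from_Re_step:
  assumes tube: "0 \<le> Im (N z)" "Im (N z) \<le> 1"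
  shows "\<bar>zigzag (Re (N z) / p) - (1 - Im z)\<bar> \<le> p + 3 * h"
proof -
  have v: "0 \<le> Im z" "Im z \<le> 1"
    using Im_step_above[of z] Im_step_below[of z] tube by (auto intro: leI)
  show ?thesis
  proof (rule column_cases[of "\<tau> z"])
    fix k assume t: "\<bar>\<tau> z - of_int k\<bar> < 3 * h / 2"
    have b: "if even k then 1 - h < Im z else Im z < h" by (rule tube_bend[OF t tube])
    have "Re (N z) / p = of_int k + p * (\<tau> z - k)"
    proof -
      have "clip h (Im z) = (if even k then 1 else 0)"
        using b h clip_eq_1[of h "Im z"] clip_eq_0[of h "Im z"] by (auto split: if_splits)
      then have "Re (N z) = p * (of_int k + p * (\<tau> z - k))"
        using Re_step_bend[OF t] by (simp add: algebra_simps)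
      then show ?thesis using p by simp
    qed
    then have "\<bar>zigzag (Re (N z) / p) - zigzag (of_int k)\<bar> \<le> \<bar>p * (\<tau> z - k)\<bar>"
      using zigzag_lipschitz[of "Re (N z) / p" "of_int k"] by simp
    also have "\<dots> \<le> p * 1" unfolding abs_mult using p t h by (intro mult_mono) auto
    finally have 1: "\<bar>zigzag (Re (N z) / p) - zigzag (of_int k)\<bar> \<le> p" by simp
    have "\<bar>zigzag (of_int k) - (1 - Im z)\<bar> \<le> h"
      using b v by (cases "even k") (auto simp: zigzag_def abs_le_iff)
    then show ?thesis using 1 h by linarith
  next
    fix k :: int assume t: "of_int k + h < \<tau> z" "\<tau> z < of_int k + 1 - h"
    define w where "w = turn h k (Im z)"
    have w: "0 \<le> w" "w \<le> 1" unfolding w_def by (rule turn_range)+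
    have "Re (N z) = p * ((k + (1 - w)) + p * (\<tau> z - k - (1 - w)))"
      using Re_step_straight[of k z] t by (simp add: w_def algebra_simps)
    then have "Re (N z) / p = (k + (1 - w)) + p * (\<tau> z - k - (1 - w))" using p by simp
    then have "\<bar>zigzag (Re (N z) / p) - zigzag (k + (1 - w))\<bar> \<le> \<bar>p * (\<tau> z - k - (1 - w))\<bar>"
      using zigzag_lipschitz[of "Re (N z) / p" "k + (1 - w)"] by simp
    also have "\<dots> \<le> p * 1" unfolding abs_mult using p t h w by (intro mult_mono) (auto simp: abs_le_iff)
    finally have 1: "\<bar>zigzag (Re (N z) / p) - zigzag (k + (1 - w))\<bar> \<le> p" by simp
    have "zigzag (k + (1 - w)) = 1 - clip h (Im z)"
      using zigzag_column[of k "k + (1 - w)"] w by (auto simp: w_def turn_def)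
    then show ?thesis using 1 clip_close[of h "Im z"] h v by linarith
  qed
qed

text \<open>
A piece of the new tube that advances by a small fraction of \<open>p\<close> is small, because it covers only a small
fraction of the length of a column.
\<close>

lemma step_fine:
  assumes tube: "0 \<le> Im (N z)" "Im (N z) \<le> 1" "0 \<le> Im (N w)" "Im (N w) \<le> 1"
    and r: "p \<le> r / 24" "h \<le> r / 48" and close: "\<bar>Re (N z) - Re (N w)\<bar> \<le> r * p / 6"
  shows "cmod (z - w) \<le> r"
proof -
  define d where "d = \<bar>Re (N z) - Re (N w)\<bar>"
  have "\<bar>zigzag (Re (N z) / p) - zigzag (Re (N w) / p)\<bar> \<le> d / p"
  proof -
    have "\<bar>Re (N z) / p - Re (N w) / p\<bar> = d / p" using p by (simp add: d_def flip: diff_divide_distrib)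
    then show ?thesis using zigzag_lipschitz[of "Re (N z) / p" "Re (N w) / p"] by simp
  qed
  then have im: "\<bar>Im z - Im w\<bar> \<le> d / p + 2 * p + 6 * h"
    using height_from_Re_step[OF tube(1,2)] height_from_Re_step[OF tube(3,4)] by linarith
  have "\<bar>Im z / s - Im w / s\<bar> \<le> \<bar>Im z - Im w\<bar>"
  proof -
    have "\<bar>Im z / s - Im w / s\<bar> = \<bar>Im z - Im w\<bar> / s" using s by (simp flip: diff_divide_distrib)
    also have "\<dots> \<le> \<bar>Im z - Im w\<bar> / 1" using s by (intro divide_left_mono) auto
    finally show ?thesis by simp
  qed
  then have re: "\<bar>Re z - Re w\<bar> \<le> d + 2 * p + \<bar>Im z - Im w\<bar>"
    using Re_step_skew[of z] Re_step_skew[of w] unfolding d_def by linarith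
  have "d / p \<le> r / 6" using close p by (simp add: d_def divide_le_eq)
  moreover have "d \<le> r / 12"
  proof -
    have "r * p / 6 \<le> r * (1/2) / 6" using p r by (intro divide_right_mono mult_left_mono) auto
    then have "r * p / 6 \<le> r / 12" by simp
    then show ?thesis using close unfolding d_def by linarith
  qed
  moreover have "cmod (z - w) \<le> \<bar>Re z - Re w\<bar> + \<bar>Im z - Im w\<bar>" using cmod_le[of "z - w"] by simp
  ultimately show ?thesis using im re r p by linarith
qed

end

text \<open>
The properties of the charts that are preserved when one more step is added.
\<close>

definition plane_chart :: "(complex \<Rightarrow> complex) \<Rightarrow> real \<Rightarrow> bool" where
  "plane_chart f L \<longleftrightarrow> 1 \<le> L \<and> (\<forall>z w. cmod (f w - f z) \<le> L * cmod (w - z)) \<and> inj f \<and> surj f \<and> (\<forall>z. f (z + 1) = f z + 1)"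

lemma plane_chart_translate:
  assumes "plane_chart f L" shows "f (z + of_int k) = f z + of_int k"
  using translate_of_int[of f 1] assms by (simp add: plane_chart_def)

text \<open>
The inverse is uniformly continuous on the strip because it commutes with integer translations and
the strip is compact modulo these.
\<close>

lemma plane_chart_inverse_modulus:
  assumes f: "plane_chart f L" and e: "0 < e"
  obtains r where "0 < r" "r \<le> 1"
    "\<And>z w. Im (f z) \<in> {0..1} \<Longrightarrow> Im (f w) \<in> {0..1} \<Longrightarrow> cmod (f z - f w) \<le> r \<Longrightarrow> cmod (z - w) \<le> e"
proof -
  have "L-lipschitz_on UNIV f" using f by (intro lipschitz_onI) (auto simp: dist_norm plane_chart_def)
  then have cont: "continuous_on UNIV f" by (rule lipschitz_on_continuous_on)
  have gf: "inv f (f z) = z" for z using f by (simp add: plane_chart_def)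
  have "continuous_on (f ` UNIV) (inv f)" by (rule continuous_on_inverse_open[OF open_UNIV cont]) (auto simp: gf)
  then have g: "continuous_on UNIV (inv f)" using f by (simp add: plane_chart_def)
  let ?B = "cbox (Complex (-1) 0) (Complex 2 1)"
  have "uniformly_continuous_on ?B (inv f)"
    by (intro compact_uniformly_continuous continuous_on_subset[OF g]) auto
  then obtain d where d: "0 < d" "\<And>x y. x \<in> ?B \<Longrightarrow> y \<in> ?B \<Longrightarrow> dist y x < d \<Longrightarrow> dist (inv f y) (inv f x) < e"
    unfolding uniformly_continuous_on_def using e by meson
  show thesis
  proof (rule that[of "min 1 (d / 2)"])
    show "0 < min 1 (d / 2)" "min 1 (d / 2) \<le> 1" using d by auto
    fix z w assume zw: "Im (f z) \<in> {0..1}" "Im (f w) \<in> {0..1}" "cmod (f z - f w) \<le> min 1 (d / 2)"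
    define k where "k = - \<lfloor>Re (f z)\<rfloor>"
    have fz: "f (z + of_int k) = f z + of_int k" and fw: "f (w + of_int k) = f w + of_int k"
      by (rule plane_chart_translate[OF f])+
    have "0 \<le> Re (f z) + k" "Re (f z) + k \<le> 1" unfolding k_def by linarith+
    moreover have "\<bar>Re (f z) - Re (f w)\<bar> \<le> 1" using abs_Re_le_cmod[of "f z - f w"] zw by simp
    ultimately have "f (z + of_int k) \<in> ?B" "f (w + of_int k) \<in> ?B"
      using zw by (auto simp: fz fw in_cbox_complex_iff)
    moreover have "dist (f (z + of_int k)) (f (w + of_int k)) < d"
      using zw d(1) by (simp add: fz fw dist_norm)
    ultimately have "dist (inv f (f (z + of_int k))) (inv f (f (w + of_int k))) < e" using d(2) by blast
    then show "cmod (z - w) \<le> e" by (simp add: gf dist_norm)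
  qed
qed

lemma small_reciprocal:
  assumes "0 < (P::real)" obtains K :: nat where "0 < 1 / (2 * real K)" "1 / (2 * real K) \<le> P"
proof -
  obtain K :: nat where K: "1 / P < real K" using reals_Archimedean2 by blast
  have "0 < 1 / P" using assms by simp
  then have K0: "0 < real K" using K by linarith
  have "1 / real K < P" using K K0 assms by (simp add: divide_less_eq mult.commute)
  then have "1 / (2 * real K) \<le> P" using K0 by (simp add: field_simps)
  then show thesis using K0 that[of K] by simp
qed

text \<open>
The order of the choices matters. First \<open>h\<close> is chosen in terms of the modulus \<open>r\<close> of the inverse chart, then
\<open>p\<close>, and finally \<open>s'\<close>. For odd \<open>n\<close> the value \<open>s' = 48 / (r * p)\<close> makes the next tube fine by \<open>step_fine\<close>.
It is large, but only of order \<open>1 / p\<close>, so that \<open>p\<^sup>2 * s'\<close> is still as small as required when \<open>p\<close> is small.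
\<close>

lemma next_step:
  fixes n :: nat
  assumes f: "plane_chart f L" and s: "1 \<le> s"
  obtains h p s' L' where "meander s p h" "\<exists>K::nat. p = 1 / (2 * real K)" "L \<le> L'" "1 \<le> s'"
    "plane_chart (\<lambda>z. step s p h (f z)) L'" "h \<le> (1/2) ^ n / 200"
    "48 * s * p\<^sup>2 * s' \<le> (1/2) ^ n / (8 * L)"
    "even n \<Longrightarrow> s' = s" "even n \<Longrightarrow> s * p * L \<le> (1/2) ^ n" "odd n \<Longrightarrow> 4 * s \<le> s'"
    "odd n \<Longrightarrow> (\<forall>z w. Im (step s p h (f z)) \<in> {0..1} \<longrightarrow> Im (step s p h (f w)) \<in> {0..1} \<longrightarrow>
      \<bar>Re (step s p h (f z)) - Re (step s p h (f w))\<bar> \<le> 8 / s' \<longrightarrow> cmod (z - w) \<le> (1/2) ^ n)"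
proof -
  have L: "1 \<le> L" using f by (simp add: plane_chart_def)
  define q where "q = (1/2::real) ^ n"
  have q: "0 < q" "q \<le> 1" by (auto simp: q_def power_le_one)
  obtain r where r: "0 < r" "r \<le> 1"
    "\<And>z w. Im (f z) \<in> {0..1} \<Longrightarrow> Im (f w) \<in> {0..1} \<Longrightarrow> cmod (f z - f w) \<le> r \<Longrightarrow> cmod (z - w) \<le> q"
    using plane_chart_inverse_modulus[OF f q(1)] by blast
  define h where "h = min (q / 200) (r / 48)"
  have h: "0 < h" "h \<le> q / 200" "h \<le> r / 48" using q r by (auto simp: h_def)
  define P where "P = min (h / (2 * s)) (min (r / 24) (q * r / (18432 * s\<^sup>2 * L)))"
  have P: "0 < P" using h s r q L by (simp add: P_def)
  obtain K :: nat where K: "0 < 1 / (2 * real K)" "1 / (2 * real K) \<le> P" using small_reciprocal[OF P] by blast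
  define p where "p = 1 / (2 * real K)"
  have p: "0 < p" "p \<le> h / (2 * s)" "p \<le> r / 24" "p \<le> q * r / (18432 * s\<^sup>2 * L)"
    using K by (auto simp: p_def P_def)
  have sp: "s * p \<le> h / 2" using p(2) s by (simp add: field_simps)
  have m: "meander s p h" using s p(1,3) r(2) h q sp by unfold_locales auto
  have ss: "s * 1 \<le> s * s" using s by (intro mult_left_mono) auto
  have key: "18432 * s\<^sup>2 * L * p \<le> q * r" using p(4) s L by (simp add: field_simps)
  have key': "18432 * (s * p * L) \<le> q * r"
  proof -
    have "s * (p * L) \<le> s\<^sup>2 * (p * L)" using s ss p(1) L by (intro mult_right_mono) (auto simp: power2_eq_square)
    then show ?thesis using key by (simp add: mult_ac)
  qed
  have qr: "q * r \<le> q" using q r by (simp add: mult_left_le)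
  define s' where "s' = (if even n then s else 48 / (r * p))"
  obtain L1 where L1: "1 \<le> L1" "\<And>z w. cmod (step s p h w - step s p h z) \<le> L1 * cmod (w - z)"
    using meander.step_lipschitz[OF m] by blast
  have fs: "plane_chart (\<lambda>z. step s p h (f z)) (L1 * L)"
    unfolding plane_chart_def
  proof (intro conjI allI)
    show "1 \<le> L1 * L" using mult_mono[of 1 L1 1 L] L1(1) L by simp
    show "cmod (step s p h (f w) - step s p h (f z)) \<le> L1 * L * cmod (w - z)" for z w
    proof -
      have "L1 * cmod (f w - f z) \<le> L1 * (L * cmod (w - z))"
        using f L1(1) by (intro mult_left_mono) (auto simp: plane_chart_def)
      then show ?thesis using L1(2)[of "f w" "f z"] by (simp add: mult.assoc)
    qed
    show "inj (\<lambda>z. step s p h (f z))"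
      using inj_compose[OF meander.step_inj[OF m], of f] f by (simp add: plane_chart_def o_def)
    show "surj (\<lambda>z. step s p h (f z))"
      using comp_surj[OF _ meander.step_surj[OF m], of f] f by (simp add: plane_chart_def o_def)
    show "step s p h (f (z + 1)) = step s p h (f z) + 1" for z
      using meander.step_translate[OF m p_def] f by (simp add: plane_chart_def)
  qed
  have rp: "0 < r * p" "r * p \<le> 1" using r p(1,3) mult_mono[of r 1 p 1] by auto
  have s'1: "1 \<le> s'" using s rp by (auto simp: s'_def le_divide_eq)
  show thesis
  proof (rule that[of p h "L1 * L" s', OF m])
    show "\<exists>K::nat. p = 1 / (2 * real K)" using p_def by blast
    show "L \<le> L1 * L" using mult_right_mono[OF L1(1), of L] L by simp
    show "1 \<le> s'" by (rule s'1)
    show "plane_chart (\<lambda>z. step s p h (f z)) (L1 * L)" by (rule fs)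
    show "h \<le> (1/2) ^ n / 200" using h by (simp add: q_def)
    show "48 * s * p\<^sup>2 * s' \<le> (1/2) ^ n / (8 * L)"
    proof -
      have "(48 * s * p\<^sup>2 * s') * (8 * L) \<le> q"
      proof (cases "even n")
        case True
        have "p * p \<le> p * 1" using p(1,3) r by (intro mult_left_mono) auto
        then have "384 * (s\<^sup>2 * L) * (p * p) \<le> 384 * (s\<^sup>2 * L) * p" using s L by (intro mult_left_mono) auto
        also have "\<dots> \<le> 18432 * s\<^sup>2 * L * p" using s L p(1) by simp
        also have "\<dots> \<le> q" using key qr by simp
        finally show ?thesis using True by (simp add: s'_def power2_eq_square mult_ac)
      next
        case False
        have "(48 * s * p\<^sup>2 * s') * (8 * L) = 18432 * (s * p * L) / r"
          using False p(1) r by (simp add: s'_def power2_eq_square field_simps)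
        also have "\<dots> \<le> q" using key' r by (simp add: divide_le_eq)
        finally show ?thesis .
      qed
      then show ?thesis using L by (simp add: q_def pos_le_divide_eq)
    qed
    show "s' = s" if "even n" using that by (simp add: s'_def)
    show "s * p * L \<le> (1/2) ^ n" if "even n"
    proof -
      have "0 \<le> s * p * L" using s p(1) L by simp
      then show ?thesis using key' qr unfolding q_def by linarith
    qed
    show "4 * s \<le> s'" if "odd n"
    proof -
      have "r * (s * p) \<le> 1 * 1" using r sp h q p(1) s by (intro mult_mono) auto
      then have "4 * s * (r * p) \<le> 48" by (simp add: mult_ac)
      then show ?thesis using that rp by (simp add: s'_def pos_le_divide_eq)
    qed
    show "\<forall>z w. Im (step s p h (f z)) \<in> {0..1} \<longrightarrow> Im (step s p h (f w)) \<in> {0..1} \<longrightarrow>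
      \<bar>Re (step s p h (f z)) - Re (step s p h (f w))\<bar> \<le> 8 / s' \<longrightarrow> cmod (z - w) \<le> (1/2) ^ n" if "odd n"
    proof (intro allI impI)
      fix z w assume zw: "Im (step s p h (f z)) \<in> {0..1}" "Im (step s p h (f w)) \<in> {0..1}"
        "\<bar>Re (step s p h (f z)) - Re (step s p h (f w))\<bar> \<le> 8 / s'"
      have "8 / s' = r * p / 6" using that by (simp add: s'_def)
      then have "cmod (f z - f w) \<le> r"
        using zw p(3) h(3) by (intro meander.step_fine[OF m]) auto
      moreover have "Im (f z) \<in> {0..1}" "Im (f w) \<in> {0..1}"
        using meander.Im_step_above[OF m, of "f z"] meander.Im_step_below[OF m, of "f z"]
          meander.Im_step_above[OF m, of "f w"] meander.Im_step_below[OF m, of "f w"] zw(1,2) by fastforce+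
      ultimately show "cmod (z - w) \<le> (1/2) ^ n" using r(3) by (simp add: q_def)
    qed
  qed
qed

lemma tower_exists: "\<exists>s p h L. tower s p h L"
proof -
  \<comment> \<open>A state consists of the chart of level \<open>n\<close>, the slope \<open>s n\<close>, and a Lipschitz constant of the chart.\<close>
  define good where "good = (\<lambda>(n::nat) (x :: (complex \<Rightarrow> complex) \<times> real \<times> real).
    plane_chart (fst x) (snd (snd x)) \<and> 1 \<le> fst (snd x) \<and> (n = 0 \<longrightarrow> fst x = (\<lambda>z. z)))"
  define link where "link = (\<lambda>n (x :: (complex \<Rightarrow> complex) \<times> real \<times> real) (y :: (complex \<Rightarrow> complex) \<times> real \<times> real) h p.
    meander (fst (snd x)) p h \<and> (\<exists>K::nat. p = 1 / (2 * real K)) \<and> snd (snd x) \<le> snd (snd y) \<and>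
    fst y = (\<lambda>z. step (fst (snd x)) p h (fst x z)) \<and> h \<le> (1/2) ^ n / 200 \<and>
    48 * fst (snd x) * p\<^sup>2 * fst (snd y) \<le> (1/2) ^ n / (8 * snd (snd x)) \<and>
    (even n \<longrightarrow> fst (snd y) = fst (snd x) \<and> fst (snd x) * p * snd (snd x) \<le> (1/2) ^ n) \<and>
    (odd n \<longrightarrow> 4 * fst (snd x) \<le> fst (snd y) \<and>
      (\<forall>z w. Im (fst y z) \<in> {0..1} \<longrightarrow> Im (fst y w) \<in> {0..1} \<longrightarrow>
        \<bar>Re (fst y z) - Re (fst y w)\<bar> \<le> 8 / fst (snd y) \<longrightarrow> cmod (z - w) \<le> (1/2) ^ n)))"
  have start: "\<exists>x. good 0 x"
    by (intro exI[of _ "(\<lambda>z. z, 1, 1)"]) (simp add: good_def plane_chart_def)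
  have extend: "\<exists>y. good (Suc n) y \<and> (\<exists>h p. link n x y h p)" if x: "good n x" for n x
  proof -
    have 1: "plane_chart (fst x) (snd (snd x))" "1 \<le> fst (snd x)" using x by (auto simp: good_def)
    show ?thesis
    proof (rule next_step[OF 1, of n])
      fix h p s' L'
      assume a: "meander (fst (snd x)) p h" "\<exists>K::nat. p = 1 / (2 * real K)" "snd (snd x) \<le> L'" "1 \<le> s'"
        "plane_chart (\<lambda>z. step (fst (snd x)) p h (fst x z)) L'" "h \<le> (1/2) ^ n / 200"
        "48 * fst (snd x) * p\<^sup>2 * s' \<le> (1/2) ^ n / (8 * snd (snd x))"
        "even n \<Longrightarrow> s' = fst (snd x)" "even n \<Longrightarrow> fst (snd x) * p * snd (snd x) \<le> (1/2) ^ n"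
        "odd n \<Longrightarrow> 4 * fst (snd x) \<le> s'"
        "odd n \<Longrightarrow> (\<forall>z w. Im (step (fst (snd x)) p h (fst x z)) \<in> {0..1} \<longrightarrow> Im (step (fst (snd x)) p h (fst x w)) \<in> {0..1} \<longrightarrow>
          \<bar>Re (step (fst (snd x)) p h (fst x z)) - Re (step (fst (snd x)) p h (fst x w))\<bar> \<le> 8 / s' \<longrightarrow> cmod (z - w) \<le> (1/2) ^ n)"
      let ?y = "(\<lambda>z. step (fst (snd x)) p h (fst x z), s', L')"
      have "good (Suc n) ?y" using a(4,5) by (simp add: good_def)
      moreover have "link n x ?y h p" using a unfolding link_def by auto
      ultimately show ?thesis by blast
    qed
  qed
  obtain X where X: "\<And>n. good n (X n)" "\<And>n. \<exists>h p. link n (X n) (X (Suc n)) h p"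
    using dependent_nat_choice[of good "\<lambda>n x y. \<exists>h p. link n x y h p", OF start extend] by blast
  obtain h p where hp: "\<And>n. link n (X n) (X (Suc n)) (h n) (p n)" using X(2) by metis
  define s L where "s n = fst (snd (X n))" and "L n = snd (snd (X n))" for n
  have level: "level s p h n = fst (X n)" for n
  proof (induction n)
    case 0 show ?case using X(1)[of 0] by (auto simp: good_def)
  next
    case (Suc n)
    have "fst (X (Suc n)) = (\<lambda>z. step (s n) (p n) (h n) (fst (X n) z))" using hp[of n] by (simp add: link_def s_def)
    then show ?case using Suc by auto
  qed
  have chart: "plane_chart (fst (X n)) (L n)" for n using X(1)[of n] by (simp add: good_def L_def)
  have linked: "meander (s n) (p n) (h n)" "\<exists>K::nat. p n = 1 / (2 * real K)" "L n \<le> L (Suc n)" "h n \<le> (1/2) ^ n / 200"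
    "48 * s n * (p n)\<^sup>2 * s (Suc n) \<le> (1/2) ^ n / (8 * L n)"
    "even n \<Longrightarrow> s (Suc n) = s n" "even n \<Longrightarrow> s n * p n * L n \<le> (1/2) ^ n"
    "odd n \<Longrightarrow> 4 * s n \<le> s (Suc n)" for n
    using hp[of n] unfolding link_def s_def L_def by blast+
  have lipschitz: "1 \<le> L n" "cmod (level s p h n w - level s p h n z) \<le> L n * cmod (w - z)" for n z w
    using chart[of n] by (simp_all add: plane_chart_def level)
  have fine: "cmod (z - w) \<le> (1/2) ^ n"
    if "odd n" "Im (level s p h (Suc n) z) \<in> {0..1}" "Im (level s p h (Suc n) w) \<in> {0..1}"
      "\<bar>Re (level s p h (Suc n) z) - Re (level s p h (Suc n) w)\<bar> \<le> 8 / s (Suc n)" for n z w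
    using hp[of n] that unfolding link_def level s_def by blast
  have "tower s p h L"
    by (rule tower.intro) (rule linked lipschitz fine; assumption)+
  then show ?thesis by blast
qed

section \<open>The theorem\<close>

theorem theorem1p1:
  shows "\<exists>\<Gamma> :: complex set. jordan_curve \<Gamma> \<and>
    (\<forall>\<sigma> :: real \<Rightarrow> complex. \<forall>U V.
       nonclosed_arc \<sigma> \<and> rectifiable \<sigma> \<and>
       U \<in> components (- \<Gamma>) \<and> V \<in> components (- \<Gamma>) \<and> U \<noteq> V \<and>
       pathstart \<sigma> \<in> U \<and> pathfinish \<sigma> \<in> V
       \<longrightarrow> hausdorff_measure1 (path_image \<sigma> \<inter> \<Gamma>) > 0)"
proof -
  obtain s p h L where "tower s p h L" using tower_exists by blast
  then interpret tower s p h L .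
  show ?thesis
    using jordan_curve_curve rectifiable_crossing_positive unfolding nonclosed_arc_def by blast
qed

end
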